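(* Let $g:\mathbb R\to[0,\infty)$ be a continuous function with $g(0)=0$ which is strictly decreasing and strictly convex on $(-\infty,0]$ and strictly increasing on $[0,\infty)$. Set $f(x)=g(\log x)$ for $x>0$. Let $\mathcal M,\mathcal N$ be connected, compact, oriented smooth $2$-dimensional Riemannian manifolds (possibly with Lipschitz boundaries) with $V_{\mathcal N}\le V_{\mathcal M}$. Then for any $\phi\in\operatorname{Lip}_+^{\mathrm{inj}}(\mathcal M,\mathcal N)$ with $V_{\phi(\mathcal M)}>0$, $$E_f(\phi)\ge F_f\left(\frac{V_{\phi(\mathcal M)}}{V_{\mathcal M}}\right),$$ and equality holds if and only if $\phi$ is a homothety. Thus, if there exists an injective homothety, it is energy-minimizing among the maps in $\operatorname{Lip}_+^{\mathrm{inj}}(\mathcal M,\mathcal N)$ whose images have the same area. Finally, for every $\phi\in\operatorname{Lip}_+^{\mathrm{inj}}(\mathcal M,\mathcal N)$, $E_f(\phi)\ge F_f(V_{\mathcal N}/V_{\mathcal M})$, with equality if and only if $\phi$ is a surjective homothety.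
   Context: $V_X$ is the Riemannian area of $X$; $\mathfrak g,\mathfrak h$ are the metrics of $\mathcal M,\mathcal N$. $\operatorname{Lip}_+^{\mathrm{inj}}(\mathcal M,\mathcal N)$ is the set of Lipschitz maps $\phi:\mathcal M\to\mathcal N$ whose signed Jacobian $J\phi$ (determinant of $d\phi$ with respect to metrics and orientations) is $\ge0$ a.e. and with $|\phi^{-1}(q)|\le1$ for a.e. $q\in\mathcal N$. With $\sigma_1(d\phi),\sigma_2(d\phi)$ the singular values of $d\phi$ (with respect to $\mathfrak g,\mathfrak h$), $$E_f(\phi)=\frac1{V_{\mathcal M}}\int_{\mathcal M}\big(f(\sigma_1(d\phi))+f(\sigma_2(d\phi))\big)\in[0,\infty],$$ with the convention $f(0)=\lim_{x\to0^+}f(x)=+\infty$. For $s\in(0,\infty)$, $$F_f(s)=\min_{xy=s,\ x,y>0}\big(f(x)+f(y)\big).$$ $\phi$ is a homothety if $\phi^*\mathfrak h=\lambda^2\mathfrak g$ for some constant $\lambda>0$ (for Lipschitz $\phi$: a.e.; such orientation-preserving maps are automatically smooth). *)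

theory Defs
  imports "HOL-Analysis.Analysis"
begin

section \<open>Smooth maps on subsets of Euclidean space\<close>

fun Ck_on :: "nat \<Rightarrow> 'a::real_normed_vector set \<Rightarrow> ('a \<Rightarrow> 'b::real_normed_vector) \<Rightarrow> bool" where
  "Ck_on 0 U f \<longleftrightarrow> continuous_on U f"
| "Ck_on (Suc k) U f \<longleftrightarrow>
     (\<forall>x\<in>U. f differentiable (at x)) \<and> (\<forall>v. Ck_on k U (\<lambda>x. frechet_derivative f (at x) v))"

text \<open>Smoothness on a set that need not be open: local existence of smooth extensions.\<close>

definition smooth_on_set :: "'a::real_normed_vector set \<Rightarrow> ('a \<Rightarrow> 'b::real_normed_vector) \<Rightarrow> bool" where
  "smooth_on_set S f \<longleftrightarrow>
     (\<forall>x\<in>S. \<exists>U h. open U \<and> x \<in> U \<and> (\<forall>k. Ck_on k U h) \<and> (\<forall>y\<in>S \<inter> U. h y = f y))"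


section \<open>Oriented Riemannian surfaces with Lipschitz boundary\<close>

record 'a chart =
  chart_dom :: "'a set"
  chart_map :: "'a \<Rightarrow> real^2"

text \<open>\<open>gram M c x\<close> is the matrix of the Riemannian metric in the coordinates of the chart \<open>c\<close>,
  at the point of \<open>M\<close> whose coordinates are \<open>x\<close>. The orientation is the one for which
  all charts of the atlas are positively oriented.\<close>

record 'a surface =
  surf_top :: "'a topology"
  atlas :: "'a chart set"
  gram :: "'a chart \<Rightarrow> real^2 \<Rightarrow> real^2^2"

abbreviation points :: "'a surface \<Rightarrow> 'a set" where
  "points M \<equiv> topspace (surf_top M)"

definition chart_inv :: "'a chart \<Rightarrow> real^2 \<Rightarrow> 'a" where
  "chart_inv c = inv_into (chart_dom c) (chart_map c)"

text \<open>Charts take values in the plane (interior charts) or in the closed epigraph of a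
  Lipschitz function (boundary charts).\<close>

definition model_region :: "(real^2) set \<Rightarrow> bool" where
  "model_region R \<longleftrightarrow>
     R = UNIV \<or> (\<exists>\<gamma> L. L-lipschitz_on (UNIV :: real set) \<gamma> \<and> R = {x. \<gamma> (x $ 1) \<le> x $ 2})"

definition is_chart :: "'a topology \<Rightarrow> 'a chart \<Rightarrow> bool" where
  "is_chart X c \<longleftrightarrow>
     openin X (chart_dom c) \<and>
     homeomorphic_map (subtopology X (chart_dom c))
       (top_of_set (chart_map c ` chart_dom c)) (chart_map c) \<and>
     (\<exists>R. model_region R \<and> openin (top_of_set R) (chart_map c ` chart_dom c))"

text \<open>Transition maps are smooth (up to the boundary) and orientation preserving, and the
  local expressions of the metric are related by the tensor transformation rule.\<close>

definition compatible_charts :: "'a surface \<Rightarrow> 'a chart \<Rightarrow> 'a chart \<Rightarrow> bool" where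
  "compatible_charts M c d \<longleftrightarrow>
     (let S = chart_map c ` (chart_dom c \<inter> chart_dom d); \<tau> = chart_map d \<circ> chart_inv c in
        smooth_on_set S \<tau> \<and>
        (\<forall>x\<in>S. \<exists>T :: real^2^2. (\<tau> has_derivative (*v) T) (at x within S) \<and> 0 < det T \<and>
           gram M c x = transpose T ** gram M d (\<tau> x) ** T))"

definition is_riemannian_gram :: "'a surface \<Rightarrow> 'a chart \<Rightarrow> bool" where
  "is_riemannian_gram M c \<longleftrightarrow>
     smooth_on_set (chart_map c ` chart_dom c) (gram M c) \<and>
     (\<forall>x\<in>chart_map c ` chart_dom c.
        transpose (gram M c x) = gram M c x \<and> (\<forall>v. v \<noteq> 0 \<longrightarrow> 0 < v \<bullet> (gram M c x *v v)))"

text \<open>Second countability need not be required: it follows from compactness and the charts.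
  Connected manifolds are nonempty by convention.\<close>

definition compact_connected_riemannian_surface :: "'a surface \<Rightarrow> bool" where
  "compact_connected_riemannian_surface M \<longleftrightarrow>
     points M \<noteq> {} \<and> Hausdorff_space (surf_top M) \<and>
     compact_space (surf_top M) \<and> connected_space (surf_top M) \<and>
     (\<forall>c\<in>atlas M. is_chart (surf_top M) c \<and> is_riemannian_gram M c) \<and>
     (\<Union>c\<in>atlas M. chart_dom c) = points M \<and>
     (\<forall>c\<in>atlas M. \<forall>d\<in>atlas M. compatible_charts M c d)"

text \<open>Pointwise notions below are computed in an arbitrarily chosen chart; by compatibility of
  the charts they do not depend on it.\<close>

definition chart_at :: "'a surface \<Rightarrow> 'a \<Rightarrow> 'a chart" where
  "chart_at M p = (SOME c. c \<in> atlas M \<and> p \<in> chart_dom c)"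

definition gram_at :: "'a surface \<Rightarrow> 'a \<Rightarrow> real^2^2" where
  "gram_at M p = gram M (chart_at M p) (chart_map (chart_at M p) p)"


section \<open>Riemannian distance and area\<close>

text \<open>No condition on the one-sided derivatives at the finitely many exceptional times: this does
  not change the infimum of the lengths.\<close>

definition piecewise_C1_curve :: "'a surface \<Rightarrow> (real \<Rightarrow> 'a) \<Rightarrow> bool" where
  "piecewise_C1_curve M \<gamma> \<longleftrightarrow>
     pathin (surf_top M) \<gamma> \<and>
     (\<exists>S. finite S \<and> (\<forall>c\<in>atlas M.
        (chart_map c \<circ> \<gamma>) C1_differentiable_on {t \<in> {0<..<1} - S. \<gamma> t \<in> chart_dom c}))"

definition speed :: "'a surface \<Rightarrow> (real \<Rightarrow> 'a) \<Rightarrow> real \<Rightarrow> real" where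
  "speed M \<gamma> t =
     (let v = vector_derivative (chart_map (chart_at M (\<gamma> t)) \<circ> \<gamma>) (at t)
      in sqrt (v \<bullet> (gram_at M (\<gamma> t) *v v)))"

definition curve_length :: "'a surface \<Rightarrow> (real \<Rightarrow> 'a) \<Rightarrow> ennreal" where
  "curve_length M \<gamma> = (\<integral>\<^sup>+t\<in>{0..1}. ennreal (speed M \<gamma> t) \<partial>lborel)"

definition riemannian_dist :: "'a surface \<Rightarrow> 'a \<Rightarrow> 'a \<Rightarrow> ennreal" where
  "riemannian_dist M p q =
     Inf {curve_length M \<gamma> | \<gamma>. piecewise_C1_curve M \<gamma> \<and> \<gamma> 0 = p \<and> \<gamma> 1 = q}"

text \<open>The Riemannian area is the unique Borel measure given in every chart by the density
  \<open>sqrt (det (gram M c x))\<close>.\<close>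

definition riemannian_area :: "'a surface \<Rightarrow> 'a measure" where
  "riemannian_area M = (THE \<mu>.
     sets \<mu> = sigma_sets (points M) {U. openin (surf_top M) U} \<and>
     (\<forall>c\<in>atlas M. \<forall>A\<in>sets \<mu>. A \<subseteq> chart_dom c \<longrightarrow>
        emeasure \<mu> A = (\<integral>\<^sup>+x\<in>chart_map c ` A. ennreal (sqrt (det (gram M c x))) \<partial>lborel)))"

abbreviation area :: "'a surface \<Rightarrow> 'a set \<Rightarrow> real" where
  "area M A \<equiv> measure (riemannian_area M) A"


section \<open>Maps between surfaces\<close>

definition lipschitz_map :: "'a surface \<Rightarrow> 'b surface \<Rightarrow> ('a \<Rightarrow> 'b) \<Rightarrow> bool" where
  "lipschitz_map M N \<phi> \<longleftrightarrow>
     \<phi> \<in> points M \<rightarrow> points N \<and>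
     (\<exists>L\<ge>0. \<forall>p\<in>points M. \<forall>q\<in>points M.
        riemannian_dist N (\<phi> p) (\<phi> q) \<le> ennreal L * riemannian_dist M p q)"

definition local_rep :: "'a surface \<Rightarrow> 'b surface \<Rightarrow> ('a \<Rightarrow> 'b) \<Rightarrow> 'a \<Rightarrow> real^2 \<Rightarrow> real^2" where
  "local_rep M N \<phi> p = chart_map (chart_at N (\<phi> p)) \<circ> \<phi> \<circ> chart_inv (chart_at M p)"

definition coord_filter :: "'a surface \<Rightarrow> 'a \<Rightarrow> (real^2) filter" where
  "coord_filter M p = (let c = chart_at M p in at (chart_map c p) within chart_map c ` chart_dom c)"

definition differentiable_at_point :: "'a surface \<Rightarrow> 'b surface \<Rightarrow> ('a \<Rightarrow> 'b) \<Rightarrow> 'a \<Rightarrow> bool" where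
  "differentiable_at_point M N \<phi> p \<longleftrightarrow> local_rep M N \<phi> p differentiable coord_filter M p"

definition diff_matrix :: "'a surface \<Rightarrow> 'b surface \<Rightarrow> ('a \<Rightarrow> 'b) \<Rightarrow> 'a \<Rightarrow> real^2^2" where
  "diff_matrix M N \<phi> p = matrix (frechet_derivative (local_rep M N \<phi> p) (coord_filter M p))"

text \<open>The determinant of the differential with respect to positively oriented orthonormal bases
  of the two tangent spaces.\<close>

definition jacobian :: "'a surface \<Rightarrow> 'b surface \<Rightarrow> ('a \<Rightarrow> 'b) \<Rightarrow> 'a \<Rightarrow> real" where
  "jacobian M N \<phi> p =
     sqrt (det (gram_at N (\<phi> p))) / sqrt (det (gram_at M p)) * det (diff_matrix M N \<phi> p)"

text \<open>The matrix of the adjoint of the differential (with respect to the two metrics) composed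
  with the differential; the singular values are the square roots of its eigenvalues,
  counted with multiplicity.\<close>

definition adjoint_diff_matrix :: "'a surface \<Rightarrow> 'b surface \<Rightarrow> ('a \<Rightarrow> 'b) \<Rightarrow> 'a \<Rightarrow> real^2^2" where
  "adjoint_diff_matrix M N \<phi> p =
     matrix_inv (gram_at M p) **
       (transpose (diff_matrix M N \<phi> p) ** gram_at N (\<phi> p) ** diff_matrix M N \<phi> p)"

definition singular_values :: "'a surface \<Rightarrow> 'b surface \<Rightarrow> ('a \<Rightarrow> 'b) \<Rightarrow> 'a \<Rightarrow> real \<times> real" where
  "singular_values M N \<phi> p = (THE \<sigma>. 0 \<le> snd \<sigma> \<and> snd \<sigma> \<le> fst \<sigma> \<and>
     (\<forall>t. det (mat t - adjoint_diff_matrix M N \<phi> p) = (t - (fst \<sigma>)\<^sup>2) * (t - (snd \<sigma>)\<^sup>2)))"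

text \<open>The Jacobian is only defined where the map is differentiable, so a statement about it
  almost everywhere includes differentiability almost everywhere. For Lipschitz maps the latter
  is no restriction (Rademacher). The same applies to \<open>homothety\<close> below.\<close>

definition Lip_inj_plus :: "'a surface \<Rightarrow> 'b surface \<Rightarrow> ('a \<Rightarrow> 'b) set" where
  "Lip_inj_plus M N = {\<phi>. lipschitz_map M N \<phi> \<and>
     (AE p in riemannian_area M. differentiable_at_point M N \<phi> p \<and> 0 \<le> jacobian M N \<phi> p) \<and>
     (AE q in riemannian_area N. \<exists>\<^sub>\<le>\<^sub>1 p. p \<in> points M \<and> \<phi> p = q)}"

definition homothety :: "'a surface \<Rightarrow> 'b surface \<Rightarrow> ('a \<Rightarrow> 'b) \<Rightarrow> bool" where
  "homothety M N \<phi> \<longleftrightarrow> lipschitz_map M N \<phi> \<and>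
     (\<exists>r>0. AE p in riemannian_area M. differentiable_at_point M N \<phi> p \<and>
        transpose (diff_matrix M N \<phi> p) ** gram_at N (\<phi> p) ** diff_matrix M N \<phi> p
          = r\<^sup>2 *\<^sub>R gram_at M p)"


section \<open>Energy\<close>

text \<open>The integrand \<open>f\<close> only matters on the positive reals; it is extended by infinity at 0.\<close>

definition extend_at_0 :: "(real \<Rightarrow> real) \<Rightarrow> real \<Rightarrow> ennreal" where
  "extend_at_0 f x = (if 0 < x then ennreal (f x) else \<infinity>)"

definition energy :: "(real \<Rightarrow> real) \<Rightarrow> 'a surface \<Rightarrow> 'b surface \<Rightarrow> ('a \<Rightarrow> 'b) \<Rightarrow> ennreal" where
  "energy f M N \<phi> =
     (\<integral>\<^sup>+p. extend_at_0 f (fst (singular_values M N \<phi> p))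
           + extend_at_0 f (snd (singular_values M N \<phi> p)) \<partial>riemannian_area M)
     / ennreal (area M (points M))"

definition min_pair_energy :: "(real \<Rightarrow> real) \<Rightarrow> real \<Rightarrow> real" where
  "min_pair_energy f s = (LEAST m. \<exists>x>0. \<exists>y>0. x * y = s \<and> m = f x + f y)"

definition strictly_convex_on :: "real set \<Rightarrow> (real \<Rightarrow> real) \<Rightarrow> bool" where
  "strictly_convex_on S g \<longleftrightarrow> convex S \<and>
     (\<forall>x\<in>S. \<forall>y\<in>S. \<forall>t. x \<noteq> y \<longrightarrow> 0 < t \<longrightarrow> t < 1 \<longrightarrow>
        g ((1 - t) * x + t * y) < (1 - t) * g x + t * g y)"

end

theory Submission
  imports Defs
begin

text \<open>Put \<open>s = area (\<phi> M) / area M \<le> 1\<close> and \<open>v = ln s / 2 \<le> 0\<close>. Since \<open>g\<close> is strictly convex and decreasing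
  on the nonpositive reals and nonnegative elsewhere, it has a supporting line of slope \<open>- m \<le> 0\<close> at \<open>v\<close>
  on the whole real line, touching \<open>g\<close> only at \<open>v\<close>. Evaluated at the logarithms of the singular values,
  whose sum is the logarithm of the Jacobian \<open>J\<close>, and combined with \<open>ln x \<le> x - 1\<close>, it bounds the energy
  density from below by \<open>2 * g v - m * (J / s - 1)\<close>, with equality only if both singular values are \<open>sqrt s\<close>.
  By the area formula \<open>J\<close> has mean value \<open>s\<close>, so that integration yields the bound
  \<open>2 * g v = F\<^sub>f s\<close>, attained exactly by the homotheties.

  The area formula needs a Lipschitz map to be locally Lipschitz in coordinates, hence the two-sided
  comparison of the Riemannian distance with the Euclidean distance in charts.\<close>

section \<open>Convexity and singular values\<close>

text \<open>Only the mean of the Jacobian is controlled, not the mean of its logarithm. This is why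
  the sum of two supporting lines, affine in \<open>ln J\<close>, is weakened to an expression
  affine in \<open>J\<close>; the weakening goes the right way because the slope is nonpositive. The
  hypothesis on the total areas forces \<open>s \<le> 1\<close>, so that the contact point lies in
  the half line where \<open>g\<close> is convex; on the other half line only monotonicity is
  assumed. For \<open>s = 1\<close> the slope is zero, and rigidity still follows since the line
  touches \<open>g\<close> at one point only.

  The last claim reduces to the first: \<open>F\<close> decreases strictly up to 1, an image of zero
  area costs infinite energy, and a compact image of full area leaves out an open null set, which
  must be empty.

  Two technical obstacles shape the rest. Pointwise quantities are computed in charts chosen without
  any regularity, so they are rewritten in fixed charts on finitely many Borel pieces. And a
  derivative is only Lebesgue measurable in coordinates, so measurability is stated for the
  completion of the area, which leaves the integrals unchanged.\<close>

lemma convex_decreasing_support: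
  fixes g :: "real \<Rightarrow> real"
  assumes nonneg: "\<And>t. 0 \<le> g t" and g0: "g 0 = 0"
    and anti: "strict_antimono_on {..0} g" and conv: "strictly_convex_on {..0} g"
    and mono: "strict_mono_on {0..} g" and v: "v \<le> 0"
  shows "\<exists>m\<ge>0. \<forall>x. g v - m * (x - v) \<le> g x \<and> (g x = g v - m * (x - v) \<longrightarrow> x = v)"
proof (cases "v = 0")
  case True
  have pos: "0 < g x" if "x \<noteq> 0" for x
  proof (cases "x < 0")
    case True
    then show ?thesis using monotone_onD[OF anti, of x 0] g0 by auto
  next
    case False
    then show ?thesis using monotone_onD[OF mono, of 0 x] g0 that by auto
  qed
  \<comment> \<open>At the corner between the convex and the merely increasing half, slope 0 works
    because \<open>g\<close> vanishes only at 0.\<close>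
  show ?thesis
  proof (intro exI[of _ 0] conjI allI impI)
    show "x = v" if "g x = g v - 0 * (x - v)" for x
      using pos[of x] that True g0 by force
  qed (use True g0 nonneg in auto)
next
  case False
  with v have v: "v < 0" by simp
  have sc: "g ((1 - t) * x + t * y) < (1 - t) * g x + t * g y"
    if "x \<le> 0" "y \<le> 0" "x \<noteq> y" "0 < t" "t < 1" for x y t
    using conv that unfolding strictly_convex_on_def by auto
  have cvx: "convex_on {..0} g"
  proof (rule convex_onI)
    show "g ((1 - t) *\<^sub>R x + t *\<^sub>R y) \<le> (1 - t) * g x + t * g y"
      if "0 < t" "t < 1" "x \<in> {..0}" "y \<in> {..0}" for t x y
      using sc[of x y t] that by (cases "x = y") (auto simp: algebra_simps)
  qed auto
  \<comment> \<open>The infimum of the difference quotients to the right of \<open>v\<close> is the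
    right derivative of \<open>g\<close> at \<open>v\<close>; \<open>m\<close> is its
    negative.\<close>
  define m where "m = - Inf ((\<lambda>t. (g v - g t) / (v - t)) ` ({v<..} \<inter> {..0}))"
  have line: "g v - m * (y - v) \<le> g y" if "y \<le> 0" for y
    using convex_le_Inf_differential[OF cvx, of v y] v that by (simp add: m_def)
  have gv: "0 < g v" using monotone_onD[OF anti, of v 0] v g0 by auto
  have mpos: "0 < m"
  proof -
    have "g v \<le> m * (0 - v)" using line[of 0] g0 by simp
    with gv have "0 < m * (- v)" by simp
    then show ?thesis using v by (simp only: zero_less_mult_iff) auto
  qed
  have strict: "g v - m * (x - v) < g x" if "x \<noteq> v" for x
  proof (cases "x \<le> 0")
    case True
    \<comment> \<open>If the line also touched \<open>g\<close> at \<open>x\<close>, strict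
      convexity would put \<open>g\<close> strictly below the line at the midpoint.\<close>
    have "g ((1 - 1/2) * x + 1/2 * v) < (1 - 1/2) * g x + 1/2 * g v"
      using True v that by (intro sc) auto
    moreover have "g v - m * (((1 - 1/2) * x + 1/2 * v) - v) \<le> g ((1 - 1/2) * x + 1/2 * v)"
      using True v by (intro line) auto
    ultimately show ?thesis by (simp add: algebra_simps)
  next
    case False
    \<comment> \<open>Beyond 0 there is no convexity, but the line has already fallen to at most
      \<open>g 0 = 0\<close> and keeps falling, while \<open>g\<close> is nonnegative.\<close>
    have "g v - m * (x - v) < g v - m * (0 - v)" using mpos False by (simp add: algebra_simps)
    also have "\<dots> \<le> 0" using line[of 0] g0 by simp
    finally show ?thesis using nonneg[of x] by simp
  qed
  show ?thesis
  proof (intro exI[of _ m] conjI allI impI)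
    show "g v - m * (x - v) \<le> g x" for x
      using strict[of x] by (cases "x = v") auto
    show "x = v" if "g x = g v - m * (x - v)" for x
      using strict[of x] that by force
  qed (use mpos in auto)
qed

text \<open>Evaluate the supporting line at \<open>ln s / 2\<close> in the logarithms of both
  factors. The logarithms add up to \<open>ln s\<close>, so the linear terms cancel and the balanced
  pair \<open>sqrt s\<close>, \<open>sqrt s\<close> is optimal.\<close>

lemma min_pair_energy_eq:
  fixes g f :: "real \<Rightarrow> real"
  assumes nonneg: "\<And>t. 0 \<le> g t" and g0: "g 0 = 0"
    and anti: "strict_antimono_on {..0} g" and conv: "strictly_convex_on {..0} g"
    and mono: "strict_mono_on {0..} g" and f: "\<And>x. 0 < x \<Longrightarrow> f x = g (ln x)"
    and s: "0 < s" "s \<le> 1"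
  shows "min_pair_energy f s = 2 * g (ln s / 2)"
  unfolding min_pair_energy_def
proof (rule Least_equality)
  have "f (sqrt s) = g (ln s / 2)" using s f[of "sqrt s"] by (simp add: ln_sqrt)
  then show "\<exists>x>0. \<exists>y>0. x * y = s \<and> 2 * g (ln s / 2) = f x + f y"
    using s by (intro exI[of _ "sqrt s"] conjI) auto
next
  fix y assume "\<exists>x>0. \<exists>z>0. x * z = s \<and> y = f x + f z"
  then obtain x z where xz: "x > 0" "z > 0" "x * z = s" and y: "y = f x + f z" by auto
  have "ln s / 2 \<le> 0" using s by simp
  from convex_decreasing_support[OF nonneg g0 anti conv mono this]
  obtain m where m: "0 \<le> m" "\<And>x. g (ln s / 2) - m * (x - ln s / 2) \<le> g x" by auto
  define u w where "u = ln x" and "w = ln z"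
  have uw: "u + w = ln s" using ln_mult_pos[OF xz(1,2)] unfolding xz(3) u_def w_def by (rule sym)
  have "m * (ln s / 2 - u) + m * (ln s / 2 - w) = m * (ln s - (u + w))"
    by (simp add: algebra_simps)
  then have "m * (u - ln s / 2) + m * (w - ln s / 2) = 0"
    unfolding uw by (simp add: algebra_simps)
  moreover have "y = g u + g w" unfolding y u_def w_def using f[OF xz(1)] f[OF xz(2)] by (rule arg_cong2)
  ultimately show "2 * g (ln s / 2) \<le> y"
    using m(2)[of u] m(2)[of w] by linarith
qed

section \<open>Positive definite matrices of size two\<close>

definition posdef :: "real^2^2 \<Rightarrow> bool" where
  "posdef G \<longleftrightarrow> transpose G = G \<and> (\<forall>v. v \<noteq> 0 \<longrightarrow> 0 < v \<bullet> (G *v v))"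

lemma vec2_inner: "v \<bullet> (G *v w) = v$1 * (G$1$1 * w$1 + G$1$2 * w$2) + v$2 * (G$2$1 * w$1 + G$2$2 * w$2)"
  for G :: "real^2^2"
  by (simp add: inner_vec_def sum_2 matrix_vector_mult_def)

lemma posdef_entries:
  assumes "posdef G"
  shows "0 < G$1$1" "G$2$1 = G$1$2" "0 < det G" "det G = G$1$1 * G$2$2 - (G$1$2)\<^sup>2"
proof -
  have "transpose G $ 1 $ 2 = G $ 1 $ 2" using assms by (simp add: posdef_def)
  then show sym: "G$2$1 = G$1$2" by (simp add: transpose_def)
  have pos: "0 < v \<bullet> (G *v v)" if "v \<noteq> 0" for v
    using assms that by (simp add: posdef_def)
  have "vector [1, 0] \<noteq> (0::real^2)" by (simp add: vec_eq_iff forall_2)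
  from pos[OF this] show 11: "0 < G$1$1" by (simp add: vec2_inner)
  show d: "det G = G$1$1 * G$2$2 - (G$1$2)\<^sup>2" by (simp add: det_2 sym power2_eq_square)
  \<comment> \<open>On this vector, which the first row of \<open>G\<close> annihilates, the
    quadratic form equals \<open>G$1$1 * det G\<close>.\<close>
  have "vector [- G$1$2, G$1$1] \<noteq> (0::real^2)" using 11 by (simp add: vec_eq_iff forall_2)
  from pos[OF this] have "0 < G$1$1 * det G"
    by (simp add: vec2_inner d sym power2_eq_square algebra_simps)
  then show "0 < det G" using 11 by (simp add: zero_less_mult_iff)
qed

lemma posdef_invertible: "posdef G \<Longrightarrow> invertible G"
  using posdef_entries(3)[of G] by (simp add: invertible_det_nz)

lemma matrix_inv_mult:
  assumes "invertible (A :: real^'n^'n)"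
  shows "matrix_inv A ** A = mat 1" "A ** matrix_inv A = mat 1"
  using someI_ex[OF assms[unfolded invertible_def]] unfolding matrix_inv_def by auto

text \<open>Cramer's rule, which turns the trace of \<open>matrix_inv G ** P\<close> into an
  explicit rational expression in the entries.\<close>

lemma matrix_inv_2:
  fixes G :: "real^2^2"
  assumes "det G \<noteq> 0"
  shows "matrix_inv G = (1 / det G) *\<^sub>R vector [vector [G$2$2, - G$1$2], vector [- G$2$1, G$1$1]]"
    (is "_ = ?H")
proof -
  have "G ** ?H = mat 1"
    using assms by (simp add: vec_eq_iff forall_2 matrix_matrix_mult_def sum_2 mat_def field_simps)
       (simp add: det_2 algebra_simps)
  then have "matrix_inv G ** (G ** ?H) = matrix_inv G" by simp
  then show ?thesis
    using matrix_inv_mult(1)[of G] assms by (simp add: matrix_mul_assoc invertible_det_nz)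
qed

lemma transpose_congruence_sym:
  fixes D G :: "real^2^2"
  assumes "transpose G = G"
  shows "transpose (transpose D ** G ** D) = transpose D ** G ** D"
  by (simp add: matrix_transpose_mul assms matrix_mul_assoc)

lemma congruence_inner:
  fixes T G :: "real^'n^'n"
  shows "(T *v v) \<bullet> (G *v (T *v v)) = v \<bullet> ((transpose T ** G ** T) *v v)"
proof -
  have "v \<bullet> ((transpose T ** G ** T) *v v) = (transpose T *v (G *v (T *v v))) \<bullet> v"
    by (simp only: matrix_vector_mul_assoc inner_commute matrix_mul_assoc)
  also have "\<dots> = (G *v (T *v v)) \<bullet> (T *v v)"
    by (simp only: transpose_matrix_vector dot_lmul_matrix)
  finally show ?thesis by (simp only: inner_commute)
qed

lemma congruence_psd:
  fixes D G :: "real^2^2"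
  assumes "posdef G"
  shows "0 \<le> v \<bullet> ((transpose D ** G ** D) *v v)"
  unfolding congruence_inner[symmetric]
  using assms by (cases "D *v v = 0") (auto simp: posdef_def less_imp_le)

section \<open>Trace, determinant and singular values of the pulled-back metric\<close>

definition trace2 :: "real^2^2 \<Rightarrow> real" where
  "trace2 A = A$1$1 + A$2$2"

lemma trace2_commute: "trace2 (A ** B) = trace2 (B ** A)"
  by (simp add: trace2_def matrix_matrix_mult_def sum_2 algebra_simps)

lemma det_mat_minus_2: "det (mat t - A) = t\<^sup>2 - trace2 A * t + det (A :: real^2^2)"
  by (simp add: det_2 trace2_def mat_def power2_eq_square algebra_simps)

text \<open>The discriminant of the characteristic polynomial of \<open>G\<inverse> P\<close> is nonnegative because
  \<open>det (P - t G)\<close> is nonpositive at \<open>t = P\<^sub>1\<^sub>1 / G\<^sub>1\<^sub>1\<close>.\<close>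

lemma pencil_discriminant:
  fixes a b c e f h :: real
  assumes e: "0 < e" and d: "0 < e * h - f\<^sup>2"
  defines "disc \<equiv> (h * a - 2 * f * b + e * c)\<^sup>2 - 4 * (e * h - f\<^sup>2) * (a * c - b\<^sup>2)"
  shows "0 \<le> disc" "disc = 0 \<Longrightarrow> b * e = f * a \<and> c * e = h * a"
proof -
  \<comment> \<open>Here G has the entries \<open>e\<close>, \<open>f\<close>, \<open>h\<close> and
    P the entries \<open>a\<close>, \<open>b\<close>, \<open>c\<close>; \<open>disc\<close> is
    \<open>(det G)\<^sup>2\<close> times the discriminant of the characteristic polynomial. In this
    sum of two squares with positive weights, both vanish only if P is proportional to G.\<close>
  have eq: "e\<^sup>2 * disc = (2 * (e * h - f\<^sup>2) * a - e * (h * a - 2 * f * b + e * c))\<^sup>2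
      + 4 * (e * h - f\<^sup>2) * (b * e - f * a)\<^sup>2"
    unfolding disc_def by algebra
  show "0 \<le> disc"
  proof -
    have "0 \<le> e\<^sup>2 * disc" unfolding eq using d by simp
    then show ?thesis using e by (simp add: zero_le_mult_iff)
  qed
  assume "disc = 0"
  then have "(2 * (e * h - f\<^sup>2) * a - e * (h * a - 2 * f * b + e * c))\<^sup>2
      + 4 * (e * h - f\<^sup>2) * (b * e - f * a)\<^sup>2 = 0" using eq by simp
  moreover have "0 \<le> 4 * (e * h - f\<^sup>2) * (b * e - f * a)\<^sup>2" using d by simp
  ultimately have "(2 * (e * h - f\<^sup>2) * a - e * (h * a - 2 * f * b + e * c))\<^sup>2 = 0"
    and "4 * (e * h - f\<^sup>2) * (b * e - f * a)\<^sup>2 = 0"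
    using add_nonneg_eq_0_iff[of "(2 * (e * h - f\<^sup>2) * a - e * (h * a - 2 * f * b + e * c))\<^sup>2"
       "4 * (e * h - f\<^sup>2) * (b * e - f * a)\<^sup>2"] by auto
  then have 1: "b * e = f * a" and 2: "2 * (e * h - f\<^sup>2) * a - e * (h * a - 2 * f * b + e * c) = 0"
    using d by auto
  have "e * (h * a - c * e) = 0" using 1 2 by algebra
  with 1 e show "b * e = f * a \<and> c * e = h * a" by simp
qed

lemma trace2_inv_mult:
  assumes "posdef G"
  shows "trace2 (matrix_inv G ** P) =
    (G$2$2 * P$1$1 - G$1$2 * (P$2$1 + P$1$2) + G$1$1 * P$2$2) / det G"
  using posdef_entries[OF assms]
  by (simp add: matrix_inv_2 trace2_def matrix_matrix_mult_def sum_2 field_simps)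

lemma det_inv_mult:
  assumes "posdef G"
  shows "det (matrix_inv G ** P) = det P / det G"
proof -
  have "det (matrix_inv G) * det G = 1"
    using matrix_inv_mult(1)[OF posdef_invertible[OF assms]] by (metis det_I det_mul)
  then show ?thesis
    using posdef_entries(3)[OF assms] by (simp add: det_mul field_simps)
qed

text \<open>The square roots of the two roots of \<open>t\<^sup>2 - \<tau> * t + \<delta>\<close>,
  larger one first. Being explicit in trace and determinant, the pair inherits their
  measurability.\<close>

definition sv_pair :: "real \<Rightarrow> real \<Rightarrow> real \<times> real" where
  "sv_pair \<tau> \<delta> = (sqrt ((\<tau> + sqrt (\<tau>\<^sup>2 - 4 * \<delta>)) / 2), sqrt ((\<tau> - sqrt (\<tau>\<^sup>2 - 4 * \<delta>)) / 2))"

lemma sv_pair_props: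
  assumes "0 \<le> \<tau>" "0 \<le> \<delta>" "4 * \<delta> \<le> \<tau>\<^sup>2"
  defines "\<sigma> \<equiv> sv_pair \<tau> \<delta>"
  shows "0 \<le> snd \<sigma>" "snd \<sigma> \<le> fst \<sigma>" "(fst \<sigma>)\<^sup>2 + (snd \<sigma>)\<^sup>2 = \<tau>" "fst \<sigma> * snd \<sigma> = sqrt \<delta>"
proof -
  have le: "sqrt (\<tau>\<^sup>2 - 4 * \<delta>) \<le> \<tau>" using assms by (intro real_le_lsqrt) auto
  have pos: "0 \<le> sqrt (\<tau>\<^sup>2 - 4 * \<delta>)" using assms by simp
  show "0 \<le> snd \<sigma>" "snd \<sigma> \<le> fst \<sigma>" "(fst \<sigma>)\<^sup>2 + (snd \<sigma>)\<^sup>2 = \<tau>"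
    using le pos assms by (simp_all add: \<sigma>_def sv_pair_def field_simps)
  have "fst \<sigma> * snd \<sigma> = sqrt ((\<tau> + sqrt (\<tau>\<^sup>2 - 4 * \<delta>)) / 2 * ((\<tau> - sqrt (\<tau>\<^sup>2 - 4 * \<delta>)) / 2))"
    by (simp add: \<sigma>_def sv_pair_def real_sqrt_mult real_sqrt_divide)
  also have "(\<tau> + sqrt (\<tau>\<^sup>2 - 4 * \<delta>)) / 2 * ((\<tau> - sqrt (\<tau>\<^sup>2 - 4 * \<delta>)) / 2) = (\<tau>\<^sup>2 - (sqrt (\<tau>\<^sup>2 - 4 * \<delta>))\<^sup>2) / 4"
    by (simp add: field_simps power2_eq_square)
  also have "\<dots> = \<delta>" using assms by simp
  finally show "fst \<sigma> * snd \<sigma> = sqrt \<delta>" .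
qed

text \<open>Resolves the definite description in \<open>singular_values\<close>: the characteristic
  polynomial, evaluated at 0 and at 1, fixes the product and the sum of the squares, and the
  ordering and the signs fix the rest.\<close>

lemma singular_value_pair_unique:
  assumes tr: "0 \<le> trace2 A" and d: "0 \<le> det A" "4 * det A \<le> (trace2 A)\<^sup>2"
  shows "(THE \<sigma>. 0 \<le> snd \<sigma> \<and> snd \<sigma> \<le> fst \<sigma> \<and>
     (\<forall>t. det (mat t - A) = (t - (fst \<sigma>)\<^sup>2) * (t - (snd \<sigma>)\<^sup>2))) = sv_pair (trace2 A) (det A)"
proof (rule the_equality)
  define \<sigma> where "\<sigma> = sv_pair (trace2 A) (det A)"
  note p = sv_pair_props[OF tr d, folded \<sigma>_def]
  have "(fst \<sigma>)\<^sup>2 * (snd \<sigma>)\<^sup>2 = det A"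
    using p(4) d by (metis power_mult_distrib real_sqrt_pow2)
  then show "0 \<le> snd (sv_pair (trace2 A) (det A)) \<and>
     snd (sv_pair (trace2 A) (det A)) \<le> fst (sv_pair (trace2 A) (det A)) \<and>
     (\<forall>t. det (mat t - A) = (t - (fst (sv_pair (trace2 A) (det A)))\<^sup>2) * (t - (snd (sv_pair (trace2 A) (det A)))\<^sup>2))"
    using p(1-3) unfolding \<sigma>_def[symmetric] det_mat_minus_2
    by (auto simp: algebra_simps power2_eq_square) (metis distrib_right mult.commute)
next
  fix \<rho> :: "real \<times> real"
  assume r: "0 \<le> snd \<rho> \<and> snd \<rho> \<le> fst \<rho> \<and>
     (\<forall>t. det (mat t - A) = (t - (fst \<rho>)\<^sup>2) * (t - (snd \<rho>)\<^sup>2))"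
  define x y where "x = (fst \<rho>)\<^sup>2" and "y = (snd \<rho>)\<^sup>2"
  have e: "t\<^sup>2 - trace2 A * t + det A = (t - x) * (t - y)" for t
    using r by (simp add: det_mat_minus_2 x_def y_def)
  have dd: "det A = x * y" using e[of 0] by simp
  have tt: "trace2 A = x + y" using e[of 1] dd by (simp add: algebra_simps)
  have yx: "y \<le> x" using r by (simp add: x_def y_def power_mono)
  have "(trace2 A)\<^sup>2 - 4 * det A = (x - y)\<^sup>2" unfolding dd tt by algebra
  then have "sqrt ((trace2 A)\<^sup>2 - 4 * det A) = x - y" using yx by simp
  then have "sv_pair (trace2 A) (det A) = (sqrt x, sqrt y)" by (simp add: sv_pair_def tt)
  also have "\<dots> = \<rho>" using r by (simp add: x_def y_def prod_eq_iff)
  finally show "\<rho> = sv_pair (trace2 A) (det A)" ..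
qed

context
  fixes G H D :: "real^2^2"
  assumes G: "posdef G" and H: "posdef H"
begin

text \<open>With \<open>G\<close> and \<open>H\<close> the metrics of source and target and
  \<open>D\<close> the differential, \<open>P\<close> is the pulled-back metric and \<open>K\<close>
  the matrix called \<open>adjoint_diff_matrix\<close> above.\<close>

private abbreviation "P \<equiv> transpose D ** H ** D"
private abbreviation "K \<equiv> matrix_inv G ** P"

private lemma P_sym: "P$2$1 = P$1$2"
proof -
  have "transpose P = P" by (rule transpose_congruence_sym) (use H in \<open>simp add: posdef_def\<close>)
  then have "transpose P $ 1 $ 2 = P $ 1 $ 2" by simp
  then show ?thesis by (simp only: transpose_def vec_lambda_beta)
qed

lemma det_adjoint: "det K = (sqrt (det H) / sqrt (det G) * det D)\<^sup>2"
  using posdef_entries(3)[OF G] posdef_entries(3)[OF H]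
  unfolding det_inv_mult[OF G]
  by (simp add: det_mul power_mult_distrib power_divide) (simp add: power2_eq_square)

private lemma disc_eq:
  "(det G)\<^sup>2 * ((trace2 K)\<^sup>2 - 4 * det K) =
    (G$2$2 * P$1$1 - 2 * G$1$2 * P$1$2 + G$1$1 * P$2$2)\<^sup>2
      - 4 * (G$1$1 * G$2$2 - (G$1$2)\<^sup>2) * (P$1$1 * P$2$2 - (P$1$2)\<^sup>2)"
proof -
  have dP: "det P = P$1$1 * P$2$2 - (P$1$2)\<^sup>2" by (simp only: det_2 P_sym power2_eq_square)
  have "(det G)\<^sup>2 * ((trace2 K)\<^sup>2 - 4 * det K) =
    (G$2$2 * P$1$1 - 2 * G$1$2 * P$1$2 + G$1$1 * P$2$2)\<^sup>2 - 4 * det G * det P"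
    using posdef_entries(3)[OF G]
    unfolding trace2_inv_mult[OF G] det_inv_mult[OF G] P_sym
    by (simp add: field_simps power2_eq_square)
  then show ?thesis unfolding dP posdef_entries(4)[OF G] .
qed

text \<open>The first part makes the singular values real. The second is the pointwise source of
  homotheties: a double eigenvalue of \<open>K\<close> forces the pulled-back metric to be a
  multiple of \<open>G\<close>.\<close>

lemma adjoint_trace_disc: "4 * det K \<le> (trace2 K)\<^sup>2"
  and adjoint_disc_eq_0: "4 * det K = (trace2 K)\<^sup>2 \<Longrightarrow> P = (trace2 K / 2) *\<^sub>R G"
proof -
  note g = posdef_entries[OF G]
  have "0 \<le> (det G)\<^sup>2 * ((trace2 K)\<^sup>2 - 4 * det K)"
    unfolding disc_eq using g by (intro pencil_discriminant(1)) auto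
  then show "4 * det K \<le> (trace2 K)\<^sup>2"
    using g(3) by (simp add: zero_le_mult_iff)
  assume "4 * det K = (trace2 K)\<^sup>2"
  then have "P$1$2 * G$1$1 = G$1$2 * P$1$1 \<and> P$2$2 * G$1$1 = G$2$2 * P$1$1"
    using g disc_eq by (intro pencil_discriminant(2)) auto
  then have q: "P$1$2 = P$1$1 / G$1$1 * G$1$2" "P$2$2 = P$1$1 / G$1$1 * G$2$2"
    "P$1$1 = P$1$1 / G$1$1 * G$1$1"
    using g(1) by (simp_all add: field_simps)
  have "P = (P$1$1 / G$1$1) *\<^sub>R G"
    using q P_sym g(2) unfolding vec_eq_iff forall_2 vector_scaleR_component real_scaleR_def by metis
  moreover define l where "l = P$1$1 / G$1$1"
  ultimately have l: "P = l *\<^sub>R G" by simp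
  have "trace2 K = 2 * l"
    using g(3) unfolding trace2_inv_mult[OF G] l
    by (simp add: field_simps g(2) g(4) power2_eq_square)
  then show "P = (trace2 K / 2) *\<^sub>R G" by (simp add: l)
qed

lemma adjoint_trace_nonneg: "0 \<le> trace2 K"
proof -
  note g = posdef_entries[OF G]
  define a b c where "a = P$1$1" and "b = P$1$2" and "c = P$2$2"
  have psd: "0 \<le> v$1 * (a * v$1 + b * v$2) + v$2 * (b * v$1 + c * v$2)" for v :: "real^2"
    using congruence_psd[OF H, of v D] unfolding vec2_inner P_sym a_def b_def c_def .
  have "0 \<le> a" using psd[of "vector [1, 0]"] by simp
  \<comment> \<open>The test vector is chosen so that the value of \<open>P\<close> on it, plus
    \<open>det G * P$1$1\<close>, is \<open>G$1$1 * det G\<close> times the trace of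
    \<open>K\<close>.\<close>
  moreover have "0 \<le> G$1$2 * (a * G$1$2 - b * G$1$1) - G$1$1 * (b * G$1$2 - c * G$1$1)"
    using psd[of "vector [G$1$2, - G$1$1]"] by simp
  moreover have "G$1$1 * (G$2$2 * a - G$1$2 * (b + b) + G$1$1 * c) =
     det G * a + (G$1$2 * (a * G$1$2 - b * G$1$1) - G$1$1 * (b * G$1$2 - c * G$1$1))"
    unfolding g(4) by algebra
  ultimately have "0 \<le> G$1$1 * (G$2$2 * a - G$1$2 * (b + b) + G$1$1 * c)"
    using g(3) by simp
  then have "0 \<le> G$2$2 * a - G$1$2 * (b + b) + G$1$1 * c"
    using g(1) by (simp add: zero_le_mult_iff)
  then show ?thesis
    using g(3) unfolding trace2_inv_mult[OF G] P_sym a_def b_def c_def by simp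
qed

end

section \<open>Change of variables in Euclidean space\<close>

text \<open>Change of variables for images of finite measure, extended to all values: if the image
  has infinite measure then the determinant is not integrable, so both sides are infinite.\<close>

lemma emeasure_differentiable_image:
  fixes h :: "real^'n::{finite,wellorder} \<Rightarrow> real^'n::_"
  assumes S: "S \<in> sets lebesgue"
    and der: "\<And>x. x \<in> S \<Longrightarrow> (h has_derivative H x) (at x within S)"
    and inj: "inj_on h S"
  shows "emeasure lebesgue (h ` S) = (\<integral>\<^sup>+x\<in>S. ennreal \<bar>det (matrix (H x))\<bar> \<partial>lebesgue)"
proof -
  have "h differentiable_on S"
    using der by (auto simp: differentiable_on_def differentiable_def)
  then have hS: "h ` S \<in> sets lebesgue"
    using S by (intro differentiable_image_in_sets_lebesgue) auto
  have meas: "(\<lambda>x. \<bar>det (matrix (H x))\<bar>) \<in> borel_measurable (lebesgue_on S)"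
    using borel_measurable_det_Jacobian[OF S der] by simp
  let ?I = "\<integral>\<^sup>+x\<in>S. ennreal \<bar>det (matrix (H x))\<bar> \<partial>lebesgue"
  show ?thesis
  proof (cases "h ` S \<in> lmeasurable")
    case True
    then have "((\<lambda>x. \<bar>det (matrix (H x))\<bar>) has_integral measure lebesgue (h ` S)) S"
      using has_measure_differentiable_image[OF S der inj] by blast
    then have "?I = ennreal (measure lebesgue (h ` S))"
      using nn_integral_has_integral_lebesgue'[of S "\<lambda>x. \<bar>det (matrix (H x))\<bar>"]
      by (simp add: nn_integral_completion)
    then show ?thesis using emeasure_eq_measure2[OF True] by simp
  next
    case False
    have top: "emeasure lebesgue (h ` S) = \<infinity>"
    proof (rule ccontr)
      assume "emeasure lebesgue (h ` S) \<noteq> \<infinity>"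
      then show False using False fmeasurableI[OF hS] by (simp add: top.not_eq_extremum)
    qed
    have "?I = \<infinity>"
    proof (rule ccontr)
      assume "?I \<noteq> \<infinity>"
      then have "?I < \<infinity>" by (simp add: top.not_eq_extremum)
      then have "integrable (lebesgue_on S) (\<lambda>x. \<bar>det (matrix (H x))\<bar>)"
        using meas S by (simp add: integrable_iff_bounded nn_integral_restrict_space)
      then have "(\<lambda>x. \<bar>det (matrix (H x))\<bar>) integrable_on S"
        using integrable_on_lebesgue_on S by blast
      then show False
        using measurable_differentiable_image_eq[OF S der inj] False by blast
    qed
    with top show ?thesis by simp
  qed
qed

text \<open>The push-forward under \<open>h\<close> of Lebesgue measure with density
  \<open>\<bar>det\<bar>\<close> is Lebesgue measure on the image. It suffices to compare the two on
  Borel sets, since the weight \<open>w\<close> is Borel; each comparison is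
  \<open>emeasure_differentiable_image\<close> for a preimage.\<close>

lemma nn_integral_change_of_variables:
  fixes h :: "real^'n::{finite,wellorder} \<Rightarrow> real^'n::_"
  assumes S: "S \<in> sets lebesgue"
    and der: "\<And>x. x \<in> S \<Longrightarrow> (h has_derivative H x) (at x within S)"
    and inj: "inj_on h S" and w: "w \<in> borel_measurable borel"
  shows "(\<integral>\<^sup>+x\<in>S. ennreal \<bar>det (matrix (H x))\<bar> * w (h x) \<partial>lebesgue) = (\<integral>\<^sup>+y\<in>h ` S. w y \<partial>lebesgue)"
proof -
  have diff: "h differentiable_on S"
    using der by (auto simp: differentiable_on_def differentiable_def)
  then have hS: "h ` S \<in> sets lebesgue"
    using S by (intro differentiable_image_in_sets_lebesgue) auto
  let ?d = "\<lambda>x. ennreal \<bar>det (matrix (H x))\<bar>"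
  have d[measurable]: "?d \<in> borel_measurable (lebesgue_on S)"
    using borel_measurable_det_Jacobian[OF S der] by simp
  have h[measurable]: "h \<in> borel_measurable (lebesgue_on S)"
    using S differentiable_imp_continuous_on[OF diff] by (rule continuous_imp_measurable_on_sets_lebesgue[rotated])
  have id[measurable]: "(\<lambda>y. y) \<in> borel_measurable (lebesgue_on (h ` S))"
    by (intro measurable_restrict_space1 measurable_completion) simp
  have eq: "distr (density (lebesgue_on S) ?d) borel h = distr (lebesgue_on (h ` S)) borel (\<lambda>y. y)"
  proof (rule measure_eqI)
    fix X assume "X \<in> sets (distr (density (lebesgue_on S) ?d) borel h)"
    then have X[measurable]: "X \<in> sets borel" by simp
    define T where "T = S \<inter> h -` X"
    have Ts: "T \<in> sets (lebesgue_on S)"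
      using measurable_sets[OF h X] by (simp add: T_def Int_commute)
    then have T: "T \<in> sets lebesgue" using S by (simp add: sets_restrict_space_iff)
    have "emeasure (distr (density (lebesgue_on S) ?d) borel h) X = emeasure (density (lebesgue_on S) ?d) T"
      by (subst emeasure_distr) (auto simp: T_def Int_commute)
    also have "\<dots> = (\<integral>\<^sup>+x. ?d x * indicator T x \<partial>lebesgue_on S)"
      using Ts d by (intro emeasure_density)
    also have "\<dots> = (\<integral>\<^sup>+x\<in>T. ?d x \<partial>lebesgue)"
      using S by (subst nn_integral_restrict_space)
        (auto simp: T_def indicator_def intro!: nn_integral_cong)
    also have "\<dots> = emeasure lebesgue (h ` T)"
      using T der inj
      by (intro emeasure_differentiable_image[symmetric])
         (auto simp: T_def intro: has_derivative_subset inj_on_subset)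
    also have "h ` T = X \<inter> h ` S" by (auto simp: T_def)
    also have "emeasure lebesgue (X \<inter> h ` S) = emeasure (distr (lebesgue_on (h ` S)) borel (\<lambda>y. y)) X"
      using hS by (subst emeasure_distr) (auto simp: emeasure_restrict_space)
    finally show "emeasure (distr (density (lebesgue_on S) ?d) borel h) X =
      emeasure (distr (lebesgue_on (h ` S)) borel (\<lambda>y. y)) X" .
  qed simp
  have "(\<integral>\<^sup>+x\<in>S. ?d x * w (h x) \<partial>lebesgue) = (\<integral>\<^sup>+x. ?d x * w (h x) \<partial>lebesgue_on S)"
    using S by (simp add: nn_integral_restrict_space)
  also have "\<dots> = (\<integral>\<^sup>+x. w (h x) \<partial>density (lebesgue_on S) ?d)"
    using measurable_compose[OF h w] d by (intro nn_integral_density[symmetric])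
  also have "\<dots> = (\<integral>\<^sup>+y. w y \<partial>distr (density (lebesgue_on S) ?d) borel h)"
    using w by (subst nn_integral_distr) auto
  also have "\<dots> = (\<integral>\<^sup>+y. w y \<partial>lebesgue_on (h ` S))"
    unfolding eq using w by (subst nn_integral_distr) auto
  also have "\<dots> = (\<integral>\<^sup>+y\<in>h ` S. w y \<partial>lebesgue)"
    using hS by (simp add: nn_integral_restrict_space)
  finally show ?thesis .
qed

text \<open>Where the derivative is invertible, \<open>h\<close> does not shrink small distances by
  more than a fixed factor. Countably many sets \<open>E n\<close> with uniform constants cover
  these points, and locally each \<open>E n\<close> is a Lipschitz image, under the inverse of
  \<open>h\<close>, of a subset of the negligible image.\<close>

lemma jacobian_zero_on_negligible_image:
  fixes h :: "real^'n::{finite,wellorder} \<Rightarrow> real^'n::_"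
  assumes der: "\<And>x. x \<in> A \<Longrightarrow> (h has_derivative H x) (at x within A)"
    and neg: "negligible (h ` A)"
  shows "negligible {x \<in> A. det (matrix (H x)) \<noteq> 0}"
proof -
  define E where "E n = {x \<in> A. \<forall>y\<in>A. norm (y - x) < inverse (real (Suc n)) \<longrightarrow>
      norm (y - x) \<le> real (Suc n) * norm (h y - h x)}" for n
  have "negligible (E n)" for n
  proof (subst locally_negligible_alt, intro ballI)
    fix x assume x: "x \<in> E n"
    \<comment> \<open>Half the radius in \<open>E n\<close>, so that any two points of
      \<open>U\<close> are close enough for the estimate.\<close>
    define U where "U = E n \<inter> ball x (inverse (real (Suc n)) / 2)"
    have lip: "norm (y - z) \<le> real (Suc n) * norm (h y - h z)" if "y \<in> U" "z \<in> U" for y z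
    proof -
      have "dist y z < inverse (real (Suc n))"
        using that dist_triangle_half_r[of x y "inverse (real (Suc n))" z] by (simp add: U_def)
      then show ?thesis using that by (auto simp: U_def E_def dist_norm)
    qed
    have inj: "inj_on h U"
    proof (rule inj_onI)
      fix y z assume "y \<in> U" "z \<in> U" "h y = h z"
      then show "y = z" using lip[of y z] by simp
    qed
    have "negligible (inv_into U h ` (h ` U))"
    proof (rule negligible_locally_Lipschitz_image)
      show "negligible (h ` U)"
        using neg by (rule negligible_subset) (auto simp: U_def E_def)
      show "\<exists>T B. open T \<and> y \<in> T \<and> (\<forall>z\<in>h ` U \<inter> T.
          norm (inv_into U h z - inv_into U h y) \<le> B * norm (z - y))" if "y \<in> h ` U" for y
        using that lip inj by (intro exI[of _ UNIV] exI[of _ "real (Suc n)"]) auto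
    qed simp
    then have "negligible U" using inj by (simp add: inv_into_image_cancel)
    then show "\<exists>U. openin (top_of_set (E n)) U \<and> x \<in> U \<and> negligible U"
      using x by (intro exI[of _ U]) (auto simp: U_def openin_open)
  qed
  then have "negligible (\<Union>n. E n)" by (intro negligible_Union_nat) auto
  moreover have "{x \<in> A. det (matrix (H x)) \<noteq> 0} \<subseteq> (\<Union>n. E n)"
  proof clarify
    fix x assume x: "x \<in> A" and d: "det (matrix (H x)) \<noteq> 0"
    have lin: "linear (H x)" using der[OF x] by (rule has_derivative_linear)
    then have "inj (H x)" using d det_nz_iff_inj by blast
    then obtain B where B: "B > 0" "\<And>v. B * norm v \<le> norm (H x v)"
      using linear_inj_bounded_below_pos[OF lin] by metis
    obtain r where r: "r > 0" "\<And>y. y \<in> A \<Longrightarrow> norm (y - x) < r \<Longrightarrow>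
        norm (h y - h x - H x (y - x)) \<le> B / 2 * norm (y - x)"
      using der[OF x] B(1) unfolding has_derivative_within_alt by (metis half_gt_zero)
    \<comment> \<open>\<open>n\<close> must serve twice: the radius has to lie inside the range
      where the derivative approximates \<open>h\<close> up to \<open>B / 2\<close>, and the
      expansion constant has to be at most the remaining \<open>B / 2\<close>.\<close>
    obtain n where n: "inverse (real (Suc n)) < min (B / 2) r"
      using reals_Archimedean[of "min (B / 2) r"] B r by auto
    have "x \<in> E n" unfolding E_def
    proof (intro CollectI conjI ballI impI)
      fix y assume y: "y \<in> A" "norm (y - x) < inverse (real (Suc n))"
      have "norm (H x (y - x)) \<le> norm (h y - h x) + norm (h y - h x - H x (y - x))"
        using norm_triangle_ineq4[of "h y - h x" "h y - h x - H x (y - x)"] by simp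
      then have "B / 2 * norm (y - x) \<le> norm (h y - h x)"
        using r(2)[OF y(1)] y(2) n B(2)[of "y - x"] by auto
      moreover have "inverse (real (Suc n)) * norm (y - x) \<le> B / 2 * norm (y - x)"
        using n by (intro mult_right_mono) auto
      ultimately have "inverse (real (Suc n)) * norm (y - x) \<le> norm (h y - h x)" by linarith
      then show "norm (y - x) \<le> real (Suc n) * norm (h y - h x)"
        by (simp add: field_simps)
    qed (rule x)
    then show "x \<in> (\<Union>n. E n)" by blast
  qed
  ultimately show ?thesis by (rule negligible_subset)
qed

section \<open>Charts of a compact surface\<close>

lemma lipschitz_fst_continuous:
  assumes "L-lipschitz_on UNIV (\<gamma> :: real \<Rightarrow> real)"
  shows "continuous_on UNIV (\<lambda>x::real^2. \<gamma> (x $ 1))"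
proof -
  have "continuous_on UNIV (\<lambda>x::real^2. x $ 1)" by (intro continuous_intros)
  with lipschitz_on_continuous_on[OF assms] show ?thesis
    by (rule continuous_on_compose2) simp
qed

lemma model_region_closed: "model_region R \<Longrightarrow> closed R"
  unfolding model_region_def
proof (elim disjE exE conjE)
  fix \<gamma> :: "real \<Rightarrow> real" and L assume L: "L-lipschitz_on UNIV \<gamma>" and R: "R = {x. \<gamma> (x $ 1) \<le> x $ 2}"
  have "continuous_on UNIV (\<lambda>x::real^2. \<gamma> (x $ 1))" using L by (rule lipschitz_fst_continuous)
  moreover have "continuous_on UNIV (\<lambda>x::real^2. x $ 2)" by (intro continuous_intros)
  ultimately show "closed R" unfolding R by (rule closed_Collect_le)
qed simp

text \<open>Two points of an epigraph are joined inside it by a parabola whose length is controlled by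
  their distance; a segment would not do.\<close>

definition arch :: "real \<Rightarrow> real^2 \<Rightarrow> real^2 \<Rightarrow> real \<Rightarrow> real^2" where
  "arch L x y t = (1 - t) *\<^sub>R x + t *\<^sub>R y + (2 * L * t * (1 - t) * \<bar>x $ 1 - y $ 1\<bar>) *\<^sub>R axis 2 1"

lemma model_region_arch:
  assumes "model_region R"
  obtains L where "0 \<le> L" "\<And>x y t. x \<in> R \<Longrightarrow> y \<in> R \<Longrightarrow> 0 \<le> t \<Longrightarrow> t \<le> 1 \<Longrightarrow> arch L x y t \<in> R"
  using assms unfolding model_region_def
proof (elim disjE exE conjE)
  assume "R = UNIV" then show ?thesis by (intro that[of 0]) auto
next
  fix \<gamma> :: "real \<Rightarrow> real" and L assume L: "L-lipschitz_on UNIV \<gamma>" and R: "R = {x. \<gamma> (x $ 1) \<le> x $ 2}"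
  show ?thesis
  proof (rule that[of L])
    show "0 \<le> L" using L by (rule lipschitz_on_nonneg)
    fix x y :: "real^2" and t :: real assume x: "x \<in> R" and y: "y \<in> R" and t: "0 \<le> t" "t \<le> 1"
    define z where "z = (1 - t) * x $ 1 + t * y $ 1"
    define r where "r = \<bar>x $ 1 - y $ 1\<bar>"
    have "z - x $ 1 = t * (y $ 1 - x $ 1)" "z - y $ 1 = (1 - t) * (x $ 1 - y $ 1)"
      by (simp_all add: z_def algebra_simps)
    then have d: "\<bar>z - x $ 1\<bar> = t * r" "\<bar>z - y $ 1\<bar> = (1 - t) * r"
      using t by (simp_all add: abs_mult r_def abs_minus_commute)
    have lip: "\<gamma> z \<le> \<gamma> w + L * \<bar>z - w\<bar>" for w
      using lipschitz_onD[OF L, of z w] by (simp add: dist_real_def)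
    have 1: "\<gamma> z \<le> x $ 2 + L * (t * r)" using lip[of "x $ 1"] x d by (simp add: R)
    have 2: "\<gamma> z \<le> y $ 2 + L * ((1 - t) * r)" using lip[of "y $ 1"] y d by (simp add: R)
    \<comment> \<open>Each endpoint contributes a deficit of \<open>L * t * (1 - t) * r\<close>
      after weighting. Their sum is exactly the parabolic term of \<open>arch\<close>, which
      explains its factor 2.\<close>
    have "(1 - t) * \<gamma> z + t * \<gamma> z \<le> (1 - t) * (x $ 2 + L * (t * r)) + t * (y $ 2 + L * ((1 - t) * r))"
      using 1 2 t by (intro add_mono mult_left_mono) auto
    then have "\<gamma> z \<le> (1 - t) * x $ 2 + t * y $ 2 + 2 * L * t * (1 - t) * r"
      by (simp add: algebra_simps)
    then show "arch L x y t \<in> R" by (simp add: R arch_def z_def r_def axis_def)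
  qed
qed

text \<open>Moving straight up from a boundary point of an epigraph enters its interior. This is
  what makes nonempty open subsets of a surface with boundary have positive area.\<close>

lemma model_region_interior:
  assumes "model_region R" and W: "openin (top_of_set R) W" "W \<noteq> {}"
  shows "interior W \<noteq> {}"
  using assms(1) unfolding model_region_def
proof (elim disjE exE conjE)
  assume "R = UNIV" then show ?thesis using W by (simp add: interior_open)
next
  fix \<gamma> :: "real \<Rightarrow> real" and L assume L: "L-lipschitz_on UNIV \<gamma>" and R: "R = {x. \<gamma> (x $ 1) \<le> x $ 2}"
  from W obtain T where T: "open T" "W = R \<inter> T" by (auto simp: openin_open)
  from W(2) T obtain x where x: "x \<in> R" "x \<in> T" by auto
  from T(1) x(2) obtain e where e: "e > 0" "ball x e \<subseteq> T" by (auto simp: open_contains_ball)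
  define y where "y = x + (e / 2) *\<^sub>R axis 2 1"
  have "continuous_on UNIV (\<lambda>x::real^2. x $ 2)" by (intro continuous_intros)
  from open_Collect_less[OF lipschitz_fst_continuous[OF L] this]
  have "open {x::real^2. \<gamma> (x $ 1) < x $ 2}" .
  then have "open ({x. \<gamma> (x $ 1) < x $ 2} \<inter> T)" using T by auto
  moreover have "{x. \<gamma> (x $ 1) < x $ 2} \<inter> T \<subseteq> W" using T by (auto simp: R)
  moreover have "y \<in> T" using e by (auto simp: y_def dist_norm)
  moreover have "\<gamma> (y $ 1) < y $ 2" using x e by (simp add: y_def R axis_def)
  ultimately have "y \<in> interior W" by (intro interiorI[of "{x. \<gamma> (x $ 1) < x $ 2} \<inter> T"]) auto
  then show ?thesis by auto
qed

lemma smooth_on_set_continuous: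
  assumes "smooth_on_set S f" shows "continuous_on S f"
proof (rule continuous_on_eq_continuous_within[THEN iffD2], intro ballI)
  fix x assume x: "x \<in> S"
  from assms x obtain U h where U: "open U" "x \<in> U" "\<forall>k. Ck_on k U h" "\<forall>y\<in>S \<inter> U. h y = f y"
    unfolding smooth_on_set_def by blast
  have "continuous_on U h" using U(3) Ck_on.simps(1) by blast
  then have "isCont h x" using U(1,2) by (simp add: continuous_on_eq_continuous_at)
  then have "(h \<longlongrightarrow> h x) (at x within S)"
    by (simp add: isCont_def tendsto_within_subset[OF _ subset_UNIV])
  moreover have "\<forall>\<^sub>F y in at x within S. h y = f y"
    using U by (auto simp: eventually_at_topological)
  moreover have "h x = f x" using U x by auto
  ultimately show "continuous (at x within S) f"
    unfolding continuous_within by (auto elim: Lim_transform_eventually)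
qed

text \<open>Carries only the Borel sets, so that measurability can be discussed before the area is
  known to exist.\<close>

definition borel_alg :: "'a surface \<Rightarrow> 'a measure" where
  "borel_alg M = sigma (points M) {U. openin (surf_top M) U}"

text \<open>The property under the definite description in \<open>riemannian_area\<close>.\<close>

definition is_area :: "'a surface \<Rightarrow> 'a measure \<Rightarrow> bool" where
  "is_area M \<mu> \<longleftrightarrow>
     sets \<mu> = sigma_sets (points M) {U. openin (surf_top M) U} \<and>
     (\<forall>c\<in>atlas M. \<forall>A\<in>sets \<mu>. A \<subseteq> chart_dom c \<longrightarrow>
        emeasure \<mu> A = (\<integral>\<^sup>+x\<in>chart_map c ` A. ennreal (sqrt (det (gram M c x))) \<partial>lborel))"

abbreviation img :: "'a chart \<Rightarrow> (real^2) set" where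
  "img c \<equiv> chart_map c ` chart_dom c"

lemma open_subsets: "{U. openin X U} \<subseteq> Pow (topspace X)"
  by (auto dest: openin_subset)

lemma space_borel_alg[simp]: "space (borel_alg M) = points M"
  by (simp add: borel_alg_def open_subsets)

lemma sets_borel_alg: "sets (borel_alg M) = sigma_sets (points M) {U. openin (surf_top M) U}"
  by (simp add: borel_alg_def open_subsets)

lemma open_borel_alg: "openin (surf_top M) U \<Longrightarrow> U \<in> sets (borel_alg M)"
  by (auto simp: sets_borel_alg)

locale riemannian_surface =
  fixes M :: "'a surface"
  assumes surface: "compact_connected_riemannian_surface M"
begin

lemma points_nonempty: "points M \<noteq> {}"
  and hausdorff: "Hausdorff_space (surf_top M)"
  and compact: "compact_space (surf_top M)"
  using surface by (auto simp: compact_connected_riemannian_surface_def)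

lemma atlas_cover:
  assumes "p \<in> points M" obtains c where "c \<in> atlas M" "p \<in> chart_dom c"
proof -
  have "(\<Union>c\<in>atlas M. chart_dom c) = points M"
    using surface by (simp only: compact_connected_riemannian_surface_def)
  then show ?thesis using that assms by blast
qed

lemma compatible: "c \<in> atlas M \<Longrightarrow> d \<in> atlas M \<Longrightarrow> compatible_charts M c d"
  using surface by (auto simp: compact_connected_riemannian_surface_def)

lemma chart_at:
  assumes "p \<in> points M" shows "chart_at M p \<in> atlas M" "p \<in> chart_dom (chart_at M p)"
proof -
  obtain c where "c \<in> atlas M \<and> p \<in> chart_dom c" using atlas_cover[OF assms] by blast
  then have "chart_at M p \<in> atlas M \<and> p \<in> chart_dom (chart_at M p)"
    unfolding chart_at_def by (rule someI)
  then show "chart_at M p \<in> atlas M" "p \<in> chart_dom (chart_at M p)" by auto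
qed

context
  fixes c assumes c: "c \<in> atlas M"
begin

lemma is_chart_c: "is_chart (surf_top M) c"
  and gram_c: "is_riemannian_gram M c"
  using surface c by (auto simp: compact_connected_riemannian_surface_def)

lemma chart_open: "openin (surf_top M) (chart_dom c)"
  using is_chart_c by (simp add: is_chart_def)

lemma chart_subset: "chart_dom c \<subseteq> points M"
  using chart_open by (rule openin_subset)

lemma chart_homeo:
  "homeomorphic_map (subtopology (surf_top M) (chart_dom c)) (top_of_set (img c)) (chart_map c)"
  using is_chart_c by (simp add: is_chart_def)

lemma chart_inj: "inj_on (chart_map c) (chart_dom c)"
  using chart_homeo chart_subset by (simp add: homeomorphic_eq_everything_map Int_absorb1)

lemma chart_inv_map[simp]: "p \<in> chart_dom c \<Longrightarrow> chart_inv c (chart_map c p) = p"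
  using chart_inj by (simp add: chart_inv_def)

lemma chart_map_inv[simp]: "x \<in> img c \<Longrightarrow> chart_map c (chart_inv c x) = x"
  by (auto simp: chart_inv_def f_inv_into_f)

lemma chart_inv_dom[simp]: "x \<in> img c \<Longrightarrow> chart_inv c x \<in> chart_dom c"
  by (auto simp: chart_inv_def intro: inv_into_into)

lemma img_region: obtains R where "model_region R" "openin (top_of_set R) (img c)"
  using is_chart_c by (auto simp: is_chart_def)

lemma img_borel: "img c \<in> sets borel"
proof -
  obtain R where R: "model_region R" "openin (top_of_set R) (img c)" by (rule img_region)
  then obtain T where "open T" "img c = R \<inter> T" by (auto simp: openin_open)
  then show ?thesis using model_region_closed[OF R(1)] by auto
qed

lemma chart_image_open:
  assumes "openin (surf_top M) U" shows "openin (top_of_set (img c)) (chart_map c ` (U \<inter> chart_dom c))"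
proof -
  have "open_map (subtopology (surf_top M) (chart_dom c)) (top_of_set (img c)) (chart_map c)"
    using chart_homeo by (rule homeomorphic_imp_open_map)
  moreover have "openin (subtopology (surf_top M) (chart_dom c)) (U \<inter> chart_dom c)"
    using assms by (auto simp: openin_subtopology)
  ultimately show ?thesis by (simp add: open_map_def)
qed

lemma chart_preimage_open:
  assumes "open V" shows "openin (surf_top M) {p \<in> chart_dom c. chart_map c p \<in> V}"
proof -
  have "continuous_map (subtopology (surf_top M) (chart_dom c)) (top_of_set (img c)) (chart_map c)"
    using chart_homeo by (rule homeomorphic_imp_continuous_map)
  then have "continuous_map (subtopology (surf_top M) (chart_dom c)) euclidean (chart_map c)"
    using continuous_map_in_subtopology by blast
  then have "openin (subtopology (surf_top M) (chart_dom c))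
      {p \<in> topspace (subtopology (surf_top M) (chart_dom c)). chart_map c p \<in> V}"
    using assms by (intro openin_continuous_map_preimage[where Y=euclidean]) auto
  then have "openin (surf_top M) {p \<in> topspace (subtopology (surf_top M) (chart_dom c)). chart_map c p \<in> V}"
    using chart_open openin_trans_full by blast
  then show ?thesis using chart_subset by (simp add: Int_absorb1)
qed

lemma chart_map_measurable: "chart_map c \<in> borel_measurable (restrict_space (borel_alg M) (chart_dom c))"
proof (rule borel_measurableI)
  fix S :: "(real^2) set" assume "open S"
  from open_borel_alg[OF chart_preimage_open[OF this]]
  show "chart_map c -` S \<inter> space (restrict_space (borel_alg M) (chart_dom c))
      \<in> sets (restrict_space (borel_alg M) (chart_dom c))"
    using chart_subset open_borel_alg[OF chart_open]
    by (subst sets_restrict_space_iff)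
       (auto simp: space_restrict_space Collect_conj_eq Int_commute Int_absorb2 Int_left_commute vimage_def)
qed

lemma chart_inv_measurable: "chart_inv c \<in> restrict_space borel (img c) \<rightarrow>\<^sub>M borel_alg M"
  unfolding borel_alg_def
proof (rule measurable_measure_of[OF open_subsets])
  show "chart_inv c \<in> space (restrict_space borel (img c)) \<rightarrow> points M"
    using chart_subset chart_inv_dom by (auto simp: space_restrict_space)
  fix U assume "U \<in> {U. openin (surf_top M) U}"
  then have "openin (top_of_set (img c)) (chart_map c ` (U \<inter> chart_dom c))" by (simp add: chart_image_open)
  then obtain T where T: "open T" "chart_map c ` (U \<inter> chart_dom c) = img c \<inter> T" by (auto simp: openin_open)
  have "chart_inv c -` U \<inter> img c = chart_map c ` (U \<inter> chart_dom c)" by force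
  then show "chart_inv c -` U \<inter> space (restrict_space borel (img c)) \<in> sets (restrict_space borel (img c))"
    using T img_borel by (simp add: space_restrict_space sets_restrict_space_iff)
qed

lemma chart_image_borel:
  assumes "A \<in> sets (borel_alg M)" "A \<subseteq> chart_dom c" shows "chart_map c ` A \<in> sets borel"
proof -
  have "chart_inv c -` A \<inter> space (restrict_space borel (img c)) \<in> sets (restrict_space borel (img c))"
    using chart_inv_measurable assms(1) by (rule measurable_sets)
  moreover have "chart_inv c -` A \<inter> img c = chart_map c ` A" using assms(2) by force
  ultimately show ?thesis using img_borel by (simp add: space_restrict_space sets_restrict_space_iff)
qed

lemma chart_inv_image_borel:
  assumes "Y \<in> sets borel" "Y \<subseteq> img c" shows "chart_inv c ` Y \<in> sets (borel_alg M)"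
proof -
  have "chart_map c -` Y \<inter> space (restrict_space (borel_alg M) (chart_dom c))
      \<in> sets (restrict_space (borel_alg M) (chart_dom c))"
    using chart_map_measurable assms(1) by (rule measurable_sets)
  moreover have "chart_map c -` Y \<inter> (chart_dom c \<inter> points M) = chart_inv c ` Y"
  proof (intro equalityI subsetI)
    fix p assume "p \<in> chart_map c -` Y \<inter> (chart_dom c \<inter> points M)"
    then show "p \<in> chart_inv c ` Y" by (intro image_eqI[of _ _ "chart_map c p"]) auto
  next
    fix p assume "p \<in> chart_inv c ` Y"
    then show "p \<in> chart_map c -` Y \<inter> (chart_dom c \<inter> points M)"
      using assms(2) chart_subset by (auto dest!: subsetD)
  qed
  ultimately have "chart_inv c ` Y \<in> sets (restrict_space (borel_alg M) (chart_dom c))"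
    by (simp only: space_restrict_space space_borel_alg)
  then show ?thesis
    using open_borel_alg[OF chart_open] chart_subset
    by (simp add: sets_restrict_space_iff Int_absorb2)
qed

lemma gram_posdef: "x \<in> img c \<Longrightarrow> posdef (gram M c x)"
  using gram_c unfolding is_riemannian_gram_def posdef_def by blast

lemma gram_continuous: "continuous_on (img c) (gram M c)"
  using gram_c by (simp add: is_riemannian_gram_def smooth_on_set_continuous)

abbreviation "dens x \<equiv> sqrt (det (gram M c x))"

lemma dens_pos: "x \<in> img c \<Longrightarrow> 0 < dens x"
  using posdef_entries(3)[OF gram_posdef] by simp

lemma dens_continuous: "continuous_on (img c) (\<lambda>x. dens x)"
proof -
  have "continuous_on (img c) (\<lambda>x. gram M c x $ i $ j)" for i j
    by (intro continuous_intros gram_continuous)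
  then show ?thesis unfolding det_2
    by (intro continuous_on_real_sqrt continuous_on_diff continuous_on_mult)
qed

text \<open>Outside \<open>img c\<close> the field \<open>gram\<close> is arbitrary; cutting off by
  the indicator gives a function that is Borel on the whole plane. The same cut-off recurs
  below.\<close>

lemma dens_measurable: "(\<lambda>x. ennreal (dens x) * indicator (img c) x) \<in> borel_measurable borel"
proof -
  have "(\<lambda>x. dens x) \<in> borel_measurable (restrict_space borel (img c))"
    using dens_continuous by (rule borel_measurable_continuous_on_restrict)
  then have "(\<lambda>x. ennreal (dens x)) \<in> borel_measurable (restrict_space borel (img c))" by simp
  then show ?thesis
    using img_borel by (simp add: borel_measurable_restrict_space_iff_ennreal)
qed

end

end

section \<open>The Riemannian area\<close>

context riemannian_surface
begin

text \<open>The passage from local to global: compactness selects finitely many open sets with the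
  property \<open>Q\<close>, and removing the earlier ones from each makes them disjoint. Chart
  pieces, finiteness of the area and the local Lipschitz estimates all use it.\<close>

lemma finite_borel_partition:
  assumes "\<And>p. p \<in> points M \<Longrightarrow> \<exists>U. openin (surf_top M) U \<and> p \<in> U \<and> Q U"
  obtains n :: nat and U D where "\<And>i. i < n \<Longrightarrow> openin (surf_top M) (U i)" "\<And>i. i < n \<Longrightarrow> Q (U i)"
    "\<And>i. i < n \<Longrightarrow> D i \<subseteq> U i" "\<And>i. i < n \<Longrightarrow> D i \<in> sets (borel_alg M)"
    "disjoint_family_on D {..<n}" "(\<Union>i<n. D i) = points M"
proof -
  define \<U> where "\<U> = {U. openin (surf_top M) U \<and> Q U}"
  have "points M \<subseteq> \<Union>\<U>" using assms by (auto simp: \<U>_def)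
  moreover have "\<forall>U\<in>\<U>. openin (surf_top M) U" by (simp add: \<U>_def)
  ultimately obtain \<F> where F: "finite \<F>" "\<F> \<subseteq> \<U>" "points M \<subseteq> \<Union>\<F>"
    using compact unfolding compact_space_alt by metis
  obtain U :: "nat \<Rightarrow> 'a set" and n where U: "\<F> = U ` {i. i < n}"
    using F(1) finite_imp_nat_seg_image_inj_on by metis
  define D where "D i = U i - (\<Union>j<i. U j)" for i
  have op: "openin (surf_top M) (U i)" "Q (U i)" if "i < n" for i using F(2) U that by (auto simp: \<U>_def)
  have sets: "D i \<in> sets (borel_alg M)" if "i < n" for i
    unfolding D_def using that op open_borel_alg
    by (intro sets.Diff sets.finite_UN) auto
  have cov: "(\<Union>i<n. D i) = points M"
  proof (intro equalityI subsetI)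
    fix p assume "p \<in> points M"
    then have ex: "\<exists>i. i < n \<and> p \<in> U i" using F(3) U by auto
    define k where "k = (LEAST i. i < n \<and> p \<in> U i)"
    have k: "k < n" "p \<in> U k" using LeastI_ex[OF ex] by (auto simp: k_def)
    have "p \<notin> U j" if "j < k" for j using not_less_Least[of j "\<lambda>i. i < n \<and> p \<in> U i"] that k by (auto simp: k_def)
    then have "p \<in> D k" using k by (auto simp: D_def)
    then show "p \<in> (\<Union>i<n. D i)" using k by auto
  next
    fix p assume "p \<in> (\<Union>i<n. D i)"
    then show "p \<in> points M" using op openin_subset by (fastforce simp: D_def)
  qed
  have "disjoint_family_on D {..<n}"
    unfolding disjoint_family_on_def
  proof (intro ballI impI)
    fix i j assume "i \<in> {..<n}" "j \<in> {..<n}" "i \<noteq> j"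
    then show "D i \<inter> D j = {}" by (cases i j rule: linorder_cases) (auto simp: D_def)
  qed
  with that[of n U D] op sets cov show thesis by (auto simp: D_def)
qed

lemma transition:
  assumes c: "c \<in> atlas M" and d: "d \<in> atlas M" and p: "p \<in> chart_dom c" "p \<in> chart_dom d"
  obtains T :: "real^2^2" where
    "((chart_map d \<circ> chart_inv c) has_derivative (*v) T) (at (chart_map c p) within chart_map c ` (chart_dom c \<inter> chart_dom d))"
    "0 < det T" "gram M c (chart_map c p) = transpose T ** gram M d (chart_map d p) ** T"
proof -
  have x: "chart_map c p \<in> chart_map c ` (chart_dom c \<inter> chart_dom d)" using p by blast
  obtain T :: "real^2^2" where
    "((chart_map d \<circ> chart_inv c) has_derivative (*v) T) (at (chart_map c p) within chart_map c ` (chart_dom c \<inter> chart_dom d))"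
    "0 < det T" "gram M c (chart_map c p) = transpose T ** gram M d ((chart_map d \<circ> chart_inv c) (chart_map c p)) ** T"
    using compatible[OF c d] x unfolding compatible_charts_def Let_def by blast
  with that[of T] show thesis using chart_inv_map[OF c p(1)] by simp
qed

text \<open>By the tensor rule the determinants of the two Gram matrices differ by the factor
  \<open>(det T)\<^sup>2\<close>, so the densities differ by the Jacobian determinant of the
  transition map and the change of variables applies.\<close>

lemma dens_transition:
  assumes c: "c \<in> atlas M" and d: "d \<in> atlas M" and A: "A \<in> sets (borel_alg M)" "A \<subseteq> chart_dom c" "A \<subseteq> chart_dom d"
  shows "(\<integral>\<^sup>+x\<in>chart_map c ` A. ennreal (dens c x) \<partial>lborel) = (\<integral>\<^sup>+x\<in>chart_map d ` A. ennreal (dens d x) \<partial>lborel)"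
proof -
  let ?S = "chart_map c ` A" and ?h = "chart_map d \<circ> chart_inv c"
  have "\<exists>T. (?h has_derivative (*v) T) (at x within ?S) \<and> 0 < det T \<and>
      gram M c x = transpose T ** gram M d (?h x) ** T" if x: "x \<in> ?S" for x
  proof -
    obtain p where p: "p \<in> A" "x = chart_map c p" using x by (rule imageE)
    then have "p \<in> chart_dom c" "p \<in> chart_dom d" using A by auto
    then obtain T :: "real^2^2" where T: "(?h has_derivative (*v) T) (at x within chart_map c ` (chart_dom c \<inter> chart_dom d))"
      "0 < det T" "gram M c x = transpose T ** gram M d (chart_map d p) ** T"
      using transition[OF c d, of p] p by metis
    have "?S \<subseteq> chart_map c ` (chart_dom c \<inter> chart_dom d)" using A by auto
    then show ?thesis using T \<open>p \<in> chart_dom c\<close> p c by (auto intro: has_derivative_subset)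
  qed
  then obtain T where T: "\<And>x. x \<in> ?S \<Longrightarrow> (?h has_derivative (*v) (T x)) (at x within ?S)"
    "\<And>x. x \<in> ?S \<Longrightarrow> 0 < det (T x)"
    "\<And>x. x \<in> ?S \<Longrightarrow> gram M c x = transpose (T x) ** gram M d (?h x) ** T x" by metis
  have hS: "?h ` ?S = chart_map d ` A" using A c by (force simp: image_image)
  have inj: "inj_on ?h ?S"
  proof (rule inj_onI)
    fix x y assume x: "x \<in> ?S" and y: "y \<in> ?S" and eq: "?h x = ?h y"
    from x obtain p where p: "p \<in> A" "x = chart_map c p" by (rule imageE)
    from y obtain q where q: "q \<in> A" "y = chart_map c q" by (rule imageE)
    have "p \<in> chart_dom c" "q \<in> chart_dom c" "p \<in> chart_dom d" "q \<in> chart_dom d" using p q A by auto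
    moreover from this have "chart_map d p = chart_map d q" using eq p q c by simp
    ultimately show "x = y" using inj_onD[OF chart_inj[OF d]] p q by blast
  qed
  have S: "?S \<in> sets lebesgue" using chart_image_borel[OF c A(1,2)] by simp
  have eq: "ennreal (dens c x) = ennreal \<bar>det (matrix ((*v) (T x)))\<bar> * (ennreal (dens d (?h x)) * indicator (img d) (?h x))"
    if "x \<in> ?S" for x
  proof -
    have "?h x \<in> ?h ` ?S" using that by (rule imageI)
    then have "?h x \<in> img d" unfolding hS using A by blast
    moreover have "dens c x = \<bar>det (T x)\<bar> * dens d (?h x)"
    proof -
      have "det (gram M c x) = (det (T x))\<^sup>2 * det (gram M d (?h x))"
        by (subst T(3)[OF that]) (simp add: det_mul power2_eq_square)
      then have "dens c x = sqrt ((det (T x))\<^sup>2) * dens d (?h x)"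
        by (simp only: real_sqrt_mult)
      then show ?thesis by (simp only: real_sqrt_abs)
    qed
    ultimately show ?thesis
      by (simp only: matrix_of_matrix_vector_mul indicator_simps mult_1_right ennreal_mult' abs_ge_zero)
  qed
  have "(\<integral>\<^sup>+x\<in>?S. ennreal (dens c x) \<partial>lborel) = (\<integral>\<^sup>+x\<in>?S. ennreal \<bar>det (matrix ((*v) (T x)))\<bar> * (ennreal (dens d (?h x)) * indicator (img d) (?h x)) \<partial>lborel)"
    by (intro nn_integral_cong) (auto simp: eq indicator_def)
  also have "\<dots> = (\<integral>\<^sup>+x\<in>?h ` ?S. (ennreal (dens d x) * indicator (img d) x) \<partial>lborel)"
    using nn_integral_change_of_variables[OF S T(1) inj dens_measurable[OF d]] by (simp only: nn_integral_completion)
  also have "\<dots> = (\<integral>\<^sup>+x\<in>chart_map d ` A. ennreal (dens d x) \<partial>lborel)"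
    unfolding hS using A by (intro nn_integral_cong) (auto simp: indicator_def)
  finally show ?thesis .
qed

section \<open>Existence and uniqueness of the area measure\<close>

text \<open>The share of the area carried by \<open>D\<close>, transported from the coordinates of
  \<open>c\<close> to the surface. The area is a finite sum of such measures.\<close>

definition chart_measure :: "'a chart \<Rightarrow> 'a set \<Rightarrow> 'a measure" where
  "chart_measure c D = distr (density (restrict_space lborel (chart_map c ` D))
     (\<lambda>x. ennreal (dens c x) * indicator (img c) x)) (borel_alg M) (chart_inv c)"

lemma sets_chart_measure[simp]: "sets (chart_measure c D) = sets (borel_alg M)"
  by (simp add: chart_measure_def)

lemma emeasure_chart_measure:
  assumes c: "c \<in> atlas M" and D: "D \<in> sets (borel_alg M)" "D \<subseteq> chart_dom c" and A: "A \<in> sets (borel_alg M)"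
  shows "emeasure (chart_measure c D) A = (\<integral>\<^sup>+x\<in>chart_map c ` (A \<inter> D). ennreal (dens c x) \<partial>lborel)"
proof -
  let ?L = "restrict_space lborel (chart_map c ` D)" and ?w = "\<lambda>x. ennreal (dens c x) * indicator (img c) x"
  have sub: "chart_map c ` D \<subseteq> img c" using D by auto
  have DB: "chart_map c ` D \<in> sets lborel" using chart_image_borel[OF c D] by simp
  have w: "?w \<in> borel_measurable ?L" using dens_measurable[OF c] by (intro measurable_restrict_space1) simp
  have "chart_inv c \<in> restrict_space (restrict_space borel (img c)) (chart_map c ` D) \<rightarrow>\<^sub>M borel_alg M"
    using chart_inv_measurable[OF c] by (rule measurable_restrict_space1)
  then have inv: "chart_inv c \<in> restrict_space borel (chart_map c ` D) \<rightarrow>\<^sub>M borel_alg M"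
    using sub img_borel[OF c] DB by (simp add: restrict_restrict_space Int_absorb1)
  have inv': "chart_inv c \<in> density ?L ?w \<rightarrow>\<^sub>M borel_alg M"
    using inv by (subst measurable_cong_sets[OF _ refl, of _ "restrict_space borel (chart_map c ` D)"])
       (simp_all add: sets_restrict_space)
  have AD: "chart_inv c -` A \<inter> chart_map c ` D = chart_map c ` (A \<inter> D)" using D c by force
  have ADs: "chart_map c ` (A \<inter> D) \<in> sets ?L"
    using chart_image_borel[OF c, of "A \<inter> D"] A D DB by (subst sets_restrict_space_iff) auto
  have "emeasure (chart_measure c D) A = emeasure (density ?L ?w) (chart_map c ` (A \<inter> D))"
    unfolding chart_measure_def using inv' A
    by (subst emeasure_distr) (simp_all add: space_restrict_space AD)
  also have "\<dots> = (\<integral>\<^sup>+x. ?w x * indicator (chart_map c ` (A \<inter> D)) x \<partial>?L)"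
    using w ADs by (rule emeasure_density)
  also have "\<dots> = (\<integral>\<^sup>+x. (?w x * indicator (chart_map c ` (A \<inter> D)) x) * indicator (chart_map c ` D) x \<partial>lborel)"
    using DB by (intro nn_integral_restrict_space) auto
  also have "\<dots> = (\<integral>\<^sup>+x\<in>chart_map c ` (A \<inter> D). ennreal (dens c x) \<partial>lborel)"
    using sub by (intro nn_integral_cong) (auto simp: indicator_def)
  finally show ?thesis .
qed

lemma chart_partition:
  obtains n :: nat and c D where "\<And>i. i < n \<Longrightarrow> c i \<in> atlas M" "\<And>i. i < n \<Longrightarrow> D i \<subseteq> chart_dom (c i)"
    "\<And>i. i < n \<Longrightarrow> D i \<in> sets (borel_alg M)" "disjoint_family_on D {..<n}" "(\<Union>i<n. D i) = points M"
proof -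
  have 1: "\<exists>U. openin (surf_top M) U \<and> p \<in> U \<and> (\<exists>c\<in>atlas M. U \<subseteq> chart_dom c)" if p: "p \<in> points M" for p
  proof -
    obtain c where "c \<in> atlas M" "p \<in> chart_dom c" using atlas_cover[OF p] .
    then show ?thesis using chart_open by blast
  qed
  obtain n :: nat and U D where 2: "\<And>i. i < n \<Longrightarrow> openin (surf_top M) (U i)" "\<And>i. i < n \<Longrightarrow> \<exists>c\<in>atlas M. U i \<subseteq> chart_dom c"
    "\<And>i. i < n \<Longrightarrow> D i \<subseteq> U i" "\<And>i. i < n \<Longrightarrow> D i \<in> sets (borel_alg M)"
    "disjoint_family_on D {..<n}" "(\<Union>i<n. D i) = points M"
    using finite_borel_partition[of "\<lambda>U. \<exists>c\<in>atlas M. U \<subseteq> chart_dom c", OF 1] by blast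
  then have "\<forall>i. \<exists>c. i < n \<longrightarrow> c \<in> atlas M \<and> U i \<subseteq> chart_dom c" by blast
  then obtain c where "\<forall>i. i < n \<longrightarrow> c i \<in> atlas M \<and> U i \<subseteq> chart_dom (c i)" by (rule choice[THEN exE])
  with that[of n c D] 2 show thesis by blast
qed

text \<open>Sum the chart measures over a finite partition. To verify the defining property in
  another chart \<open>d\<close>, each piece is re-expressed in \<open>d\<close> by
  \<open>dens_transition\<close> and the pieces are added up again.\<close>

lemma is_area_exists: "\<exists>\<mu>. is_area M \<mu>"
proof -
  obtain n :: nat and c D where P: "\<And>i. i < n \<Longrightarrow> c i \<in> atlas M" "\<And>i. i < n \<Longrightarrow> D i \<subseteq> chart_dom (c i)"
    "\<And>i. i < n \<Longrightarrow> D i \<in> sets (borel_alg M)" "disjoint_family_on D {..<n}" "(\<Union>i<n. D i) = points M"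
    by (rule chart_partition) blast
  define m where "m A = (\<Sum>i<n. emeasure (chart_measure (c i) (D i)) A)" for A
  define \<mu> where "\<mu> = measure_of (points M) {U. openin (surf_top M) U} m"
  have sets: "sets \<mu> = sets (borel_alg M)" by (simp add: \<mu>_def borel_alg_def open_subsets)
  have em: "emeasure \<mu> A = m A" if "A \<in> sets (borel_alg M)" for A
  proof (rule emeasure_measure_of[OF \<mu>_def open_subsets])
    show "A \<in> sets \<mu>" using that sets by simp
    show "positive (sets \<mu>) m" by (simp add: positive_def m_def)
    show "countably_additive (sets \<mu>) m"
    proof (rule countably_additiveI)
      fix F :: "nat \<Rightarrow> 'a set" assume F: "range F \<subseteq> sets \<mu>" "disjoint_family F"
      have "(\<Sum>k. m (F k)) = (\<Sum>i<n. \<Sum>k. emeasure (chart_measure (c i) (D i)) (F k))"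
        unfolding m_def by (intro suminf_sum) simp
      also have "\<dots> = m (\<Union>k. F k)"
        unfolding m_def using F sets by (intro sum.cong refl suminf_emeasure) auto
      finally show "(\<Sum>k. m (F k)) = m (\<Union>k. F k)" .
    qed
  qed
  have "emeasure \<mu> A = (\<integral>\<^sup>+x\<in>chart_map d ` A. ennreal (dens d x) \<partial>lborel)"
    if d: "d \<in> atlas M" and A: "A \<in> sets (borel_alg M)" "A \<subseteq> chart_dom d" for d A
  proof -
    have "emeasure (chart_measure (c i) (D i)) A = emeasure (chart_measure d A) (A \<inter> D i)" if "i < n" for i
    proof -
      have "emeasure (chart_measure (c i) (D i)) A = (\<integral>\<^sup>+x\<in>chart_map (c i) ` (A \<inter> D i). ennreal (dens (c i) x) \<partial>lborel)"
        using P that A by (intro emeasure_chart_measure) auto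
      also have "\<dots> = (\<integral>\<^sup>+x\<in>chart_map d ` (A \<inter> D i). ennreal (dens d x) \<partial>lborel)"
        using P that A d by (intro dens_transition sets.Int) auto
      also have "\<dots> = emeasure (chart_measure d A) (A \<inter> D i)"
        using P that A d by (subst emeasure_chart_measure) (auto simp: Int_absorb2 Int_commute Int_left_commute)
      finally show ?thesis .
    qed
    then have "emeasure \<mu> A = (\<Sum>i<n. emeasure (chart_measure d A) (A \<inter> D i))"
      using em[OF A(1)] by (simp add: m_def)
    also have "\<dots> = emeasure (chart_measure d A) A"
      using P A sets.sets_into_space[OF A(1)] by (intro sum_emeasure_cover[symmetric]) auto
    also have "\<dots> = (\<integral>\<^sup>+x\<in>chart_map d ` A. ennreal (dens d x) \<partial>lborel)"
      using emeasure_chart_measure[OF d A A(1)] by simp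
    finally show ?thesis .
  qed
  then show ?thesis using sets by (intro exI[of _ \<mu>]) (auto simp: is_area_def sets_borel_alg)
qed

text \<open>A Borel set is cut into finitely many pieces, each inside one chart domain, where the
  defining property leaves no choice.\<close>

lemma is_area_unique: assumes "is_area M \<mu>" "is_area M \<nu>" shows "\<mu> = \<nu>"
proof (rule measure_eqI)
  have s: "sets \<mu> = sets (borel_alg M)" "sets \<nu> = sets (borel_alg M)"
    using assms by (auto simp: is_area_def sets_borel_alg)
  then show "sets \<mu> = sets \<nu>" by simp
  obtain n :: nat and c D where P: "\<And>i. i < n \<Longrightarrow> c i \<in> atlas M" "\<And>i. i < n \<Longrightarrow> D i \<subseteq> chart_dom (c i)"
    "\<And>i. i < n \<Longrightarrow> D i \<in> sets (borel_alg M)" "disjoint_family_on D {..<n}" "(\<Union>i<n. D i) = points M"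
    by (rule chart_partition) blast
  fix A assume "A \<in> sets \<mu>"
  then have A: "A \<in> sets (borel_alg M)" using s by simp
  have "emeasure \<rho> A = (\<Sum>i<n. \<integral>\<^sup>+x\<in>chart_map (c i) ` (A \<inter> D i). ennreal (dens (c i) x) \<partial>lborel)"
    if "is_area M \<rho>" for \<rho>
  proof -
    have sr: "sets \<rho> = sets (borel_alg M)" using that by (simp add: is_area_def sets_borel_alg)
    have "emeasure \<rho> A = (\<Sum>i<n. emeasure \<rho> (A \<inter> D i))"
      using P A sr sets.sets_into_space[OF A] by (intro sum_emeasure_cover) auto
    also have "\<dots> = (\<Sum>i<n. \<integral>\<^sup>+x\<in>chart_map (c i) ` (A \<inter> D i). ennreal (dens (c i) x) \<partial>lborel)"
    proof (intro sum.cong refl)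
      fix i assume "i \<in> {..<n}"
      then have "c i \<in> atlas M" "A \<inter> D i \<in> sets \<rho>" "A \<inter> D i \<subseteq> chart_dom (c i)" using P A sr by auto
      then show "emeasure \<rho> (A \<inter> D i) = (\<integral>\<^sup>+x\<in>chart_map (c i) ` (A \<inter> D i). ennreal (dens (c i) x) \<partial>lborel)"
        using that unfolding is_area_def by blast
    qed
    finally show ?thesis .
  qed
  then show "emeasure \<mu> A = emeasure \<nu> A" using assms by simp
qed

lemma riemannian_area_is_area: "is_area M (riemannian_area M)"
proof -
  obtain \<mu> where m: "is_area M \<mu>" using is_area_exists by blast
  then show ?thesis
    unfolding riemannian_area_def is_area_def[symmetric]
    by (rule theI[of "is_area M"]) (rule is_area_unique[OF _ m])
qed

abbreviation "\<mu> \<equiv> riemannian_area M"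

lemma sets_area[simp]: "sets \<mu> = sets (borel_alg M)"
  using riemannian_area_is_area by (simp add: is_area_def sets_borel_alg)

lemma space_area[simp]: "space \<mu> = points M"
  using sets_eq_imp_space_eq[OF sets_area] by simp

lemma emeasure_area:
  assumes "c \<in> atlas M" "A \<in> sets (borel_alg M)" "A \<subseteq> chart_dom c"
  shows "emeasure \<mu> A = (\<integral>\<^sup>+x\<in>chart_map c ` A. ennreal (dens c x) \<partial>lborel)"
proof -
  have "\<forall>c\<in>atlas M. \<forall>A\<in>sets \<mu>. A \<subseteq> chart_dom c \<longrightarrow>
      emeasure \<mu> A = (\<integral>\<^sup>+x\<in>chart_map c ` A. ennreal (dens c x) \<partial>lborel)"
    using riemannian_area_is_area unfolding is_area_def by (rule conjunct2)
  moreover have "A \<in> sets \<mu>" using assms by simp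
  ultimately show ?thesis using assms by blast
qed

section \<open>Null sets and integrals in coordinates\<close>

lemma dens_measurable_on:
  assumes c: "c \<in> atlas M" and Y: "Y \<in> sets borel" "Y \<subseteq> img c"
  shows "(\<lambda>x. ennreal (dens c x) * indicator Y x) \<in> borel_measurable borel"
proof -
  have "(\<lambda>x. (ennreal (dens c x) * indicator (img c) x) * indicator Y x) \<in> borel_measurable borel"
    by (rule borel_measurable_times_ennreal[OF dens_measurable[OF c] borel_measurable_indicator[OF Y(1)]])
  moreover have "(\<lambda>x. (ennreal (dens c x) * indicator (img c) x) * indicator Y x) = (\<lambda>x. ennreal (dens c x) * indicator Y x)"
    using Y by (intro ext) (auto simp: indicator_def)
  ultimately show ?thesis by simp
qed

lemma dens_integral_zero_iff:
  assumes c: "c \<in> atlas M" and Y: "Y \<in> sets borel" "Y \<subseteq> img c"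
  shows "(\<integral>\<^sup>+x\<in>Y. ennreal (dens c x) \<partial>lborel) = 0 \<longleftrightarrow> negligible Y"
proof -
  have "(\<integral>\<^sup>+x\<in>Y. ennreal (dens c x) \<partial>lborel) = 0 \<longleftrightarrow> (AE x in lborel. ennreal (dens c x) * indicator Y x = 0)"
    using dens_measurable_on[OF c Y] by (intro nn_integral_0_iff_AE) simp
  also have "\<dots> \<longleftrightarrow> (AE x in lborel. x \<notin> Y)"
  proof (rule AE_cong)
    fix x show "(ennreal (dens c x) * indicator Y x = 0) = (x \<notin> Y)"
      using dens_pos[OF c, of x] Y by (cases "x \<in> Y") (auto simp: ennreal_eq_0_iff not_le)
  qed
  also have "\<dots> \<longleftrightarrow> Y \<in> null_sets lborel"
    using Y by (subst AE_iff_null_sets) auto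
  also have "\<dots> \<longleftrightarrow> negligible Y"
    using Y by (simp add: negligible_iff_null_sets null_sets_completion_iff)
  finally show ?thesis .
qed

lemma chart_map_inv_image: "c \<in> atlas M \<Longrightarrow> Y \<subseteq> img c \<Longrightarrow> chart_map c ` chart_inv c ` Y = Y"
  by (auto simp: image_image subset_iff)

lemma chart_inv_map_image: "c \<in> atlas M \<Longrightarrow> A \<subseteq> chart_dom c \<Longrightarrow> chart_inv c ` chart_map c ` A = A"
  by (auto simp: image_image subset_iff)

lemma chart_inv_image_subset: "c \<in> atlas M \<Longrightarrow> Y \<subseteq> img c \<Longrightarrow> chart_inv c ` Y \<subseteq> chart_dom c"
  by (auto simp: subset_iff)

text \<open>The density is positive on the chart image, so null sets correspond. Since
  \<open>negligible\<close> refers to Lebesgue measure, whose null sets need not be Borel, the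
  counterpart on the surface is the completion of the area.\<close>

lemma null_sets_chart_iff:
  assumes c: "c \<in> atlas M" and A: "A \<subseteq> chart_dom c"
  shows "A \<in> null_sets (completion \<mu>) \<longleftrightarrow> negligible (chart_map c ` A)"
proof
  assume "A \<in> null_sets (completion \<mu>)"
  then obtain N' where N: "N' \<in> null_sets \<mu>" "A \<subseteq> N'" by (auto simp: null_sets_completion_iff2)
  let ?B = "N' \<inter> chart_dom c"
  have B: "?B \<in> sets (borel_alg M)" using N(1) open_borel_alg[OF chart_open[OF c]] by (auto simp: null_sets_def)
  have "emeasure \<mu> ?B = 0" using N(1) B by (metis Int_lower1 null_sets_subset null_setsD1 sets_area)
  then have "negligible (chart_map c ` ?B)"
    using dens_integral_zero_iff[OF c chart_image_borel[OF c B]] emeasure_area[OF c B] by auto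
  then show "negligible (chart_map c ` A)" by (rule negligible_subset) (use A N in auto)
next
  assume "negligible (chart_map c ` A)"
  then obtain Y where Y: "Y \<in> null_sets lborel" "chart_map c ` A \<subseteq> Y"
    by (auto simp: negligible_iff_null_sets null_sets_completion_iff2)
  let ?Y = "Y \<inter> img c"
  have Yb: "?Y \<in> sets borel" "?Y \<subseteq> img c" using Y(1) img_borel[OF c] by (auto simp: null_sets_def)
  have "negligible Y" using Y(1) by (auto simp: negligible_iff_null_sets null_sets_completionI)
  then have "negligible ?Y" by (rule negligible_subset) auto
  then have "emeasure \<mu> (chart_inv c ` ?Y) = 0"
    using emeasure_area[OF c chart_inv_image_borel[OF c Yb] chart_inv_image_subset[OF c Yb(2)]]
      dens_integral_zero_iff[OF c Yb] chart_map_inv_image[OF c Yb(2)] by simp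
  then have "chart_inv c ` ?Y \<in> null_sets \<mu>" using chart_inv_image_borel[OF c Yb] by auto
  moreover have "A \<subseteq> chart_inv c ` ?Y"
  proof
    fix p assume "p \<in> A"
    then show "p \<in> chart_inv c ` ?Y" using A Y(2) c by (intro image_eqI[of _ _ "chart_map c p"]) auto
  qed
  ultimately show "A \<in> null_sets (completion \<mu>)" by (auto simp: null_sets_completion_iff2)
qed

lemma completion_chart_inv:
  assumes c: "c \<in> atlas M" and Y: "Y \<in> sets lebesgue" "Y \<subseteq> img c"
  shows "chart_inv c ` Y \<in> sets (completion \<mu>)"
    and "emeasure (completion \<mu>) (chart_inv c ` Y) = (\<integral>\<^sup>+x\<in>Y. ennreal (dens c x) \<partial>lebesgue)"
proof -
  \<comment> \<open>A Lebesgue set is a Borel set up to a null set; the Borel part is handled by the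
    defining property of the area, the rest by \<open>null_sets_chart_iff\<close>.\<close>
  define B N where "B = main_part lborel Y" and "N = null_part lborel Y"
  have BN: "Y = B \<union> N" using main_part_null_part_Un[OF Y(1)] by (simp add: B_def N_def)
  have B: "B \<in> sets borel" using main_part_sets[OF Y(1)] unfolding B_def[symmetric] by simp
  have N: "N \<in> null_sets lebesgue" using null_part_null_sets[OF Y(1)] unfolding N_def[symmetric] .
  have "B \<subseteq> img c" "N \<subseteq> img c" using BN Y(2) by blast+
  note B = B this(1) and N = N this(2)
  have n: "chart_inv c ` N \<in> null_sets (completion \<mu>)"
    using N chart_map_inv_image[OF c N(2)] chart_inv_image_subset[OF c N(2)]
    by (subst null_sets_chart_iff[OF c]) (auto simp: negligible_iff_null_sets)
  have b: "chart_inv c ` B \<in> sets \<mu>" using chart_inv_image_borel[OF c B] by simp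
  have u: "chart_inv c ` Y = chart_inv c ` B \<union> chart_inv c ` N" using BN by auto
  show "chart_inv c ` Y \<in> sets (completion \<mu>)"
    unfolding u by (rule sets.Un[OF sets_completionI_sets[OF b] null_setsD2[OF n]])
  have "emeasure (completion \<mu>) (chart_inv c ` Y) = emeasure (completion \<mu>) (chart_inv c ` B)"
    unfolding u by (rule emeasure_Un_null_set[OF sets_completionI_sets[OF b] n])
  also have "\<dots> = emeasure \<mu> (chart_inv c ` B)" using b by simp
  also have "\<dots> = (\<integral>\<^sup>+x\<in>B. ennreal (dens c x) \<partial>lborel)"
    using emeasure_area[OF c chart_inv_image_borel[OF c B] chart_inv_image_subset[OF c B(2)]]
      chart_map_inv_image[OF c B(2)] by simp
  also have "\<dots> = (\<integral>\<^sup>+x\<in>B. ennreal (dens c x) \<partial>lebesgue)" by (simp add: nn_integral_completion)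
  also have "\<dots> = (\<integral>\<^sup>+x\<in>Y. ennreal (dens c x) \<partial>lebesgue)"
  proof (rule nn_integral_cong_AE, rule AE_mp[OF AE_not_in[OF N(1)]], intro AE_I2 impI)
    fix x assume "x \<notin> N"
    then have "indicator B x = (indicator Y x :: ennreal)" unfolding BN by (simp add: indicator_def)
    then show "ennreal (dens c x) * indicator B x = ennreal (dens c x) * indicator Y x" by simp
  qed
  finally show "emeasure (completion \<mu>) (chart_inv c ` Y) = (\<integral>\<^sup>+x\<in>Y. ennreal (dens c x) \<partial>lebesgue)" .
qed

context
  fixes c D assumes c: "c \<in> atlas M" and D: "D \<in> sets (borel_alg M)" "D \<subseteq> chart_dom c"
begin

lemma D_completion: "D \<in> sets (completion \<mu>)"
  using D by (intro sets_completionI_sets) simp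

lemma image_lebesgue: "chart_map c ` D \<in> sets lebesgue"
  using chart_image_borel[OF c D] by simp

lemma preimage_lebesgue:
  assumes "Y \<in> sets (lebesgue_on (chart_map c ` D))"
  shows "Y \<in> sets lebesgue" "Y \<subseteq> img c" "chart_map c -` Y \<inter> D = chart_inv c ` Y"
proof -
  have Y: "Y \<in> sets lebesgue" "Y \<subseteq> chart_map c ` D"
    using assms image_lebesgue by (auto simp: sets_restrict_space_iff)
  then show "Y \<in> sets lebesgue" "Y \<subseteq> img c" using D by auto
  show "chart_map c -` Y \<inter> D = chart_inv c ` Y"
  proof (intro equalityI subsetI)
    fix p assume "p \<in> chart_map c -` Y \<inter> D"
    then show "p \<in> chart_inv c ` Y" using D c by (intro image_eqI[of _ _ "chart_map c p"]) auto
  next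
    fix p assume "p \<in> chart_inv c ` Y"
    then obtain q where "q \<in> D" "chart_map c q \<in> Y" "p = chart_inv c (chart_map c q)" using Y(2) by blast
    moreover from this have "p = q" using D c by auto
    ultimately show "p \<in> chart_map c -` Y \<inter> D" by simp
  qed
qed

text \<open>Preimages of Lebesgue sets, not only of Borel sets, are needed here; they are measurable
  in the completion because inverse charts preserve null sets.\<close>

lemma chart_map_completion_measurable:
  "chart_map c \<in> restrict_space (completion \<mu>) D \<rightarrow>\<^sub>M lebesgue_on (chart_map c ` D)"
proof (rule measurableI)
  have sp: "space (restrict_space (completion \<mu>) D) = D"
    using D sets.sets_into_space[OF D(1)] by (auto simp: space_restrict_space)
  show "chart_map c x \<in> space (lebesgue_on (chart_map c ` D))" if "x \<in> space (restrict_space (completion \<mu>) D)" for x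
    using that sp by (auto simp: space_restrict_space)
  fix Y assume Y: "Y \<in> sets (lebesgue_on (chart_map c ` D))"
  show "chart_map c -` Y \<inter> space (restrict_space (completion \<mu>) D) \<in> sets (restrict_space (completion \<mu>) D)"
    unfolding sp using completion_chart_inv(1)[OF c preimage_lebesgue(1,2)[OF Y]] preimage_lebesgue(3)[OF Y]
      D_completion sets.Int_space_eq2[OF D_completion]
    by (subst sets_restrict_space_iff) auto
qed

lemma measurable_from_chart:
  assumes "(\<lambda>x. f (chart_inv c x)) \<in> lebesgue_on (chart_map c ` D) \<rightarrow>\<^sub>M K"
  shows "f \<in> restrict_space (completion \<mu>) D \<rightarrow>\<^sub>M K"
proof -
  have "(\<lambda>p. f (chart_inv c (chart_map c p))) \<in> restrict_space (completion \<mu>) D \<rightarrow>\<^sub>M K"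
    by (rule measurable_compose[OF chart_map_completion_measurable assms])
  moreover have "f (chart_inv c (chart_map c p)) = f p" if "p \<in> space (restrict_space (completion \<mu>) D)" for p
  proof -
    have "p \<in> D" using that by (simp add: space_restrict_space)
    then show ?thesis using D c by (simp add: subset_iff)
  qed
  ultimately show ?thesis by (subst (asm) measurable_cong[where g=f])
qed

lemma distr_chart:
  "distr (restrict_space (completion \<mu>) D) (lebesgue_on (chart_map c ` D)) (chart_map c)
    = density (lebesgue_on (chart_map c ` D)) (\<lambda>x. ennreal (dens c x) * indicator (img c) x)" (is "?L = ?R")
proof (rule measure_eqI)
  fix Y assume "Y \<in> sets ?L"
  then have Y: "Y \<in> sets (lebesgue_on (chart_map c ` D))" by simp
  have sp: "space (restrict_space (completion \<mu>) D) = D"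
    using D sets.sets_into_space[OF D(1)] by (auto simp: space_restrict_space)
  have sub: "Y \<subseteq> chart_map c ` D" using Y image_lebesgue by (auto simp: sets_restrict_space_iff)
  have w: "(\<lambda>x. ennreal (dens c x) * indicator (img c) x) \<in> borel_measurable (lebesgue_on (chart_map c ` D))"
    using dens_measurable[OF c] by (intro measurable_restrict_space1 measurable_completion) simp
  have "emeasure ?L Y = emeasure (restrict_space (completion \<mu>) D) (chart_inv c ` Y)"
    using Y preimage_lebesgue(3)[OF Y] by (subst emeasure_distr[OF chart_map_completion_measurable]) (simp_all add: sp)
  also have "\<dots> = emeasure (completion \<mu>) (chart_inv c ` Y)"
    using preimage_lebesgue(3)[OF Y] sets.Int_space_eq2[OF D_completion] D_completion
    by (intro emeasure_restrict_space) auto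
  also have "\<dots> = (\<integral>\<^sup>+x\<in>Y. ennreal (dens c x) \<partial>lebesgue)"
    using completion_chart_inv(2)[OF c preimage_lebesgue(1,2)[OF Y]] .
  also have "\<dots> = (\<integral>\<^sup>+x. ((ennreal (dens c x) * indicator (img c) x) * indicator Y x) * indicator (chart_map c ` D) x \<partial>lebesgue)"
    using sub preimage_lebesgue(2)[OF Y] by (intro nn_integral_cong) (auto simp: indicator_def)
  also have "\<dots> = (\<integral>\<^sup>+x. (ennreal (dens c x) * indicator (img c) x) * indicator Y x \<partial>lebesgue_on (chart_map c ` D))"
    using image_lebesgue by (intro nn_integral_restrict_space[symmetric]) simp
  also have "\<dots> = emeasure ?R Y"
    using w Y by (rule emeasure_density[symmetric])
  finally show "emeasure ?L Y = emeasure ?R Y" .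
qed simp

text \<open>The integrand is only asked to be Lebesgue measurable in coordinates, as derivatives
  are. The integral is therefore moved to the completion, which does not change it, and then pushed
  forward by \<open>distr_chart\<close>.\<close>

lemma nn_integral_chart:
  assumes u: "(\<lambda>x. u (chart_inv c x)) \<in> borel_measurable (lebesgue_on (chart_map c ` D))"
  shows "(\<integral>\<^sup>+p\<in>D. u p \<partial>\<mu>) = (\<integral>\<^sup>+x\<in>chart_map c ` D. ennreal (dens c x) * u (chart_inv c x) \<partial>lebesgue)"
proof -
  let ?L = "lebesgue_on (chart_map c ` D)" and ?w = "\<lambda>x. ennreal (dens c x) * indicator (img c) x"
  have w: "?w \<in> borel_measurable ?L"
    using dens_measurable[OF c] by (intro measurable_restrict_space1 measurable_completion) simp
  have "(\<integral>\<^sup>+p\<in>D. u p \<partial>\<mu>) = (\<integral>\<^sup>+p\<in>D. u p \<partial>completion \<mu>)" by (simp only: nn_integral_completion)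
  also have "\<dots> = (\<integral>\<^sup>+p. u p \<partial>restrict_space (completion \<mu>) D)"
    using sets.Int_space_eq2[OF D_completion] D_completion by (intro nn_integral_restrict_space[symmetric]) auto
  also have "\<dots> = (\<integral>\<^sup>+p. u (chart_inv c (chart_map c p)) \<partial>restrict_space (completion \<mu>) D)"
    using D c by (intro nn_integral_cong) (auto simp: space_restrict_space)
  also have "\<dots> = (\<integral>\<^sup>+x. u (chart_inv c x) \<partial>distr (restrict_space (completion \<mu>) D) ?L (chart_map c))"
    using u by (intro nn_integral_distr[symmetric] chart_map_completion_measurable) simp
  also have "\<dots> = (\<integral>\<^sup>+x. ?w x * u (chart_inv c x) \<partial>?L)"
    unfolding distr_chart using w u by (rule nn_integral_density)
  also have "\<dots> = (\<integral>\<^sup>+x\<in>chart_map c ` D. ?w x * u (chart_inv c x) \<partial>lebesgue)"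
    using image_lebesgue by (intro nn_integral_restrict_space) simp
  also have "\<dots> = (\<integral>\<^sup>+x\<in>chart_map c ` D. ennreal (dens c x) * u (chart_inv c x) \<partial>lebesgue)"
    using D by (intro nn_integral_cong) (auto simp: indicator_def)
  finally show ?thesis .
qed

end

text \<open>In a chart, a nonempty open set becomes relatively open in a model region and so has
  interior points, hence is not negligible.\<close>

lemma open_area_pos:
  assumes "openin (surf_top M) U" "U \<noteq> {}"
  shows "emeasure \<mu> U \<noteq> 0"
proof
  assume 0: "emeasure \<mu> U = 0"
  from assms obtain p where p: "p \<in> U" by auto
  then have "p \<in> points M" using assms(1) openin_subset by auto
  then obtain c where c: "c \<in> atlas M" "p \<in> chart_dom c" by (rule atlas_cover)
  have "U \<in> null_sets \<mu>" using 0 open_borel_alg[OF assms(1)] by auto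
  then have "U \<inter> chart_dom c \<in> null_sets (completion \<mu>)" by (auto simp: null_sets_completion_iff2)
  then have neg: "negligible (chart_map c ` (U \<inter> chart_dom c))"
    using null_sets_chart_iff[OF c(1), of "U \<inter> chart_dom c"] by simp
  obtain R where R: "model_region R" "openin (top_of_set R) (img c)" by (rule img_region[OF c(1)])
  have "openin (top_of_set R) (chart_map c ` (U \<inter> chart_dom c))"
    using chart_image_open[OF c(1) assms(1)] R(2) by (rule openin_trans)
  moreover have "chart_map c ` (U \<inter> chart_dom c) \<noteq> {}" using p c by auto
  ultimately have "interior (chart_map c ` (U \<inter> chart_dom c)) \<noteq> {}"
    by (rule model_region_interior[OF R(1)])
  moreover have "negligible (interior (chart_map c ` (U \<inter> chart_dom c)))"
    using neg interior_subset by (rule negligible_subset)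
  ultimately show False using open_not_negligible open_interior by blast
qed

text \<open>Near every point the density is bounded on a bounded coordinate ball; compactness does
  the rest.\<close>

lemma area_finite: "emeasure \<mu> (points M) < \<infinity>"
proof -
  have 1: "\<exists>U. openin (surf_top M) U \<and> p \<in> U \<and> emeasure \<mu> U < \<infinity>" if p: "p \<in> points M" for p
  proof -
    obtain c where c: "c \<in> atlas M" "p \<in> chart_dom c" using atlas_cover[OF p] .
    let ?x = "chart_map c p"
    have x: "?x \<in> img c" using c by simp
    obtain r where r: "r > 0" "\<And>y. y \<in> img c \<Longrightarrow> dist y ?x < r \<Longrightarrow> dist (dens c y) (dens c ?x) < 1"
      using dens_continuous[OF c(1)] x unfolding continuous_on_iff by (metis zero_less_one)
    define U where "U = {q \<in> chart_dom c. chart_map c q \<in> ball ?x r}"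
    have op: "openin (surf_top M) U" unfolding U_def by (rule chart_preimage_open[OF c(1)]) simp
    have Ub: "U \<in> sets (borel_alg M)" "U \<subseteq> chart_dom c" using open_borel_alg[OF op] by (auto simp: U_def)
    have "emeasure \<mu> U = (\<integral>\<^sup>+y\<in>chart_map c ` U. ennreal (dens c y) \<partial>lborel)"
      by (rule emeasure_area[OF c(1) Ub])
    also have "\<dots> \<le> (\<integral>\<^sup>+y. ennreal (dens c ?x + 1) * indicator (ball ?x r) y \<partial>lborel)"
    proof (intro nn_integral_mono)
      fix y show "ennreal (dens c y) * indicator (chart_map c ` U) y \<le> ennreal (dens c ?x + 1) * indicator (ball ?x r) y"
      proof (cases "y \<in> chart_map c ` U")
        case True
        then have y: "y \<in> img c" "y \<in> ball ?x r" by (auto simp: U_def)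
        then have "dens c y \<le> dens c ?x + 1" using r(2)[of y] by (auto simp: dist_commute dist_real_def)
        then show ?thesis using True y by (simp add: ennreal_leI)
      qed simp
    qed
    also have "\<dots> = ennreal (dens c ?x + 1) * emeasure lborel (ball ?x r)"
      by (intro nn_integral_cmult_indicator) simp
    also have "\<dots> < \<infinity>"
      using emeasure_bounded_finite[of "ball ?x r"] by (simp add: ennreal_mult_less_top)
    finally have "emeasure \<mu> U < \<infinity>" .
    moreover have "p \<in> U" using c r by (simp add: U_def)
    ultimately show ?thesis using op by blast
  qed
  obtain n :: nat and U D where 2: "\<And>i. i < n \<Longrightarrow> openin (surf_top M) (U i)" "\<And>i. i < n \<Longrightarrow> emeasure \<mu> (U i) < \<infinity>"
    "\<And>i. i < n \<Longrightarrow> D i \<subseteq> U i" "\<And>i. i < n \<Longrightarrow> D i \<in> sets (borel_alg M)"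
    "disjoint_family_on D {..<n}" "(\<Union>i<n. D i) = points M"
    using finite_borel_partition[of "\<lambda>U. emeasure \<mu> U < \<infinity>", OF 1] by blast
  have "emeasure \<mu> (points M) = (\<Sum>i<n. emeasure \<mu> (D i))"
    unfolding 2(6)[symmetric] using 2 by (intro sum_emeasure[symmetric]) auto
  also have "\<dots> < \<infinity>"
  proof -
    have "emeasure \<mu> (D i) < \<infinity>" if "i < n" for i
      using emeasure_mono[of "D i" "U i" \<mu>] 2 that open_borel_alg by (metis le_less_trans sets_area)
    then show ?thesis by auto
  qed
  finally show ?thesis .
qed

sublocale area: finite_measure \<mu>
  using area_finite by (intro finite_measureI) auto

lemma area_pos: "0 < area M (points M)"
  using open_area_pos[OF openin_topspace] points_nonempty
  by (simp add: area.emeasure_eq_measure zero_less_measure_iff)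

end

section \<open>Riemannian distance in coordinates\<close>

text \<open>The fundamental theorem of calculus yields a gauge integral, while lengths are Lebesgue
  integrals. If the right-hand side is finite, \<open>F\<close> is Lebesgue integrable on
  \<open>S\<close> and the two integrals agree.\<close>

lemma norm_has_integral_le:
  fixes F :: "real \<Rightarrow> 'b::euclidean_space"
  assumes "(F has_integral I) S"
  shows "ennreal (norm I) \<le> (\<integral>\<^sup>+x\<in>S. ennreal (norm (F x)) \<partial>lborel)"
proof (cases "(\<integral>\<^sup>+x\<in>S. ennreal (norm (F x)) \<partial>lborel) = \<infinity>")
  case False
  let ?F = "\<lambda>x. indicator S x *\<^sub>R F x"
  have eq: "(\<integral>\<^sup>+x. ennreal (norm (?F x)) \<partial>lebesgue) = (\<integral>\<^sup>+x\<in>S. ennreal (norm (F x)) \<partial>lborel)"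
    unfolding nn_integral_completion by (intro nn_integral_cong) (auto simp: indicator_def)
  have "?F \<in> borel_measurable lebesgue"
    using assms by (rule has_integral_implies_lebesgue_measurable)
  then have int: "integrable lebesgue ?F"
    using False eq by (intro integrableI_bounded) (auto simp: top.not_eq_extremum)
  have "(?F has_integral (integral\<^sup>L lebesgue ?F)) UNIV"
    using int by (rule has_integral_integral_lebesgue)
  moreover have "(?F has_integral I) UNIV"
    using assms unfolding indicator_scaleR_eq_if has_integral_restrict_UNIV .
  ultimately have "integral\<^sup>L lebesgue ?F = I" by (rule has_integral_unique)
  then show ?thesis using integral_norm_bound_ennreal[OF int] eq by simp
qed simp

context riemannian_surface
begin

lemma path_preimage_open:
  assumes "pathin (surf_top M) \<gamma>" "openin (surf_top M) U"
  shows "openin (top_of_set {0..1}) {t \<in> {0..1}. \<gamma> t \<in> U}" "open {t \<in> {0<..<1}. \<gamma> t \<in> U}"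
proof -
  show 1: "openin (top_of_set {0..1}) {t \<in> {0..1}. \<gamma> t \<in> U}"
    using openin_continuous_map_preimage[OF assms(1)[unfolded pathin_def] assms(2)] by simp
  then obtain T where T: "open T" "{t \<in> {0..1}. \<gamma> t \<in> U} = {0..1} \<inter> T" by (auto simp: openin_open)
  have eq: "{t \<in> {0<..<1}. \<gamma> t \<in> U} = {0<..<1} \<inter> T"
  proof (intro set_eqI)
    fix t :: real
    have "t \<in> {t \<in> {0..1}. \<gamma> t \<in> U} \<longleftrightarrow> t \<in> {0..1} \<inter> T" by (simp only: T(2))
    then show "t \<in> {t \<in> {0<..<1}. \<gamma> t \<in> U} \<longleftrightarrow> t \<in> {0<..<1} \<inter> T" by auto
  qed
  show "open {t \<in> {0<..<1}. \<gamma> t \<in> U}"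
    unfolding eq by (rule open_Int[OF open_greaterThanLessThan T(1)])
qed

text \<open>\<open>speed\<close> uses the chart selected at the current point, which may change with
  time; the tensor rule allows a fixed chart instead. Interior times guarantee that the curve stays
  in both chart domains on a full neighbourhood of \<open>t\<close>.\<close>

lemma speed_chart:
  assumes c: "c \<in> atlas M" and \<gamma>: "pathin (surf_top M) \<gamma>" and t: "0 < t" "t < 1" "\<gamma> t \<in> chart_dom c"
    and v: "((chart_map c \<circ> \<gamma>) has_vector_derivative v) (at t)"
  shows "speed M \<gamma> t = sqrt (v \<bullet> (gram M c (chart_map c (\<gamma> t)) *v v))"
proof -
  have pt: "\<gamma> t \<in> points M" using t chart_subset[OF c] by auto
  define d where "d = chart_at M (\<gamma> t)"
  have d: "d \<in> atlas M" "\<gamma> t \<in> chart_dom d" using chart_at[OF pt] by (auto simp: d_def)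
  define W where "W = {s \<in> {0<..<1}. \<gamma> s \<in> chart_dom c \<inter> chart_dom d}"
  have "open W" unfolding W_def
    by (rule path_preimage_open(2)[OF \<gamma> openin_Int[OF chart_open[OF c] chart_open[OF d(1)]]])
  moreover have "t \<in> W" using t d by (simp add: W_def)
  ultimately have W: "open W" "t \<in> W" .
  let ?S = "chart_map c ` (chart_dom c \<inter> chart_dom d)"
  obtain T :: "real^2^2" where T:
    "((chart_map d \<circ> chart_inv c) has_derivative (*v) T) (at (chart_map c (\<gamma> t)) within ?S)"
    "0 < det T" "gram M c (chart_map c (\<gamma> t)) = transpose T ** gram M d (chart_map d (\<gamma> t)) ** T"
    by (rule transition[OF c d(1) t(3) d(2)])
  have sub: "(chart_map c \<circ> \<gamma>) ` W \<subseteq> ?S" by (auto simp: W_def)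
  have "((chart_map c \<circ> \<gamma>) has_derivative (\<lambda>h. h *\<^sub>R v)) (at t within W)"
    using v unfolding has_vector_derivative_def by (rule has_derivative_at_withinI)
  moreover have "((chart_map d \<circ> chart_inv c) has_derivative (*v) T) (at ((chart_map c \<circ> \<gamma>) t) within (chart_map c \<circ> \<gamma>) ` W)"
    using has_derivative_subset[OF T(1) sub] by simp
  ultimately have "((chart_map d \<circ> chart_inv c) \<circ> (chart_map c \<circ> \<gamma>) has_derivative (*v) T \<circ> (\<lambda>h. h *\<^sub>R v)) (at t within W)"
    by (rule diff_chain_within)
  then have "((chart_map d \<circ> chart_inv c) \<circ> (chart_map c \<circ> \<gamma>) has_derivative (\<lambda>h. h *\<^sub>R (T *v v))) (at t)"
    using at_within_open[OF W(2,1)] by (simp add: comp_def matrix_vector_mult_scaleR)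
  then have "((chart_map d \<circ> \<gamma>) has_derivative (\<lambda>h. h *\<^sub>R (T *v v))) (at t)"
    by (rule has_derivative_transform_within_open[OF _ W]) (auto simp: W_def c)
  then have "vector_derivative (chart_map d \<circ> \<gamma>) (at t) = T *v v"
    by (intro vector_derivative_at) (simp add: has_vector_derivative_def)
  then have "speed M \<gamma> t = sqrt ((T *v v) \<bullet> (gram M d (chart_map d (\<gamma> t)) *v (T *v v)))"
    by (simp add: speed_def gram_at_def d_def Let_def)
  also have "(T *v v) \<bullet> (gram M d (chart_map d (\<gamma> t)) *v (T *v v)) = v \<bullet> (gram M c (chart_map c (\<gamma> t)) *v v)"
    unfolding T(3) by (simp add: congruence_inner)
  finally show ?thesis .
qed

text \<open>The quadratic form is continuous and positive on the compact product of \<open>K\<close>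
  with the unit circle, so it attains positive extrema there; homogeneity extends the bounds to all
  vectors.\<close>

lemma gram_bounds:
  assumes c: "c \<in> atlas M" and K: "compact K" "K \<subseteq> img c" "K \<noteq> {}"
  obtains \<kappa> C where "0 < \<kappa>" "0 \<le> C"
    "\<And>x v. x \<in> K \<Longrightarrow> \<kappa> * norm v \<le> sqrt (v \<bullet> (gram M c x *v v))"
    "\<And>x v. x \<in> K \<Longrightarrow> sqrt (v \<bullet> (gram M c x *v v)) \<le> C * norm v"
proof -
  let ?q = "\<lambda>(x, v). v \<bullet> (gram M c x *v v)"
  have comp: "compact (K \<times> sphere (0::real^2) 1)" using K by (intro compact_Times) auto
  have "axis 1 1 \<in> sphere (0::real^2) 1" by simp
  then have ne: "K \<times> sphere (0::real^2) 1 \<noteq> {}" using K by blast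
  have G: "continuous_on (K \<times> sphere (0::real^2) 1) (\<lambda>z. gram M c (fst z))"
    by (rule continuous_on_compose2[OF continuous_on_subset[OF gram_continuous[OF c] K(2)] continuous_on_fst[OF continuous_on_id]]) auto
  have G': "continuous_on (K \<times> sphere (0::real^2) 1) (\<lambda>z. gram M c (fst z) $ i $ j)" for i j
    by (intro continuous_on_component G)
  have s: "continuous_on (K \<times> sphere (0::real^2) 1) (\<lambda>z. snd z $ i)" for i
    by (intro continuous_on_component continuous_on_snd continuous_on_id)
  have "continuous_on (K \<times> sphere 0 1) ?q"
    unfolding case_prod_beta vec2_inner
    by (intro continuous_on_add continuous_on_mult G' s)
  note attain = continuous_attains_inf[OF comp ne this] continuous_attains_sup[OF comp ne this]
  from attain(1) obtain z where z: "z \<in> K \<times> sphere 0 1" "\<And>y. y \<in> K \<times> sphere 0 1 \<Longrightarrow> ?q z \<le> ?q y" by blast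
  from attain(2) obtain w where w: "w \<in> K \<times> sphere 0 1" "\<And>y. y \<in> K \<times> sphere 0 1 \<Longrightarrow> ?q y \<le> ?q w" by blast
  have pos: "0 < ?q y" if "y \<in> K \<times> sphere 0 1" for y
  proof -
    obtain x v where xv: "y = (x, v)" by (cases y)
    then have "x \<in> img c" "v \<noteq> 0" using that K by auto
    then show ?thesis using gram_posdef[OF c, of x] xv by (simp add: posdef_def)
  qed
  have hom: "sqrt (v \<bullet> (gram M c x *v v)) = norm v * sqrt (?q (x, v /\<^sub>R norm v))" for x v
  proof (cases "v = 0")
    case False
    have "v \<bullet> (gram M c x *v v) = (norm v)\<^sup>2 * ?q (x, v /\<^sub>R norm v)"
      using False by (simp add: vec2_inner power2_eq_square field_simps)
    then have "sqrt (v \<bullet> (gram M c x *v v)) = sqrt ((norm v)\<^sup>2) * sqrt (?q (x, v /\<^sub>R norm v))"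
      by (simp only: real_sqrt_mult)
    then show ?thesis by simp
  qed simp
  have unit: "(x, v /\<^sub>R norm v) \<in> K \<times> sphere 0 1" if "x \<in> K" "v \<noteq> 0" for x v using that by simp
  show thesis
  proof (rule that[of "sqrt (?q z)" "sqrt (?q w)"])
    show "0 < sqrt (?q z)" using pos[OF z(1)] by simp
    show "0 \<le> sqrt (?q w)" using pos[OF w(1)] by simp
    fix x v assume x: "x \<in> K"
    show "sqrt (?q z) * norm v \<le> sqrt (v \<bullet> (gram M c x *v v))"
      unfolding hom[of v x] using z(2)[OF unit[OF x, of v]]
      by (cases "v = 0") (simp_all add: mult.commute mult_left_mono)
    show "sqrt (v \<bullet> (gram M c x *v v)) \<le> sqrt (?q w) * norm v"
      unfolding hom[of v x] using w(2)[OF unit[OF x, of v]]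
      by (cases "v = 0") (simp_all add: mult.commute mult_left_mono)
  qed
qed

lemma chart_inv_continuous:
  assumes c: "c \<in> atlas M"
  shows "continuous_map (top_of_set (img c)) (surf_top M) (chart_inv c)"
  unfolding continuous_map_def
proof (intro conjI allI impI)
  show "chart_inv c \<in> topspace (top_of_set (img c)) \<rightarrow> points M"
    using chart_subset[OF c] chart_inv_dom[OF c] by auto
  fix U assume U: "openin (surf_top M) U"
  have "{x \<in> topspace (top_of_set (img c)). chart_inv c x \<in> U} = chart_map c ` (U \<inter> chart_dom c)"
    using c by force
  then show "openin (top_of_set (img c)) {x \<in> topspace (top_of_set (img c)). chart_inv c x \<in> U}"
    using chart_image_open[OF c U] by simp
qed

text \<open>A curve starting near \<open>p\<close> either stays in the coordinate ball of radius \<open>3 e\<close>, or has covered a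
  coordinate distance of at least \<open>2 e\<close> when it first leaves it.\<close>

lemma curve_length_lower:
  assumes c: "c \<in> atlas M" and p: "p \<in> chart_dom c"
  obtains V \<kappa> k where "openin (surf_top M) V" "p \<in> V" "V \<subseteq> chart_dom c" "0 < \<kappa>" "0 < k"
    "\<And>\<gamma>. piecewise_C1_curve M \<gamma> \<Longrightarrow> \<gamma> 0 \<in> V \<Longrightarrow> curve_length M \<gamma> < ennreal k \<Longrightarrow>
       \<gamma> 1 \<in> chart_dom c \<and> ennreal (\<kappa> * dist (chart_map c (\<gamma> 0)) (chart_map c (\<gamma> 1))) \<le> curve_length M \<gamma>"
proof -
  define x0 where "x0 = chart_map c p"
  obtain R where R: "model_region R" "openin (top_of_set R) (img c)" by (rule img_region[OF c])
  have x0: "x0 \<in> img c" using p by (simp add: x0_def)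
  obtain \<epsilon> where eps: "\<epsilon> > 0" "cball x0 \<epsilon> \<inter> R \<subseteq> img c"
    using R(2) x0 unfolding openin_contains_cball by blast
  \<comment> \<open>Curves start within \<open>e\<close> of \<open>x0\<close> and are watched up to
    distance \<open>3 * e\<close>, which leaves a gap for the curve to cross before it can
    escape.\<close>
  define e where "e = \<epsilon> / 3"
  have e: "e > 0" "cball x0 (3 * e) \<inter> R \<subseteq> img c" using eps by (auto simp: e_def)
  have imgR: "img c \<subseteq> R" using R(2) by (rule openin_imp_subset)
  define K where "K = cball x0 (3 * e) \<inter> R"
  have K: "compact K" "K \<subseteq> img c" "x0 \<in> K"
    using e x0 imgR model_region_closed[OF R(1)] by (auto simp: K_def intro: compact_Int_closed)
  have Kmem: "chart_map c q \<in> K \<longleftrightarrow> chart_map c q \<in> cball x0 (3 * e)" if "q \<in> chart_dom c" for q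
    using that imgR by (auto simp: K_def)
  have "K \<noteq> {}" using K(3) by auto
  then obtain \<kappa> C where kap: "0 < \<kappa>" "\<And>x v. x \<in> K \<Longrightarrow> \<kappa> * norm v \<le> sqrt (v \<bullet> (gram M c x *v v))"
    and "0 \<le> C" "\<And>x v. x \<in> K \<Longrightarrow> sqrt (v \<bullet> (gram M c x *v v)) \<le> C * norm v"
    by (rule gram_bounds[OF c K(1,2)]) blast
  define V W KM where "V = {q \<in> chart_dom c. chart_map c q \<in> ball x0 e}"
    and "W = {q \<in> chart_dom c. chart_map c q \<in> ball x0 (3 * e)}"
    and "KM = {q \<in> chart_dom c. chart_map c q \<in> K}"
  have VW: "openin (surf_top M) V" "openin (surf_top M) W"
    unfolding V_def W_def by (rule chart_preimage_open[OF c open_ball])+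
  have "KM = chart_inv c ` K"
  proof (intro equalityI subsetI)
    fix q assume "q \<in> KM"
    then have "chart_map c q \<in> K" "q = chart_inv c (chart_map c q)" using c by (auto simp: KM_def)
    then show "q \<in> chart_inv c ` K" by blast
  next
    fix q assume "q \<in> chart_inv c ` K"
    then obtain x where x: "x \<in> K" "q = chart_inv c x" by blast
    then have "x \<in> img c" using K(2) by blast
    then show "q \<in> KM" using x c by (simp add: KM_def)
  qed
  moreover have "compactin (top_of_set (img c)) K" using K(1,2) by (simp add: compactin_subtopology)
  then have "compactin (surf_top M) (chart_inv c ` K)"
    using chart_inv_continuous[OF c] by (rule image_compactin)
  \<comment> \<open>Closedness in the whole surface, which uses the Hausdorff property, prevents a
    curve from leaving the chart domain without first reaching the rim of the coordinate
    ball.\<close>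
  ultimately have KMc: "closedin (surf_top M) KM"
    using compactin_imp_closedin[OF hausdorff] by simp
  have bound: "ennreal (\<kappa> * dist (chart_map c (\<gamma> 0)) (chart_map c (\<gamma> T))) \<le> curve_length M \<gamma>"
    if g: "piecewise_C1_curve M \<gamma>" and T: "0 \<le> T" "T \<le> 1" and stay: "\<And>t. t \<in> {0..T} \<Longrightarrow> \<gamma> t \<in> KM" for \<gamma> T
  proof -
    let ?f = "chart_map c \<circ> \<gamma>"
    have path: "pathin (surf_top M) \<gamma>" using g by (simp add: piecewise_C1_curve_def)
    obtain S where S: "finite S" "?f C1_differentiable_on {t \<in> {0<..<1} - S. \<gamma> t \<in> chart_dom c}"
      using g c unfolding piecewise_C1_curve_def by blast
    obtain D where D: "\<And>t. t \<in> {0<..<1} - S \<Longrightarrow> \<gamma> t \<in> chart_dom c \<Longrightarrow> (?f has_vector_derivative D t) (at t)"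
      using S(2) unfolding C1_differentiable_on_def by blast
    have "continuous_map (top_of_set {0..T}) (subtopology (surf_top M) (chart_dom c)) \<gamma>"
    proof (rule continuous_map_into_subtopology)
      show "continuous_map (top_of_set {0..T}) (surf_top M) \<gamma>"
        using continuous_map_from_subtopology_mono[OF path[unfolded pathin_def], of "{0..T}"] T by auto
      show "\<gamma> \<in> topspace (top_of_set {0..T}) \<rightarrow> chart_dom c" using stay by (auto simp: KM_def)
    qed
    from continuous_map_compose[OF this homeomorphic_imp_continuous_map[OF chart_homeo[OF c]]]
    have cont: "continuous_on {0..T} ?f"
      by (metis continuous_map_iff_continuous continuous_map_in_subtopology)
    have der: "(?f has_vector_derivative D t) (at t)" if "t \<in> {0<..<T} - S" for t
      using D[of t] that T stay[of t] by (auto simp: KM_def)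
    have "(D has_integral (?f T - ?f 0)) {0..T}"
      using fundamental_theorem_of_calculus_interior_strong[OF S(1) T(1) der cont] .
    then have "((\<lambda>t. \<kappa> *\<^sub>R D t) has_integral \<kappa> *\<^sub>R (?f T - ?f 0)) {0..T}" by (rule has_integral_cmul)
    from norm_has_integral_le[OF this]
    have "ennreal (\<kappa> * norm (?f T - ?f 0)) \<le> (\<integral>\<^sup>+t\<in>{0..T}. ennreal (\<kappa> * norm (D t)) \<partial>lborel)"
      using kap(1) by simp
    also have "\<dots> \<le> (\<integral>\<^sup>+t\<in>{0..1}. ennreal (speed M \<gamma> t) \<partial>lborel)"
    proof (rule nn_integral_mono_AE)
      have "AE t in lborel. t \<notin> S \<union> {0, T}"
        using S(1) by (intro AE_not_in finite_imp_null_set_lborel) auto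
      then show "AE t in lborel. ennreal (\<kappa> * norm (D t)) * indicator {0..T} t \<le> ennreal (speed M \<gamma> t) * indicator {0..1} t"
      proof (rule AE_mp, intro AE_I2 impI)
        fix t assume t: "t \<notin> S \<union> {0, T}"
        show "ennreal (\<kappa> * norm (D t)) * indicator {0..T} t \<le> ennreal (speed M \<gamma> t) * indicator {0..1} t"
        proof (cases "t \<in> {0..T}")
          case True
          then have t': "t \<in> {0<..<T} - S" "0 < t" "t < 1" "\<gamma> t \<in> chart_dom c" "chart_map c (\<gamma> t) \<in> K"
            using t T stay[of t] by (auto simp: KM_def)
          have "\<kappa> * norm (D t) \<le> speed M \<gamma> t"
            unfolding speed_chart[OF c path t'(2-4) der[OF t'(1)]] by (rule kap(2)[OF t'(5)])
          then show ?thesis using True t' by (simp add: ennreal_leI)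
        qed simp
      qed
    qed
    finally show ?thesis
      by (simp add: curve_length_def dist_norm norm_minus_commute)
  qed
  have inW: "\<gamma> t \<in> W" if g: "piecewise_C1_curve M \<gamma>" and g0: "\<gamma> 0 \<in> V" and len: "curve_length M \<gamma> < ennreal (\<kappa> * e)"
    and t: "t \<in> {0..1}" for \<gamma> t
  proof (rule ccontr)
    assume notin: "\<gamma> t \<notin> W"
    have path: "pathin (surf_top M) \<gamma>" using g by (simp add: piecewise_C1_curve_def)
    define A where "A = {t \<in> {0..1}. \<gamma> t \<notin> W}"
    have "A = {0..1} - {t \<in> {0..1}. \<gamma> t \<in> W}" by (auto simp: A_def)
    moreover have "closedin (top_of_set {0..1}) ({0..1} - {t \<in> {0..1}. \<gamma> t \<in> W})"
      using path_preimage_open(1)[OF path VW(2)] closedin_diff[OF closedin_topspace, of "top_of_set {0..1::real}"] by simp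
    ultimately have "closed A" by (simp add: closedin_closed_eq)
    moreover have "bounded A" by (rule bounded_subset[of "{0..1}"]) (auto simp: A_def)
    ultimately have "compact A" by (simp add: compact_eq_bounded_closed)
    moreover have "A \<noteq> {}" using t notin by (auto simp: A_def)
    ultimately have "\<exists>t1\<in>A. \<forall>s\<in>A. t1 \<le> s" by (rule compact_attains_inf)
    then obtain t1 where t1: "t1 \<in> A" "\<And>s. s \<in> A \<Longrightarrow> t1 \<le> s" by blast
    have t1': "0 \<le> t1" "t1 \<le> 1" "\<gamma> t1 \<notin> W" using t1 by (auto simp: A_def)
    have "\<gamma> 0 \<in> W" using g0 e by (auto simp: V_def W_def)
    then have pos: "0 < t1" using t1' by (cases "t1 = 0") auto
    have before: "\<gamma> s \<in> KM" if "s \<in> {0..<t1}" for s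
    proof -
      have "\<gamma> s \<in> W" using t1(2)[of s] that t1' by (auto simp: A_def)
      then show ?thesis by (auto simp: W_def KM_def Kmem)
    qed
    have "closedin (top_of_set {0..1}) {s \<in> {0..1}. \<gamma> s \<in> KM}"
      using closedin_continuous_map_preimage[OF path[unfolded pathin_def] KMc] by simp
    then have cl: "closed {s \<in> {0..1}. \<gamma> s \<in> KM}" by (simp add: closedin_closed_eq)
    have "{0..<t1} \<subseteq> {s \<in> {0..1}. \<gamma> s \<in> KM}" using before t1' by auto
    \<comment> \<open>At the first exit time itself the curve is still in \<open>KM\<close>, as a
      limit of earlier points, so its chart coordinates make sense there.\<close>
    then have "closure {0..<t1} \<subseteq> {s \<in> {0..1}. \<gamma> s \<in> KM}" using cl by (rule closure_minimal)
    then have stay: "\<gamma> s \<in> KM" if "s \<in> {0..t1}" for s using pos that by auto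
    have "\<gamma> t1 \<in> chart_dom c" using stay[of t1] pos by (auto simp: KM_def)
    then have "3 * e \<le> dist x0 (chart_map c (\<gamma> t1))" using t1' by (auto simp: W_def)
    moreover have "dist x0 (chart_map c (\<gamma> 0)) < e" using g0 by (auto simp: V_def)
    ultimately have "e \<le> dist (chart_map c (\<gamma> 0)) (chart_map c (\<gamma> t1))"
      using dist_triangle[of x0 "chart_map c (\<gamma> t1)" "chart_map c (\<gamma> 0)"] e by simp
    then have "ennreal (\<kappa> * e) \<le> ennreal (\<kappa> * dist (chart_map c (\<gamma> 0)) (chart_map c (\<gamma> t1)))"
      using kap(1) by (intro ennreal_leI mult_left_mono) auto
    also have "\<dots> \<le> curve_length M \<gamma>" using bound[OF g t1'(1,2) stay] .
    finally show False using len by simp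
  qed
  show thesis
  proof (rule that[of V \<kappa> "\<kappa> * e"])
    fix \<gamma> assume g: "piecewise_C1_curve M \<gamma>" "\<gamma> 0 \<in> V" "curve_length M \<gamma> < ennreal (\<kappa> * e)"
    have KM: "\<gamma> t \<in> KM" if "t \<in> {0..1}" for t
      using inW[OF g that] by (auto simp: W_def KM_def Kmem)
    then have "\<gamma> 1 \<in> chart_dom c" by (auto simp: KM_def)
    moreover have "ennreal (\<kappa> * dist (chart_map c (\<gamma> 0)) (chart_map c (\<gamma> 1))) \<le> curve_length M \<gamma>"
      using bound[OF g(1) _ _ KM] by simp
    ultimately show "\<gamma> 1 \<in> chart_dom c \<and> ennreal (\<kappa> * dist (chart_map c (\<gamma> 0)) (chart_map c (\<gamma> 1))) \<le> curve_length M \<gamma>" ..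
  qed (use VW kap e p in \<open>auto simp: V_def x0_def\<close>)
qed

text \<open>The smallness condition is on the distance alone, with no assumption on where
  \<open>q'\<close> lies. The image of a Lipschitz map can thus be trapped in a chart before
  continuity is known.\<close>

lemma riemannian_dist_lower:
  assumes c: "c \<in> atlas M" and p: "p \<in> chart_dom c"
  obtains V \<kappa> k where "openin (surf_top M) V" "p \<in> V" "V \<subseteq> chart_dom c" "0 < \<kappa>" "0 < k"
    "\<And>q q'. q \<in> V \<Longrightarrow> riemannian_dist M q q' < ennreal k \<Longrightarrow> q' \<in> chart_dom c \<and>
       ennreal (\<kappa> * dist (chart_map c q) (chart_map c q')) \<le> riemannian_dist M q q'"
proof -
  obtain V \<kappa> k where V: "openin (surf_top M) V" "p \<in> V" "V \<subseteq> chart_dom c" "0 < \<kappa>" "0 < k"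
    "\<And>\<gamma>. piecewise_C1_curve M \<gamma> \<Longrightarrow> \<gamma> 0 \<in> V \<Longrightarrow> curve_length M \<gamma> < ennreal k \<Longrightarrow>
       \<gamma> 1 \<in> chart_dom c \<and> ennreal (\<kappa> * dist (chart_map c (\<gamma> 0)) (chart_map c (\<gamma> 1))) \<le> curve_length M \<gamma>"
    by (rule curve_length_lower[OF c p]) blast
  show thesis
  proof (rule that[OF V(1-5)])
    fix q q' assume q: "q \<in> V" and less: "riemannian_dist M q q' < ennreal k"
    from less obtain \<gamma> where g: "piecewise_C1_curve M \<gamma>" "\<gamma> 0 = q" "\<gamma> 1 = q'" "curve_length M \<gamma> < ennreal k"
      unfolding riemannian_dist_def Inf_less_iff by blast
    have 1: "q' \<in> chart_dom c" "ennreal (\<kappa> * dist (chart_map c q) (chart_map c q')) \<le> curve_length M \<gamma>"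
      using V(6)[OF g(1) _ g(4)] g q by auto
    moreover have "ennreal (\<kappa> * dist (chart_map c q) (chart_map c q')) \<le> riemannian_dist M q q'"
      unfolding riemannian_dist_def
    proof (rule Inf_greatest)
      fix l assume "l \<in> {curve_length M \<gamma> |\<gamma>. piecewise_C1_curve M \<gamma> \<and> \<gamma> 0 = q \<and> \<gamma> 1 = q'}"
      then obtain \<delta> where d: "l = curve_length M \<delta>" "piecewise_C1_curve M \<delta>" "\<delta> 0 = q" "\<delta> 1 = q'" by blast
      show "ennreal (\<kappa> * dist (chart_map c q) (chart_map c q')) \<le> l"
      proof (cases "l < ennreal k")
        case True then show ?thesis using V(6)[OF d(2)] d q by auto
      next
        \<comment> \<open>A curve of length at least \<open>k\<close> is longer than the short curve
          \<open>\<gamma>\<close> fixed above, whose length already dominates the coordinate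
          distance of the same endpoints.\<close>
        case False
        then show ?thesis using order_trans[OF 1(2) order_trans[OF less_imp_le[OF g(4)]]] by (simp add: not_less)
      qed
    qed
    ultimately show "q' \<in> chart_dom c \<and> ennreal (\<kappa> * dist (chart_map c q) (chart_map c q')) \<le> riemannian_dist M q q'"
      by blast
  qed
qed

end

section \<open>Short arches and the upper bound for the distance\<close>

definition arch_deriv :: "real \<Rightarrow> real^2 \<Rightarrow> real^2 \<Rightarrow> real \<Rightarrow> real^2" where
  "arch_deriv L x y t = (y - x) + (2 * L * (1 - 2 * t) * \<bar>x $ 1 - y $ 1\<bar>) *\<^sub>R axis 2 1"

lemma arch_has_vector_derivative: "(arch L x y has_vector_derivative arch_deriv L x y t) (at t)"
proof -
  define A where "A = (2 * L * \<bar>x $ 1 - y $ 1\<bar>) *\<^sub>R (axis 2 1 :: real^2)"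
  have eq: "arch L x y = (\<lambda>t. (1 - t) *\<^sub>R x + t *\<^sub>R y + (t * (1 - t)) *\<^sub>R A)"
    by (intro ext) (simp add: arch_def A_def algebra_simps)
  have "((\<lambda>t. (1 - t) *\<^sub>R x + t *\<^sub>R y + (t * (1 - t)) *\<^sub>R A) has_vector_derivative
     ((0 - 1) *\<^sub>R x + 1 *\<^sub>R y + (1 * (1 - t) + (0 - 1) * t) *\<^sub>R A)) (at t)"
    unfolding has_vector_derivative_def
    by (auto intro!: derivative_eq_intros simp: algebra_simps)
  moreover have "(0 - 1) *\<^sub>R x + 1 *\<^sub>R y + (1 * (1 - t) + (0 - 1) * t) *\<^sub>R A = arch_deriv L x y t"
    by (simp add: arch_deriv_def A_def algebra_simps)
  ultimately show ?thesis unfolding eq by simp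
qed

lemma arch_continuous: "continuous_on S (arch L x y)"
  using arch_has_vector_derivative by (metis continuous_at_imp_continuous_on has_vector_derivative_continuous)

lemma norm_arch_deriv:
  assumes "0 \<le> L" "0 \<le> t" "t \<le> 1"
  shows "norm (arch_deriv L x y t) \<le> (1 + 2 * L) * dist x y"
proof -
  have c: "\<bar>x $ 1 - y $ 1\<bar> \<le> dist x y"
    using component_le_norm_cart[of "x - y" 1] by (simp add: dist_norm)
  have "norm (arch_deriv L x y t) \<le> norm (y - x) + norm ((2 * L * (1 - 2 * t) * \<bar>x $ 1 - y $ 1\<bar>) *\<^sub>R (axis 2 1 :: real^2))"
    unfolding arch_deriv_def by (rule norm_triangle_ineq)
  also have "\<dots> = dist x y + 2 * L * \<bar>1 - 2 * t\<bar> * \<bar>x $ 1 - y $ 1\<bar>"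
    using assms by (simp add: abs_mult dist_norm norm_minus_commute)
  also have "\<dots> \<le> dist x y + 2 * L * 1 * dist x y"
    using assms c by (intro add_left_mono mult_mono) auto
  finally show ?thesis by (simp add: algebra_simps)
qed

text \<open>The first coordinates of \<open>x\<close> and \<open>y\<close> differ by at most
  \<open>2 * r\<close>, and \<open>t * (1 - t)\<close> is bounded crudely by 1, so the parabolic
  term adds at most \<open>4 * L * r\<close>.\<close>

lemma arch_near:
  assumes L: "0 \<le> L" and t: "0 \<le> t" "t \<le> 1" and x: "dist x0 x \<le> r" "dist x0 y \<le> r"
  shows "dist x0 (arch L x y t) \<le> (1 + 4 * L) * r"
proof -
  have c: "\<bar>x $ 1 - y $ 1\<bar> \<le> 2 * r"
    using component_le_norm_cart[of "x - y" 1] dist_triangle3[of x y x0] x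
    by (simp add: dist_norm[symmetric])
  have r: "0 \<le> r" using x(1) zero_le_dist order_trans by blast
  have "dist x0 (arch L x y t) = norm (arch L x y t - x0)" by (simp add: dist_norm norm_minus_commute)
  also have "\<dots> = norm ((1 - t) *\<^sub>R (x - x0) + t *\<^sub>R (y - x0) + (2 * L * t * (1 - t) * \<bar>x $ 1 - y $ 1\<bar>) *\<^sub>R (axis 2 1 :: real^2))"
    unfolding arch_def by (rule arg_cong[of _ _ norm]) (simp add: algebra_simps)
  also have "\<dots> \<le> norm ((1 - t) *\<^sub>R (x - x0)) + norm (t *\<^sub>R (y - x0)) + norm ((2 * L * t * (1 - t) * \<bar>x $ 1 - y $ 1\<bar>) *\<^sub>R (axis 2 1 :: real^2))"
    by (meson add_right_mono norm_triangle_ineq norm_triangle_le order_trans)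
  also have "\<dots> = (1 - t) * dist x0 x + t * dist x0 y + 2 * L * (t * (1 - t)) * \<bar>x $ 1 - y $ 1\<bar>"
    using t L by (simp add: dist_norm norm_minus_commute abs_mult)
  also have "\<dots> \<le> (1 - t) * r + t * r + 2 * L * 1 * (2 * r)"
  proof (intro add_mono mult_mono)
    show "t * (1 - t) \<le> 1" using t mult_mono[of t 1 "1 - t" 1] by simp
  qed (use t L x c r in auto)
  finally show ?thesis by (simp add: algebra_simps)
qed

text \<open>\<open>Ck_on\<close> gives continuity of derivatives in a fixed direction only. Along a
  curve the direction varies, so it is decomposed into the two axes.\<close>

lemma has_derivative_vec2:
  fixes h :: "real^2 \<Rightarrow> 'b::real_normed_vector"
  assumes "h differentiable (at x)"
  shows "frechet_derivative h (at x) v = v $ 1 *\<^sub>R frechet_derivative h (at x) (axis 1 1) + v $ 2 *\<^sub>R frechet_derivative h (at x) (axis 2 1)"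
proof -
  have lin: "linear (frechet_derivative h (at x))" using assms by (rule linear_frechet_derivative)
  have "v = v $ 1 *\<^sub>R axis 1 1 + v $ 2 *\<^sub>R axis 2 1" by (simp add: vec_eq_iff forall_2 axis_def)
  then show ?thesis using linear_add[OF lin] linear_scale[OF lin] by metis
qed

context riemannian_surface
begin

text \<open>The curve must be regular in every chart \<open>d\<close>, not just in \<open>c\<close>.
  Near each time the transition map is replaced by a smooth extension \<open>h\<close> to an open
  set, so that the chain rule also works when the arch touches the boundary. No exceptional times
  occur.\<close>

lemma arch_piecewise_C1:
  assumes c: "c \<in> atlas M" and im: "\<And>t. t \<in> {0..1} \<Longrightarrow> arch L x y t \<in> img c"
  shows "piecewise_C1_curve M (chart_inv c \<circ> arch L x y)"
  unfolding piecewise_C1_curve_def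
proof (intro conjI exI[of _ "{}"] ballI)
  let ?\<gamma> = "chart_inv c \<circ> arch L x y"
  have "continuous_map (top_of_set {0..1}) (top_of_set (img c)) (arch L x y)"
    using im by (auto simp: continuous_map_in_subtopology arch_continuous)
  then show path: "pathin (surf_top M) ?\<gamma>"
    unfolding pathin_def by (rule continuous_map_compose[OF _ chart_inv_continuous[OF c]])
  fix d assume d: "d \<in> atlas M"
  let ?f = "chart_map d \<circ> ?\<gamma>"
  let ?I = "{t \<in> {0<..<1} - {}. ?\<gamma> t \<in> chart_dom d}"
  have op: "open ?I" using path_preimage_open(2)[OF path chart_open[OF d]] by simp
  have loc: "\<exists>W D. open W \<and> t \<in> W \<and> (\<forall>s\<in>W. (?f has_vector_derivative D s) (at s)) \<and> continuous_on W D"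
    if t: "t \<in> ?I" for t
  proof -
    let ?S = "chart_map c ` (chart_dom c \<inter> chart_dom d)"
    have inS: "arch L x y s \<in> ?S" if "s \<in> ?I" for s
    proof -
      have "arch L x y s \<in> img c" using that im[of s] by auto
      then have "chart_inv c (arch L x y s) \<in> chart_dom c \<inter> chart_dom d"
        "arch L x y s = chart_map c (chart_inv c (arch L x y s))" using that c by auto
      then show ?thesis by blast
    qed
    have "smooth_on_set ?S (chart_map d \<circ> chart_inv c)"
      using compatible[OF c d] by (simp add: compatible_charts_def Let_def)
    then obtain U h where U: "open U" "arch L x y t \<in> U" "\<forall>k. Ck_on k U h"
      "\<forall>z\<in>?S \<inter> U. h z = (chart_map d \<circ> chart_inv c) z"
      using inS[OF t] unfolding smooth_on_set_def by blast
    have "Ck_on (Suc 0) U h" using U(3) by blast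
    then have h: "\<And>z. z \<in> U \<Longrightarrow> h differentiable (at z)" "\<And>v. continuous_on U (\<lambda>z. frechet_derivative h (at z) v)"
      by auto
    define W where "W = ?I \<inter> arch L x y -` U"
    have W: "open W" "t \<in> W"
      using op U t arch_continuous[of UNIV L x y] by (auto simp: W_def intro!: open_Int open_vimage)
    define D where "D s = frechet_derivative h (at (arch L x y s)) (arch_deriv L x y s)" for s
    have "(?f has_vector_derivative D s) (at s)" if s: "s \<in> W" for s
    proof -
      have "(h has_derivative frechet_derivative h (at (arch L x y s))) (at (arch L x y s))"
        using h(1) s by (simp add: W_def frechet_derivative_works)
      then have "(h has_derivative frechet_derivative h (at (arch L x y s))) (at (arch L x y s) within range (arch L x y))"
        by (rule has_derivative_at_withinI)
      from vector_derivative_diff_chain_within[OF arch_has_vector_derivative this]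
      have "((h \<circ> arch L x y) has_vector_derivative D s) (at s)" by (simp add: D_def)
      then show ?thesis
        by (rule has_vector_derivative_transform_within_open[OF _ W(1) s]) (use inS U(4) in \<open>auto simp: W_def\<close>)
    qed
    moreover have "continuous_on W D"
    proof -
      have cc: "continuous_on W (\<lambda>s. frechet_derivative h (at (arch L x y s)) v)" for v
        by (rule continuous_on_compose2[OF h(2) arch_continuous]) (auto simp: W_def)
      have ad: "continuous_on W (\<lambda>s. arch_deriv L x y s $ i)" for i
        unfolding arch_deriv_def by (intro continuous_intros)
      have "continuous_on W (\<lambda>s. arch_deriv L x y s $ 1 *\<^sub>R frechet_derivative h (at (arch L x y s)) (axis 1 1)
          + arch_deriv L x y s $ 2 *\<^sub>R frechet_derivative h (at (arch L x y s)) (axis 2 1))"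
        by (intro continuous_on_add continuous_on_scaleR cc ad)
      moreover have "D s = arch_deriv L x y s $ 1 *\<^sub>R frechet_derivative h (at (arch L x y s)) (axis 1 1)
          + arch_deriv L x y s $ 2 *\<^sub>R frechet_derivative h (at (arch L x y s)) (axis 2 1)" if "s \<in> W" for s
        unfolding D_def using that by (intro has_derivative_vec2 h(1)) (simp add: W_def)
      ultimately show ?thesis by (simp cong: continuous_on_cong)
    qed
    ultimately show ?thesis using W by blast
  qed
  have der: "(?f has_vector_derivative vector_derivative ?f (at t)) (at t)" if t: "t \<in> ?I" for t
  proof -
    obtain W D where "t \<in> W" "\<forall>s\<in>W. (?f has_vector_derivative D s) (at s)" using loc[OF t] by blast
    then have "(?f has_vector_derivative D t) (at t)" by blast
    then show ?thesis by (simp add: vector_derivative_at)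
  qed
  have cont: "isCont (\<lambda>t. vector_derivative ?f (at t)) t" if t: "t \<in> ?I" for t
  proof -
    obtain W D where W: "open W" "t \<in> W" "\<forall>s\<in>W. (?f has_vector_derivative D s) (at s)" "continuous_on W D"
      using loc[OF t] by blast
    have "continuous_on W (\<lambda>t. vector_derivative ?f (at t))"
      using W(4) by (rule continuous_on_eq) (use W(3) vector_derivative_at in fastforce)
    then show ?thesis using W(1,2) continuous_on_eq_continuous_at by blast
  qed
  show "?f C1_differentiable_on ?I"
    unfolding C1_differentiable_on_def
    using der cont by (intro exI[of _ "\<lambda>t. vector_derivative ?f (at t)"] conjI ballI continuous_at_imp_continuous_on) blast+
qed simp

lemma riemannian_dist_upper:
  assumes c: "c \<in> atlas M" and p: "p \<in> chart_dom c"
  obtains V C where "openin (surf_top M) V" "p \<in> V" "V \<subseteq> chart_dom c" "0 \<le> C"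
    "\<And>q q'. q \<in> V \<Longrightarrow> q' \<in> V \<Longrightarrow> riemannian_dist M q q' \<le> ennreal (C * dist (chart_map c q) (chart_map c q'))"
proof -
  define x0 where "x0 = chart_map c p"
  obtain R where R: "model_region R" "openin (top_of_set R) (img c)" by (rule img_region[OF c])
  obtain L where L: "0 \<le> L" "\<And>x y t. x \<in> R \<Longrightarrow> y \<in> R \<Longrightarrow> 0 \<le> t \<Longrightarrow> t \<le> 1 \<Longrightarrow> arch L x y t \<in> R"
    by (rule model_region_arch[OF R(1)]) blast
  have x0: "x0 \<in> img c" using p by (simp add: x0_def)
  obtain e where e: "e > 0" "cball x0 e \<inter> R \<subseteq> img c"
    using R(2) x0 unfolding openin_contains_cball by blast
  have imgR: "img c \<subseteq> R" using R(2) by (rule openin_imp_subset)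
  define K where "K = cball x0 e \<inter> R"
  have K: "compact K" "K \<subseteq> img c" "x0 \<in> K"
    using e x0 imgR model_region_closed[OF R(1)] by (auto simp: K_def intro: compact_Int_closed)
  have "K \<noteq> {}" using K(3) by auto
  then obtain \<kappa> C where kap: "0 < \<kappa>" "\<And>x v. x \<in> K \<Longrightarrow> \<kappa> * norm v \<le> sqrt (v \<bullet> (gram M c x *v v))"
    and C: "0 \<le> C" "\<And>x v. x \<in> K \<Longrightarrow> sqrt (v \<bullet> (gram M c x *v v)) \<le> C * norm v"
    by (rule gram_bounds[OF c K(1,2)]) blast
  \<comment> \<open>By \<open>arch_near\<close> this radius keeps every arch between points of
    \<open>V\<close> inside the compact set \<open>K\<close>.\<close>
  define r where "r = e / (1 + 4 * L)"
  have r: "0 < r" "(1 + 4 * L) * r = e" using e L by (auto simp: r_def)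
  define V where "V = {q \<in> chart_dom c. chart_map c q \<in> ball x0 r}"
  show thesis
  proof (rule that[of V "C * (1 + 2 * L)"])
    show "openin (surf_top M) V" unfolding V_def by (rule chart_preimage_open[OF c open_ball])
    show "0 \<le> C * (1 + 2 * L)" using C L by simp
    show "p \<in> V" using p r by (simp add: V_def x0_def)
    fix q q' assume q: "q \<in> V" "q' \<in> V"
    define x y where "x = chart_map c q" and "y = chart_map c q'"
    have xy: "x \<in> R" "y \<in> R" "dist x0 x \<le> r" "dist x0 y \<le> r" using q imgR by (auto simp: V_def x_def y_def)
    have inK: "arch L x y t \<in> K" if "t \<in> {0..1}" for t
      using that L(2)[OF xy(1,2), of t] arch_near[OF L(1) _ _ xy(3,4), of t] r(2) by (simp add: K_def)
    let ?\<gamma> = "chart_inv c \<circ> arch L x y"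
    have pc: "piecewise_C1_curve M ?\<gamma>"
      using inK K(2) by (intro arch_piecewise_C1[OF c]) auto
    then have path: "pathin (surf_top M) ?\<gamma>" by (simp add: piecewise_C1_curve_def)
    have "arch L x y 0 = x" "arch L x y 1 = y" by (simp_all add: arch_def)
    then have ends: "?\<gamma> 0 = q" "?\<gamma> 1 = q'" using q c by (simp_all add: V_def x_def y_def)
    have sp: "speed M ?\<gamma> t \<le> C * (1 + 2 * L) * dist x y" if t: "t \<in> {0<..<1}" for t
    proof -
      have im: "arch L x y s \<in> img c" if "s \<in> {0<..<1}" for s using inK[of s] K(2) that by auto
      have dom: "?\<gamma> t \<in> chart_dom c" using im[OF t] c by simp
      have der: "((chart_map c \<circ> ?\<gamma>) has_vector_derivative arch_deriv L x y t) (at t)"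
        using arch_has_vector_derivative
        by (rule has_vector_derivative_transform_within_open[OF _ open_greaterThanLessThan t]) (simp add: im c)
      have "speed M ?\<gamma> t = sqrt (arch_deriv L x y t \<bullet> (gram M c (chart_map c (?\<gamma> t)) *v arch_deriv L x y t))"
        using t by (intro speed_chart[OF c path _ _ dom der]) auto
      also have "chart_map c (?\<gamma> t) = arch L x y t" using im[OF t] c by simp
      also have "sqrt (arch_deriv L x y t \<bullet> (gram M c (arch L x y t) *v arch_deriv L x y t)) \<le> C * norm (arch_deriv L x y t)"
        using t inK[of t] by (intro C(2)) auto
      also have "\<dots> \<le> C * ((1 + 2 * L) * dist x y)"
        using t by (intro mult_left_mono[OF norm_arch_deriv[OF L(1)] C(1)]) auto
      finally show ?thesis by (simp only: mult.assoc)
    qed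
    have "curve_length M ?\<gamma> \<le> (\<integral>\<^sup>+t. ennreal (C * (1 + 2 * L) * dist x y) * indicator {0..1::real} t \<partial>lborel)"
      unfolding curve_length_def
    proof (rule nn_integral_mono_AE)
      have "AE t in lborel. t \<notin> {0, 1::real}"
        by (intro AE_not_in finite_imp_null_set_lborel) auto
      then show "AE t in lborel. ennreal (speed M ?\<gamma> t) * indicator {0..1} t \<le> ennreal (C * (1 + 2 * L) * dist x y) * indicator {0..1} t"
      proof (rule AE_mp, intro AE_I2 impI)
        fix t :: real assume t: "t \<notin> {0, 1}"
        show "ennreal (speed M ?\<gamma> t) * indicator {0..1} t \<le> ennreal (C * (1 + 2 * L) * dist x y) * indicator {0..1} t"
        proof (cases "t \<in> {0..1}")
          case True
          then have "t \<in> {0<..<1}" using t by auto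
          from ennreal_leI[OF sp[OF this]] show ?thesis using True by simp
        qed simp
      qed
    qed
    also have "\<dots> = ennreal (C * (1 + 2 * L) * dist x y)"
      by (subst nn_integral_cmult_indicator) auto
    finally have len: "curve_length M ?\<gamma> \<le> ennreal (C * (1 + 2 * L) * dist x y)" .
    have "riemannian_dist M q q' \<le> curve_length M ?\<gamma>"
      unfolding riemannian_dist_def using pc ends by (intro Inf_lower) blast
    also note len
    finally show "riemannian_dist M q q' \<le> ennreal (C * (1 + 2 * L) * dist (chart_map c q) (chart_map c q'))"
      by (simp only: x_def y_def)
  qed (auto simp: V_def)
qed

end

section \<open>Lipschitz maps\<close>

locale surface_pair = M: riemannian_surface M + N: riemannian_surface N
  for M :: "'a surface" and N :: "'b surface"
begin

lemma chart_ball_subset: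
  assumes d: "d \<in> atlas N" and V: "openin (surf_top N) V" "q \<in> V" "q \<in> chart_dom d"
  obtains \<epsilon> where "0 < \<epsilon>" "\<And>q'. q' \<in> chart_dom d \<Longrightarrow> dist (chart_map d q) (chart_map d q') < \<epsilon> \<Longrightarrow> q' \<in> V"
proof -
  have "openin (top_of_set (img d)) (chart_map d ` (V \<inter> chart_dom d))" using N.chart_image_open[OF d V(1)] .
  moreover have "chart_map d q \<in> chart_map d ` (V \<inter> chart_dom d)" using V by blast
  ultimately obtain \<epsilon> where e: "\<epsilon> > 0" "ball (chart_map d q) \<epsilon> \<inter> img d \<subseteq> chart_map d ` (V \<inter> chart_dom d)"
    unfolding openin_contains_ball by blast
  show thesis
  proof (rule that[OF e(1)])
    fix q' assume q': "q' \<in> chart_dom d" "dist (chart_map d q) (chart_map d q') < \<epsilon>"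
    then have "chart_map d q' \<in> ball (chart_map d q) \<epsilon> \<inter> img d" by simp
    then have "chart_map d q' \<in> chart_map d ` (V \<inter> chart_dom d)" using e(2) by blast
    then obtain z where "z \<in> V" "z \<in> chart_dom d" "chart_map d q' = chart_map d z" by blast
    then show "q' \<in> V" using inj_onD[OF N.chart_inj[OF d]] q'(1) by blast
  qed
qed

text \<open>Combines the lower bound for the distance in \<open>N\<close> with the upper bound in
  \<open>M\<close>. The estimate is used twice: with the centre \<open>p\<close>, to force the image
  of \<open>U\<close> into the set \<open>V\<close> where the lower bound holds, and then between
  arbitrary points of \<open>U\<close>.\<close>

lemma lipschitz_local:
  assumes lip: "lipschitz_map M N \<phi>" and p: "p \<in> points M"
  shows "\<exists>U. openin (surf_top M) U \<and> p \<in> U \<and> (\<exists>c\<in>atlas M. \<exists>d\<in>atlas N. \<exists>C\<ge>0. U \<subseteq> chart_dom c \<and> \<phi> ` U \<subseteq> chart_dom d \<and>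
    (\<forall>q\<in>U. \<forall>q'\<in>U. dist (chart_map d (\<phi> q)) (chart_map d (\<phi> q')) \<le> C * dist (chart_map c q) (chart_map c q')))"
proof -
  obtain L where L: "L \<ge> 0" "\<And>p q. p \<in> points M \<Longrightarrow> q \<in> points M \<Longrightarrow>
      riemannian_dist N (\<phi> p) (\<phi> q) \<le> ennreal L * riemannian_dist M p q"
    using lip unfolding lipschitz_map_def by blast
  have "\<phi> p \<in> points N" using lip p by (auto simp: lipschitz_map_def)
  then obtain d where d: "d \<in> atlas N" "\<phi> p \<in> chart_dom d" by (rule N.atlas_cover)
  obtain c where c: "c \<in> atlas M" "p \<in> chart_dom c" using M.atlas_cover[OF p] .
  obtain V \<kappa> k where V: "openin (surf_top N) V" "\<phi> p \<in> V" "V \<subseteq> chart_dom d" "0 < \<kappa>" "0 < k"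
    "\<And>q q'. q \<in> V \<Longrightarrow> riemannian_dist N q q' < ennreal k \<Longrightarrow> q' \<in> chart_dom d \<and>
       ennreal (\<kappa> * dist (chart_map d q) (chart_map d q')) \<le> riemannian_dist N q q'"
    by (rule N.riemannian_dist_lower[OF d]) blast
  obtain V' C where V': "openin (surf_top M) V'" "p \<in> V'" "V' \<subseteq> chart_dom c" "0 \<le> C"
    "\<And>q q'. q \<in> V' \<Longrightarrow> q' \<in> V' \<Longrightarrow> riemannian_dist M q q' \<le> ennreal (C * dist (chart_map c q) (chart_map c q'))"
    by (rule M.riemannian_dist_upper[OF c]) blast
  obtain \<epsilon> where eps: "0 < \<epsilon>" "\<And>q'. q' \<in> chart_dom d \<Longrightarrow> dist (chart_map d (\<phi> p)) (chart_map d q') < \<epsilon> \<Longrightarrow> q' \<in> V"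
    by (rule chart_ball_subset[OF d(1) V(1,2) d(2)]) blast
  have step: "\<phi> q' \<in> chart_dom d \<and> \<kappa> * dist (chart_map d (\<phi> q)) (chart_map d (\<phi> q')) \<le> L * C * dist (chart_map c q) (chart_map c q')"
    if q: "q \<in> V'" "q' \<in> V'" "\<phi> q \<in> V" and less: "L * C * dist (chart_map c q) (chart_map c q') < k" for q q'
  proof -
    have "q \<in> points M" "q' \<in> points M" using q V'(1) openin_subset by blast+
    then have "riemannian_dist N (\<phi> q) (\<phi> q') \<le> ennreal L * riemannian_dist M q q'" by (rule L(2))
    also have "\<dots> \<le> ennreal L * ennreal (C * dist (chart_map c q) (chart_map c q'))"
      using V'(5)[OF q(1,2)] by (rule mult_left_mono) simp
    also have "\<dots> = ennreal (L * C * dist (chart_map c q) (chart_map c q'))"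
      using L(1) V'(4) by (simp add: ennreal_mult' mult.assoc)
    finally have le: "riemannian_dist N (\<phi> q) (\<phi> q') \<le> ennreal (L * C * dist (chart_map c q) (chart_map c q'))" .
    also have "\<dots> < ennreal k" using less V(5) by (simp add: ennreal_lessI)
    finally have 1: "\<phi> q' \<in> chart_dom d" "ennreal (\<kappa> * dist (chart_map d (\<phi> q)) (chart_map d (\<phi> q'))) \<le> riemannian_dist N (\<phi> q) (\<phi> q')"
      using V(6)[OF q(3)] by blast+
    have "ennreal (\<kappa> * dist (chart_map d (\<phi> q)) (chart_map d (\<phi> q'))) \<le> ennreal (L * C * dist (chart_map c q) (chart_map c q'))"
      using 1(2) le by (rule order_trans)
    then show ?thesis using 1(1) L(1) V'(4) by (subst (asm) ennreal_le_iff) auto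
  qed
  \<comment> \<open>Staying below \<open>k\<close> activates the lower bound in \<open>N\<close>;
    staying below \<open>\<kappa> * \<epsilon>\<close> keeps the image in \<open>V\<close>. Two
    points of \<open>U\<close> are less than \<open>2 * \<delta>\<close> apart, and the
    \<open>+ 1\<close> in \<open>\<delta>\<close> covers the case \<open>L * C = 0\<close>.\<close>
  define m where "m = min k (\<kappa> * \<epsilon>)"
  define \<delta> where "\<delta> = m / (2 * (L * C + 1))"
  have LC: "0 \<le> L * C" using L(1) V'(4) by simp
  have m: "0 < m" using V(4,5) eps(1) by (simp add: m_def)
  have del: "0 < \<delta>" "L * C * (2 * \<delta>) < m"
    using m LC by (simp_all add: \<delta>_def field_simps)
  define U where "U = V' \<inter> {q \<in> chart_dom c. chart_map c q \<in> ball (chart_map c p) \<delta>}"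
  have op: "openin (surf_top M) U" unfolding U_def by (intro openin_Int V'(1) M.chart_preimage_open[OF c(1)] open_ball)
  have inV: "\<phi> q \<in> V" if q: "q \<in> U" for q
  proof -
    have dq: "L * C * dist (chart_map c p) (chart_map c q) < m"
    proof -
      have "dist (chart_map c p) (chart_map c q) \<le> 2 * \<delta>" using q del(1) by (simp add: U_def)
      then show ?thesis using mult_left_mono[OF _ LC] del(2) by (meson le_less_trans)
    qed
    then have s: "\<phi> q \<in> chart_dom d" "\<kappa> * dist (chart_map d (\<phi> p)) (chart_map d (\<phi> q)) \<le> L * C * dist (chart_map c p) (chart_map c q)"
      using step[of p q] q V'(2) V(2) by (auto simp: U_def m_def)
    have "\<kappa> * dist (chart_map d (\<phi> p)) (chart_map d (\<phi> q)) < \<kappa> * \<epsilon>"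
      using s(2) dq by (simp add: m_def)
    then show ?thesis using eps(2)[OF s(1)] V(4) by simp
  qed
  have lipU: "dist (chart_map d (\<phi> q)) (chart_map d (\<phi> q')) \<le> (L * C / \<kappa>) * dist (chart_map c q) (chart_map c q')"
    if q: "q \<in> U" "q' \<in> U" for q q'
  proof -
    have "dist (chart_map c q) (chart_map c q') \<le> 2 * \<delta>"
      using dist_triangle3[of "chart_map c q" "chart_map c q'" "chart_map c p"] q by (simp add: U_def)
    then have "L * C * dist (chart_map c q) (chart_map c q') < m"
      using mult_left_mono[OF _ LC] del(2) by (meson le_less_trans)
    then have "\<kappa> * dist (chart_map d (\<phi> q)) (chart_map d (\<phi> q')) \<le> L * C * dist (chart_map c q) (chart_map c q')"
      using step[of q q'] q inV[OF q(1)] by (auto simp: U_def m_def)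
    then show ?thesis using V(4) by (simp add: field_simps)
  qed
  have "p \<in> U" using c V'(2) del(1) by (simp add: U_def)
  moreover have "U \<subseteq> chart_dom c" by (auto simp: U_def)
  moreover have "\<phi> ` U \<subseteq> chart_dom d" using inV V(3) by blast
  moreover have "0 \<le> L * C / \<kappa>" using LC V(4) by simp
  ultimately have "\<exists>c\<in>atlas M. \<exists>d\<in>atlas N. \<exists>C\<ge>0. U \<subseteq> chart_dom c \<and> \<phi> ` U \<subseteq> chart_dom d \<and>
    (\<forall>q\<in>U. \<forall>q'\<in>U. dist (chart_map d (\<phi> q)) (chart_map d (\<phi> q')) \<le> C * dist (chart_map c q) (chart_map c q'))"
    using lipU by (intro bexI[OF _ c(1)] bexI[OF _ d(1)] exI[of _ "L * C / \<kappa>"] conjI ballI) auto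
  then show ?thesis using op \<open>p \<in> U\<close> by (intro exI[of _ U] conjI)
qed

text \<open>The topology is given by the charts rather than by the Riemannian distance, so
  continuity is derived from the coordinate estimate.\<close>

lemma lipschitz_continuous:
  assumes lip: "lipschitz_map M N \<phi>"
  shows "continuous_map (surf_top M) (surf_top N) \<phi>"
  unfolding continuous_map_def
proof (intro conjI allI impI)
  show "\<phi> \<in> points M \<rightarrow> points N" using lip by (simp add: lipschitz_map_def)
  fix V assume V: "openin (surf_top N) V"
  show "openin (surf_top M) {x \<in> points M. \<phi> x \<in> V}"
  proof (subst openin_subopen, intro ballI)
    fix p assume "p \<in> {x \<in> points M. \<phi> x \<in> V}"
    then have p: "p \<in> points M" "\<phi> p \<in> V" by auto
    obtain U c d C where U: "openin (surf_top M) U" "p \<in> U" "c \<in> atlas M" "d \<in> atlas N" "C \<ge> 0"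
      "U \<subseteq> chart_dom c" "\<phi> ` U \<subseteq> chart_dom d"
      "\<forall>q\<in>U. \<forall>q'\<in>U. dist (chart_map d (\<phi> q)) (chart_map d (\<phi> q')) \<le> C * dist (chart_map c q) (chart_map c q')"
      using lipschitz_local[OF lip p(1)] by blast
    have "\<phi> p \<in> chart_dom d" using U by auto
    then obtain \<epsilon> where eps: "0 < \<epsilon>" "\<And>q'. q' \<in> chart_dom d \<Longrightarrow> dist (chart_map d (\<phi> p)) (chart_map d q') < \<epsilon> \<Longrightarrow> q' \<in> V"
      by (rule chart_ball_subset[OF U(4) V p(2)]) blast
    define U' where "U' = U \<inter> {q \<in> chart_dom c. chart_map c q \<in> ball (chart_map c p) (\<epsilon> / (C + 1))}"
    have "openin (surf_top M) U'" unfolding U'_def by (intro openin_Int U(1) M.chart_preimage_open[OF U(3)] open_ball)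
    moreover have "p \<in> U'" using U eps(1) by (auto simp: U'_def)
    moreover have "U' \<subseteq> {x \<in> points M. \<phi> x \<in> V}"
    proof
      fix q assume q: "q \<in> U'"
      then have "q \<in> points M" using U(1) openin_subset by (auto simp: U'_def)
      have "dist (chart_map d (\<phi> p)) (chart_map d (\<phi> q)) \<le> C * dist (chart_map c p) (chart_map c q)"
        using U(8,2) q by (auto simp: U'_def)
      also have "\<dots> \<le> C * (\<epsilon> / (C + 1))" using q U(5) by (intro mult_left_mono) (auto simp: U'_def)
      also have "\<dots> < \<epsilon>" using eps(1) U(5) by (simp add: field_simps)
      finally have "\<phi> q \<in> V" using eps(2)[of "\<phi> q"] q U(7) by (auto simp: U'_def)
      with \<open>q \<in> points M\<close> show "q \<in> {x \<in> points M. \<phi> x \<in> V}" by simp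
    qed
    ultimately show "\<exists>T. openin (surf_top M) T \<and> p \<in> T \<and> T \<subseteq> {x \<in> points M. \<phi> x \<in> V}" by blast
  qed
qed

lemma lipschitz_partition:
  assumes lip: "lipschitz_map M N \<phi>"
  obtains n :: nat and c d C D where
    "\<And>i. i < n \<Longrightarrow> c i \<in> atlas M" "\<And>i. i < n \<Longrightarrow> d i \<in> atlas N"
    "\<And>i. i < n \<Longrightarrow> D i \<in> sets (borel_alg M)" "\<And>i. i < n \<Longrightarrow> D i \<subseteq> chart_dom (c i)"
    "\<And>i. i < n \<Longrightarrow> \<phi> ` D i \<subseteq> chart_dom (d i)"
    "\<And>i q q'. i < n \<Longrightarrow> q \<in> D i \<Longrightarrow> q' \<in> D i \<Longrightarrow>
       dist (chart_map (d i) (\<phi> q)) (chart_map (d i) (\<phi> q')) \<le> C i * dist (chart_map (c i) q) (chart_map (c i) q')"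
    "disjoint_family_on D {..<n}" "(\<Union>i<n. D i) = points M"
proof -
  define Q where "Q U c d C \<longleftrightarrow> c \<in> atlas M \<and> d \<in> atlas N \<and> U \<subseteq> chart_dom c \<and> \<phi> ` U \<subseteq> chart_dom d \<and>
    (\<forall>q\<in>U. \<forall>q'\<in>U. dist (chart_map d (\<phi> q)) (chart_map d (\<phi> q')) \<le> C * dist (chart_map c q) (chart_map c q'))"
    for U c d C
  have 1: "\<exists>U. openin (surf_top M) U \<and> p \<in> U \<and> (\<exists>c d C. Q U c d C)" if "p \<in> points M" for p
    using lipschitz_local[OF lip that] unfolding Q_def by blast
  obtain n :: nat and U D where 2: "\<And>i. i < n \<Longrightarrow> openin (surf_top M) (U i)" "\<And>i. i < n \<Longrightarrow> \<exists>c d C. Q (U i) c d C"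
    "\<And>i. i < n \<Longrightarrow> D i \<subseteq> U i" "\<And>i. i < n \<Longrightarrow> D i \<in> sets (borel_alg M)"
    "disjoint_family_on D {..<n}" "(\<Union>i<n. D i) = points M"
    by (rule M.finite_borel_partition[of "\<lambda>U. \<exists>c d C. Q U c d C", OF 1]) blast+
  from 2(2) have "\<forall>i. \<exists>z. i < n \<longrightarrow> Q (U i) (fst z) (fst (snd z)) (snd (snd z))" by (metis fst_conv snd_conv)
  then obtain z where z: "\<And>i. i < n \<Longrightarrow> Q (U i) (fst (z i)) (fst (snd (z i))) (snd (snd (z i)))"
    using choice by metis
  show thesis
  proof (rule that[of n "\<lambda>i. fst (z i)" "\<lambda>i. fst (snd (z i))" D "\<lambda>i. snd (snd (z i))"])
    fix i assume i: "i < n"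
    note q = z[OF i, unfolded Q_def]
    show "fst (z i) \<in> atlas M" "fst (snd (z i)) \<in> atlas N" "D i \<subseteq> chart_dom (fst (z i))"
      "\<phi> ` D i \<subseteq> chart_dom (fst (snd (z i)))" "D i \<in> sets (borel_alg M)"
      using q 2(3,4)[OF i] by blast+
    show "dist (chart_map (fst (snd (z i))) (\<phi> q)) (chart_map (fst (snd (z i))) (\<phi> q'))
        \<le> snd (snd (z i)) * dist (chart_map (fst (z i)) q) (chart_map (fst (z i)) q')" if "q \<in> D i" "q' \<in> D i" for q q'
      using q 2(3)[OF i] that by blast
  qed (use 2 in auto)
qed

end

section \<open>The differential in arbitrary charts\<close>

lemma frechet_derivative_matrix:
  fixes f :: "real^'n \<Rightarrow> real^'m"
  assumes "f differentiable F"
  shows "(f has_derivative (*v) (matrix (frechet_derivative f F))) F"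
proof -
  have d: "(f has_derivative frechet_derivative f F) F"
    using someI_ex[OF assms[unfolded differentiable_def]] by (simp add: frechet_derivative_def)
  have "(*v) (matrix (frechet_derivative f F)) = frechet_derivative f F"
    using has_derivative_linear[OF d] by (intro matrix_vector_mul) (simp add: linear_matrix_vector_mul_eq)
  with d show ?thesis by simp
qed

lemma gram_pullback_chain:
  fixes A D B G :: "real^'n^'n"
  shows "transpose (B ** D ** A) ** G ** (B ** D ** A)
    = transpose A ** (transpose D ** (transpose B ** G ** B) ** D) ** A"
  by (simp add: matrix_transpose_mul matrix_mul_assoc)

text \<open>A change of coordinates \<open>T\<close> in the source conjugates
  \<open>matrix_inv G ** P\<close> by \<open>T\<close>, and the trace is invariant under
  conjugation.\<close>

lemma trace2_adjoint_conj:
  fixes T G P :: "real^2^2"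
  assumes T: "det T \<noteq> 0" and G: "posdef G" and G': "posdef (transpose T ** G ** T)"
  shows "trace2 (matrix_inv (transpose T ** G ** T) ** (transpose T ** P ** T)) = trace2 (matrix_inv G ** P)"
proof -
  let ?G' = "transpose T ** G ** T"
  let ?S = "matrix_inv T"
  have S: "T ** ?S = mat 1" "?S ** T = mat 1"
    using matrix_inv_mult[of T] T by (simp_all add: invertible_det_nz)
  have Gi: "matrix_inv G ** G = mat 1" "G ** matrix_inv G = mat 1" using matrix_inv_mult[OF posdef_invertible[OF G]] by auto
  have tS: "transpose ?S ** transpose T = mat 1"
    using S(1) by (metis matrix_transpose_mul transpose_mat)
  have "(?S ** matrix_inv G ** transpose ?S) ** ?G' = ?S ** matrix_inv G ** (transpose ?S ** transpose T) ** G ** T"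
    by (simp add: matrix_mul_assoc)
  also have "\<dots> = ?S ** (matrix_inv G ** G) ** T" unfolding tS by (simp add: matrix_mul_assoc)
  also have "\<dots> = mat 1" unfolding Gi by (simp add: S)
  finally have l: "(?S ** matrix_inv G ** transpose ?S) ** ?G' = mat 1" .
  have "matrix_inv ?G' = (?S ** matrix_inv G ** transpose ?S) ** ?G' ** matrix_inv ?G'"
    unfolding l by simp
  also have "\<dots> = ?S ** matrix_inv G ** transpose ?S"
    using matrix_inv_mult(2)[OF posdef_invertible[OF G']] by (simp add: matrix_mul_assoc[symmetric])
  finally have inv: "matrix_inv ?G' = ?S ** matrix_inv G ** transpose ?S" .
  have "matrix_inv ?G' ** (transpose T ** P ** T) = ?S ** matrix_inv G ** (transpose ?S ** transpose T) ** P ** T"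
    unfolding inv by (simp add: matrix_mul_assoc)
  also have "\<dots> = ?S ** (matrix_inv G ** P ** T)" unfolding tS by (simp add: matrix_mul_assoc)
  finally have "trace2 (matrix_inv ?G' ** (transpose T ** P ** T)) = trace2 ((matrix_inv G ** P ** T) ** ?S)"
    using trace2_commute by metis
  also have "(matrix_inv G ** P ** T) ** ?S = matrix_inv G ** P"
    using S(1) by (simp add: matrix_mul_assoc[symmetric])
  finally show ?thesis .
qed

context riemannian_surface
begin

lemma gram_at_posdef: "p \<in> points M \<Longrightarrow> posdef (gram_at M p)"
  unfolding gram_at_def using chart_at gram_posdef by blast

end

context surface_pair
begin

lemma adjoint_props:
  assumes "p \<in> points M" "\<phi> p \<in> points N"
  shows "det (adjoint_diff_matrix M N \<phi> p) = (jacobian M N \<phi> p)\<^sup>2"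
    "4 * det (adjoint_diff_matrix M N \<phi> p) \<le> (trace2 (adjoint_diff_matrix M N \<phi> p))\<^sup>2"
    "0 \<le> trace2 (adjoint_diff_matrix M N \<phi> p)"
    "singular_values M N \<phi> p = sv_pair (trace2 (adjoint_diff_matrix M N \<phi> p)) ((jacobian M N \<phi> p)\<^sup>2)"
proof -
  note pd = M.gram_at_posdef[OF assms(1)] N.gram_at_posdef[OF assms(2)]
  show d: "det (adjoint_diff_matrix M N \<phi> p) = (jacobian M N \<phi> p)\<^sup>2"
    unfolding adjoint_diff_matrix_def jacobian_def by (rule det_adjoint[OF pd])
  show t: "4 * det (adjoint_diff_matrix M N \<phi> p) \<le> (trace2 (adjoint_diff_matrix M N \<phi> p))\<^sup>2"
    unfolding adjoint_diff_matrix_def by (rule adjoint_trace_disc[OF pd])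
  show n: "0 \<le> trace2 (adjoint_diff_matrix M N \<phi> p)"
    unfolding adjoint_diff_matrix_def by (rule adjoint_trace_nonneg[OF pd])
  have "0 \<le> det (adjoint_diff_matrix M N \<phi> p)" unfolding d by simp
  from singular_value_pair_unique[OF n this t]
  show "singular_values M N \<phi> p = sv_pair (trace2 (adjoint_diff_matrix M N \<phi> p)) ((jacobian M N \<phi> p)\<^sup>2)"
    unfolding singular_values_def d .
qed

text \<open>The charts selected by \<open>chart_at\<close> vary with the point without any
  regularity. Jacobian and trace are therefore recomputed in prescribed charts, where
  \<open>H\<close> is the selected matrix multiplied by the derivatives of the two transition maps.
  These two invariants suffice, since they determine the singular values.\<close>

lemma derivative_in_charts:
  assumes cont: "continuous_map (surf_top M) (surf_top N) \<phi>" and diff: "differentiable_at_point M N \<phi> p"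
    and c: "c \<in> atlas M" "p \<in> chart_dom c" and d: "d \<in> atlas N" "\<phi> p \<in> chart_dom d"
  obtains H :: "real^2^2" where
    "((chart_map d \<circ> \<phi> \<circ> chart_inv c) has_derivative (*v) H) (at (chart_map c p) within img c)"
    "jacobian M N \<phi> p = sqrt (det (gram N d (chart_map d (\<phi> p)))) / sqrt (det (gram M c (chart_map c p))) * det H"
    "trace2 (adjoint_diff_matrix M N \<phi> p) =
       trace2 (matrix_inv (gram M c (chart_map c p)) ** (transpose H ** gram N d (chart_map d (\<phi> p)) ** H))"
proof -
  have p: "p \<in> points M" "\<phi> p \<in> points N" using c d M.chart_subset N.chart_subset by blast+
  define c0 d0 D where "c0 = chart_at M p" and "d0 = chart_at N (\<phi> p)" and "D = diff_matrix M N \<phi> p"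
  have c0: "c0 \<in> atlas M" "p \<in> chart_dom c0" using M.chart_at[OF p(1)] by (auto simp: c0_def)
  have d0: "d0 \<in> atlas N" "\<phi> p \<in> chart_dom d0" using N.chart_at[OF p(2)] by (auto simp: d0_def)
  have D: "((chart_map d0 \<circ> \<phi> \<circ> chart_inv c0) has_derivative (*v) D) (at (chart_map c0 p) within img c0)"
    using frechet_derivative_matrix[OF diff[unfolded differentiable_at_point_def]]
    unfolding D_def diff_matrix_def local_rep_def coord_filter_def Let_def c0_def d0_def .
  obtain A :: "real^2^2" where A:
    "((chart_map c0 \<circ> chart_inv c) has_derivative (*v) A) (at (chart_map c p) within chart_map c ` (chart_dom c \<inter> chart_dom c0))"
    "0 < det A" "gram M c (chart_map c p) = transpose A ** gram M c0 (chart_map c0 p) ** A"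
    by (rule M.transition[OF c(1) c0(1) c(2) c0(2)])
  obtain B :: "real^2^2" where B:
    "((chart_map d \<circ> chart_inv d0) has_derivative (*v) B) (at (chart_map d0 (\<phi> p)) within chart_map d0 ` (chart_dom d0 \<inter> chart_dom d))"
    "0 < det B" "gram N d0 (chart_map d0 (\<phi> p)) = transpose B ** gram N d (chart_map d (\<phi> p)) ** B"
    by (rule N.transition[OF d0(1) d(1) d0(2) d(2)])
  \<comment> \<open>An open neighbourhood of \<open>p\<close> on which both changes of chart are
    defined; continuity of \<open>\<phi>\<close> makes it open.\<close>
  define W where "W = {q \<in> points M. \<phi> q \<in> chart_dom d \<inter> chart_dom d0} \<inter> (chart_dom c \<inter> chart_dom c0)"
  have W: "openin (surf_top M) W"
    unfolding W_def
    by (intro openin_Int openin_continuous_map_preimage[OF cont] N.chart_open[OF d(1)] N.chart_open[OF d0(1)]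
        M.chart_open[OF c(1)] M.chart_open[OF c0(1)])
  have pW: "p \<in> W" using p c c0 d d0 by (simp add: W_def)
  let ?X = "chart_map c ` W" and ?x = "chart_map c p"
  let ?\<tau> = "chart_map c0 \<circ> chart_inv c" and ?h = "chart_map d0 \<circ> \<phi> \<circ> chart_inv c0" and ?\<rho> = "chart_map d \<circ> chart_inv d0"
  have \<tau>: "?\<tau> (chart_map c q) = chart_map c0 q" if "q \<in> W" for q
    using that c(1) by (simp add: W_def)
  have h: "?h (chart_map c0 q) = chart_map d0 (\<phi> q)" if "q \<in> W" for q
    using that c0(1) by (simp add: W_def)
  have \<rho>: "?\<rho> (chart_map d0 (\<phi> q)) = chart_map d (\<phi> q)" if "q \<in> W" for q
    using that d0(1) by (simp add: W_def)
  have im1: "?\<tau> ` ?X \<subseteq> img c0" using \<tau> by (force simp: W_def)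
  have im2: "(?h \<circ> ?\<tau>) ` ?X \<subseteq> chart_map d0 ` (chart_dom d0 \<inter> chart_dom d)"
  proof
    fix y assume "y \<in> (?h \<circ> ?\<tau>) ` ?X"
    then obtain q where q: "q \<in> W" "y = (?h \<circ> ?\<tau>) (chart_map c q)" by blast
    then have "y = chart_map d0 (\<phi> q)" using \<tau>[OF q(1)] h[OF q(1)] by (simp only: o_apply)
    then show "y \<in> chart_map d0 ` (chart_dom d0 \<inter> chart_dom d)" using q(1) by (auto simp: W_def)
  qed
  have d1: "(?\<tau> has_derivative (*v) A) (at ?x within ?X)"
    using A(1) by (rule has_derivative_subset) (auto simp: W_def)
  have d2: "(?h has_derivative (*v) D) (at (?\<tau> ?x) within ?\<tau> ` ?X)"
    unfolding \<tau>[OF pW] using D im1 by (rule has_derivative_subset)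
  have d12: "(?h \<circ> ?\<tau> has_derivative (*v) D \<circ> (*v) A) (at ?x within ?X)"
    using d1 d2 by (rule diff_chain_within)
  have "(?h \<circ> ?\<tau>) ?x = chart_map d0 (\<phi> p)" using \<tau>[OF pW] h[OF pW] by (simp only: o_apply)
  then have d3: "(?\<rho> has_derivative (*v) B) (at ((?h \<circ> ?\<tau>) ?x) within (?h \<circ> ?\<tau>) ` ?X)"
    using has_derivative_subset[OF B(1) im2] by simp
  have "(?\<rho> \<circ> (?h \<circ> ?\<tau>) has_derivative (*v) B \<circ> ((*v) D \<circ> (*v) A)) (at ?x within ?X)"
    using d12 d3 by (rule diff_chain_within)
  moreover have "(*v) B \<circ> ((*v) D \<circ> (*v) A) = (*v) (B ** D ** A)"
    by (intro ext) (simp add: matrix_vector_mul_assoc matrix_mul_assoc)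
  ultimately have "(?\<rho> \<circ> (?h \<circ> ?\<tau>) has_derivative (*v) (B ** D ** A)) (at ?x within ?X)" by simp
  then have der: "((chart_map d \<circ> \<phi> \<circ> chart_inv c) has_derivative (*v) (B ** D ** A)) (at ?x within ?X)"
  proof (rule has_derivative_transform[rotated 2])
    show "?x \<in> ?X" using pW by blast
    fix y assume "y \<in> ?X"
    then obtain q where q: "q \<in> W" "y = chart_map c q" by blast
    then have "q \<in> chart_dom c" by (simp add: W_def)
    then show "(chart_map d \<circ> \<phi> \<circ> chart_inv c) y = (?\<rho> \<circ> (?h \<circ> ?\<tau>)) y"
      unfolding q(2) o_apply[of _ "?h \<circ> ?\<tau>"] o_apply[of ?h] \<tau>[OF q(1)] h[OF q(1)] \<rho>[OF q(1)] using c(1) by simp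
  qed
  have "openin (top_of_set (img c)) ?X"
  proof -
    have "W \<inter> chart_dom c = W" by (auto simp: W_def)
    then show ?thesis using M.chart_image_open[OF c(1) W] by simp
  qed
  then obtain O' where O: "open O'" "?X = img c \<inter> O'" by (auto simp: openin_open)
  \<comment> \<open>The chain rule gave the derivative within the smaller set; relative openness
    makes it the derivative within the whole chart image.\<close>
  have "at ?x within img c = at ?x within ?X"
    using O pW by (intro at_within_nhd[of _ O']) auto
  with der have der': "((chart_map d \<circ> \<phi> \<circ> chart_inv c) has_derivative (*v) (B ** D ** A)) (at ?x within img c)" by simp
  let ?G = "gram M c ?x" and ?Go = "gram M c0 (chart_map c0 p)" and ?K = "gram N d (chart_map d (\<phi> p))" and ?Ko = "gram N d0 (chart_map d0 (\<phi> p))"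
  have pd: "posdef ?G" "posdef ?Go" "posdef ?K" "posdef ?Ko"
    using c c0 d d0 by (auto intro: M.gram_posdef N.gram_posdef)
  have "det ?G = (det A)\<^sup>2 * det ?Go" by (simp only: A(3) det_mul det_transpose power2_eq_square ac_simps)
  then have sG: "sqrt (det ?G) = det A * sqrt (det ?Go)" using A(2) by (simp add: real_sqrt_mult)
  have "det ?Ko = (det B)\<^sup>2 * det ?K" by (simp only: B(3) det_mul det_transpose power2_eq_square ac_simps)
  then have sK: "sqrt (det ?Ko) = det B * sqrt (det ?K)" using B(2) by (simp add: real_sqrt_mult)
  have "jacobian M N \<phi> p = sqrt (det ?Ko) / sqrt (det ?Go) * det D"
    by (simp add: jacobian_def gram_at_def c0_def d0_def D_def)
  also have "\<dots> = sqrt (det ?K) / sqrt (det ?G) * det (B ** D ** A)"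
  proof -
    have "b * k / g * y = k / (a * g) * (b * y * a)" if "0 < a" for a b k g y :: real
      using that by simp
    from this[OF A(2)] show ?thesis unfolding sG sK det_mul .
  qed
  finally have J: "jacobian M N \<phi> p = sqrt (det ?K) / sqrt (det ?G) * det (B ** D ** A)" .
  have "trace2 (adjoint_diff_matrix M N \<phi> p) = trace2 (matrix_inv ?Go ** (transpose D ** ?Ko ** D))"
    by (simp add: adjoint_diff_matrix_def gram_at_def c0_def d0_def D_def)
  also have "\<dots> = trace2 (matrix_inv ?G ** (transpose A ** (transpose D ** ?Ko ** D) ** A))"
    using trace2_adjoint_conj[OF _ pd(2), of A] A(2,3) pd(1) by simp
  also have "transpose A ** (transpose D ** ?Ko ** D) ** A = transpose (B ** D ** A) ** ?K ** (B ** D ** A)"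
    unfolding B(3) by (rule gram_pullback_chain[symmetric])
  finally have "trace2 (adjoint_diff_matrix M N \<phi> p) = trace2 (matrix_inv ?G ** (transpose (B ** D ** A) ** ?K ** (B ** D ** A)))" .
  with der' J show thesis by (rule that)
qed

end

section \<open>Measurability and integration up to null sets\<close>

context riemannian_surface
begin

text \<open>In the completion every subset of a null set is measurable, so whatever values
  \<open>f\<close> takes at the discarded points cannot spoil measurability.\<close>

lemma measurable_on_null_piece:
  assumes "Z \<in> null_sets \<mu>" shows "f \<in> restrict_space (completion \<mu>) Z \<rightarrow>\<^sub>M borel"
proof (rule measurableI)
  have Z: "Z \<in> sets (completion \<mu>)" using assms by (intro sets_completionI_sets) auto
  have sp: "space (restrict_space (completion \<mu>) Z) = Z"
    using sets.sets_into_space[OF Z] by (auto simp: space_restrict_space)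
  fix A
  have "f -` A \<inter> Z \<in> null_sets (completion \<mu>)"
    using assms by (auto simp: null_sets_completion_iff2)
  then have "f -` A \<inter> Z \<in> sets (completion \<mu>)" by (rule null_setsD2)
  then show "f -` A \<inter> space (restrict_space (completion \<mu>) Z) \<in> sets (restrict_space (completion \<mu>) Z)"
    unfolding sp using sets.Int_space_eq2[OF Z] Z by (subst sets_restrict_space_iff) auto
qed simp

lemma measurable_glue_ae:
  fixes n :: nat
  assumes Z: "Z \<in> null_sets \<mu>"
    and D: "\<And>i. i < n \<Longrightarrow> D i \<in> sets (borel_alg M)" "points M \<subseteq> (\<Union>i<n. D i) \<union> Z"
    and f: "\<And>i. i < n \<Longrightarrow> f \<in> restrict_space (completion \<mu>) (D i) \<rightarrow>\<^sub>M borel"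
  shows "f \<in> completion \<mu> \<rightarrow>\<^sub>M borel"
proof (rule measurable_piecewise_restrict[of "insert Z (D ` {..<n})"])
  show "\<Omega> \<inter> space (completion \<mu>) \<in> sets (completion \<mu>)" if "\<Omega> \<in> insert Z (D ` {..<n})" for \<Omega>
    using that D(1) Z by (intro sets.Int sets.top sets_completionI_sets) (auto dest: null_setsD2)
  show "f \<in> restrict_space (completion \<mu>) \<Omega> \<rightarrow>\<^sub>M borel" if "\<Omega> \<in> insert Z (D ` {..<n})" for \<Omega>
    using that f measurable_on_null_piece[OF Z] by auto
qed (use D in auto)

lemma nn_integral_partition_ae:
  fixes n :: nat
  assumes Z: "Z \<in> null_sets \<mu>"
    and D: "\<And>i. i < n \<Longrightarrow> D i \<in> sets (borel_alg M)" "disjoint_family_on D {..<n}" "points M \<subseteq> (\<Union>i<n. D i) \<union> Z"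
    and u: "u \<in> borel_measurable (completion \<mu>)"
  shows "(\<integral>\<^sup>+p. u p \<partial>\<mu>) = (\<Sum>i<n. \<integral>\<^sup>+p\<in>D i. u p \<partial>\<mu>)"
proof -
  have "(\<integral>\<^sup>+p. u p \<partial>completion \<mu>) = (\<integral>\<^sup>+p. (\<Sum>i<n. u p * indicator (D i) p) \<partial>completion \<mu>)"
  proof (rule nn_integral_cong_AE)
    have "AE p in completion \<mu>. p \<notin> Z" using Z by (intro AE_completion AE_not_in)
    then show "AE p in completion \<mu>. u p = (\<Sum>i<n. u p * indicator (D i) p)"
    proof (rule AE_mp, intro AE_I2 impI)
      fix p assume "p \<in> space (completion \<mu>)" "p \<notin> Z"
      then have "indicator (\<Union>i<n. D i) p = (1 :: ennreal)" using D(3) by (auto simp: indicator_def)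
      moreover have "indicator (\<Union>i<n. D i) p = (\<Sum>i<n. indicator (D i) p :: ennreal)"
        by (rule indicator_UN_disjoint[OF finite_lessThan D(2)])
      ultimately have "(\<Sum>i<n. indicator (D i) p :: ennreal) = 1" by simp
      then show "u p = (\<Sum>i<n. u p * indicator (D i) p)" by (simp add: sum_distrib_left[symmetric])
    qed
  qed
  also have "\<dots> = (\<Sum>i<n. \<integral>\<^sup>+p\<in>D i. u p \<partial>completion \<mu>)"
    using u D(1) by (intro nn_integral_sum borel_measurable_times_ennreal borel_measurable_indicator sets_completionI_sets) auto
  finally show ?thesis by (simp only: nn_integral_completion)
qed

end

context surface_pair
begin

text \<open>With the charts fixed on a piece, derivative matrices \<open>H\<close> can be chosen
  pointwise. Their entries are partial derivatives and hence Lebesgue measurable, and Jacobian and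
  trace are rational in them and in square roots of continuous metric data.\<close>

lemma chart_piece:
  assumes cont: "continuous_map (surf_top M) (surf_top N) \<phi>"
    and c: "c \<in> atlas M" and d: "d \<in> atlas N"
    and A: "A \<in> sets (borel_alg M)" "A \<subseteq> chart_dom c" "\<phi> ` A \<subseteq> chart_dom d"
    and diff: "\<And>p. p \<in> A \<Longrightarrow> differentiable_at_point M N \<phi> p"
  defines "X \<equiv> chart_map c ` A" and "h \<equiv> chart_map d \<circ> \<phi> \<circ> chart_inv c"
  obtains H :: "real^2 \<Rightarrow> real^2^2" where
    "\<And>x. x \<in> X \<Longrightarrow> (h has_derivative (*v) (H x)) (at x within X)"
    "\<And>x. x \<in> X \<Longrightarrow> jacobian M N \<phi> (chart_inv c x) = sqrt (det (gram N d (h x))) / sqrt (det (gram M c x)) * det (H x)"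
    "(\<lambda>x. jacobian M N \<phi> (chart_inv c x)) \<in> borel_measurable (lebesgue_on X)"
    "(\<lambda>x. trace2 (adjoint_diff_matrix M N \<phi> (chart_inv c x))) \<in> borel_measurable (lebesgue_on X)"
proof -
  have "\<exists>H. (h has_derivative (*v) H) (at x within X) \<and>
      jacobian M N \<phi> (chart_inv c x) = sqrt (det (gram N d (h x))) / sqrt (det (gram M c x)) * det H \<and>
      trace2 (adjoint_diff_matrix M N \<phi> (chart_inv c x)) =
        trace2 (matrix_inv (gram M c x) ** (transpose H ** gram N d (h x) ** H))" if x: "x \<in> X" for x
  proof -
    from x obtain p where p: "p \<in> A" "x = chart_map c p" unfolding X_def by (rule imageE)
    have pd: "p \<in> chart_dom c" "\<phi> p \<in> chart_dom d" using p A by auto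
    have i: "chart_inv c x = p" "h x = chart_map d (\<phi> p)" using pd c by (simp_all add: p(2) h_def)
    obtain H :: "real^2^2" where H:
      "(h has_derivative (*v) H) (at (chart_map c p) within img c)"
      "jacobian M N \<phi> p = sqrt (det (gram N d (chart_map d (\<phi> p)))) / sqrt (det (gram M c (chart_map c p))) * det H"
      "trace2 (adjoint_diff_matrix M N \<phi> p) =
         trace2 (matrix_inv (gram M c (chart_map c p)) ** (transpose H ** gram N d (chart_map d (\<phi> p)) ** H))"
      unfolding h_def by (rule derivative_in_charts[OF cont diff[OF p(1)] c pd(1) d pd(2)])
    have "X \<subseteq> img c" using A by (auto simp: X_def)
    then have "(h has_derivative (*v) H) (at x within X)" using has_derivative_subset[OF H(1)] unfolding p(2) by blast
    then show ?thesis using H(2,3) unfolding i by (intro exI[of _ H]) (simp add: p(2))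
  qed
  then obtain H where H: "\<And>x. x \<in> X \<Longrightarrow> (h has_derivative (*v) (H x)) (at x within X)"
    "\<And>x. x \<in> X \<Longrightarrow> jacobian M N \<phi> (chart_inv c x) = sqrt (det (gram N d (h x))) / sqrt (det (gram M c x)) * det (H x)"
    "\<And>x. x \<in> X \<Longrightarrow> trace2 (adjoint_diff_matrix M N \<phi> (chart_inv c x)) =
        trace2 (matrix_inv (gram M c x) ** (transpose (H x) ** gram N d (h x) ** H x))" by metis
  have X: "X \<in> sets lebesgue" using M.chart_image_borel[OF c A(1,2)] by (simp add: X_def)
  have sub: "X \<subseteq> img c" using A by (auto simp: X_def)
  have hX: "h ` X \<subseteq> img d"
  proof
    fix y assume "y \<in> h ` X"
    then obtain p where "p \<in> A" "y = h (chart_map c p)" unfolding X_def by blast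
    moreover from this have "p \<in> chart_dom c" "\<phi> p \<in> chart_dom d" using A by auto
    ultimately show "y \<in> img d" using c by (simp add: h_def)
  qed
  have conth: "continuous_on X h"
    using H(1) by (meson continuous_on_eq_continuous_within has_derivative_continuous)
  have meas: "(\<lambda>x. q x) \<in> borel_measurable (lebesgue_on X)" if "continuous_on X q" for q :: "real^2 \<Rightarrow> real"
    using X that by (intro continuous_imp_measurable_on_sets_lebesgue)
  have g[measurable]: "(\<lambda>x. gram M c x $ i $ j) \<in> borel_measurable (lebesgue_on X)" for i j
    by (intro meas continuous_on_component continuous_on_subset[OF M.gram_continuous[OF c] sub])
  have k[measurable]: "(\<lambda>x. gram N d (h x) $ i $ j) \<in> borel_measurable (lebesgue_on X)" for i j
    by (intro meas continuous_on_component continuous_on_compose2[OF N.gram_continuous[OF d] conth hX])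
  have e[measurable]: "(\<lambda>x. H x $ i $ j) \<in> borel_measurable (lebesgue_on X)" for i j
    using borel_measurable_partial_derivatives[OF X H(1), of i j] by simp
  show thesis
  proof (rule that[OF H(1,2)])
    have "(\<lambda>x. sqrt (det (gram N d (h x))) / sqrt (det (gram M c x)) * det (H x)) \<in> borel_measurable (lebesgue_on X)"
      unfolding det_2 by measurable
    then show "(\<lambda>x. jacobian M N \<phi> (chart_inv c x)) \<in> borel_measurable (lebesgue_on X)"
      by (subst measurable_cong[OF H(2)]) (auto simp: space_restrict_space)
    have tr: "trace2 (adjoint_diff_matrix M N \<phi> (chart_inv c x)) =
        (gram M c x $2$2 * (transpose (H x) ** gram N d (h x) ** H x)$1$1
         - gram M c x $1$2 * ((transpose (H x) ** gram N d (h x) ** H x)$2$1 + (transpose (H x) ** gram N d (h x) ** H x)$1$2)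
         + gram M c x $1$1 * (transpose (H x) ** gram N d (h x) ** H x)$2$2) / det (gram M c x)" if "x \<in> X" for x
      unfolding H(3)[OF that] using that sub by (intro trace2_inv_mult M.gram_posdef[OF c]) auto
    have P[measurable]: "(\<lambda>x. (transpose (H x) ** gram N d (h x) ** H x)$i$j) \<in> borel_measurable (lebesgue_on X)" for i j
      unfolding matrix_matrix_mult_def transpose_def vec_lambda_beta sum_2 by measurable
    have "(\<lambda>x. (gram M c x $2$2 * (transpose (H x) ** gram N d (h x) ** H x)$1$1
         - gram M c x $1$2 * ((transpose (H x) ** gram N d (h x) ** H x)$2$1 + (transpose (H x) ** gram N d (h x) ** H x)$1$2)
         + gram M c x $1$1 * (transpose (H x) ** gram N d (h x) ** H x)$2$2) / det (gram M c x)) \<in> borel_measurable (lebesgue_on X)"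
      unfolding det_2 by measurable
    then show "(\<lambda>x. trace2 (adjoint_diff_matrix M N \<phi> (chart_inv c x))) \<in> borel_measurable (lebesgue_on X)"
      by (subst measurable_cong[OF tr]) (auto simp: space_restrict_space)
  qed
qed

text \<open>Lusin's condition (N): in coordinates \<open>\<phi>\<close> is Lipschitz on each of
  finitely many pieces, between spaces of the same dimension, and such maps preserve negligible
  sets.\<close>

lemma lipschitz_image_null:
  assumes lip: "lipschitz_map M N \<phi>" and Z: "Z \<in> null_sets (completion M.\<mu>)"
  shows "\<phi> ` Z \<in> null_sets (completion N.\<mu>)"
proof -
  obtain n :: nat and c d C D where
    P: "\<And>i. i < n \<Longrightarrow> c i \<in> atlas M" "\<And>i. i < n \<Longrightarrow> d i \<in> atlas N"
    "\<And>i. i < n \<Longrightarrow> D i \<in> sets (borel_alg M)" "\<And>i. i < n \<Longrightarrow> D i \<subseteq> chart_dom (c i)"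
    "\<And>i. i < n \<Longrightarrow> \<phi> ` D i \<subseteq> chart_dom (d i)"
    "\<And>i q q'. i < n \<Longrightarrow> q \<in> D i \<Longrightarrow> q' \<in> D i \<Longrightarrow>
       dist (chart_map (d i) (\<phi> q)) (chart_map (d i) (\<phi> q')) \<le> C i * dist (chart_map (c i) q) (chart_map (c i) q')"
    "disjoint_family_on D {..<n}" "(\<Union>i<n. D i) = points M"
    by (rule lipschitz_partition[OF lip]) blast
  have null: "\<phi> ` (Z \<inter> D i) \<in> null_sets (completion N.\<mu>)" if i: "i < n" for i
  proof -
    let ?h = "chart_map (d i) \<circ> \<phi> \<circ> chart_inv (c i)"
    have "Z \<inter> D i \<in> null_sets (completion M.\<mu>)" using Z by (rule null_sets_completion_subset[rotated]) auto
    then have neg: "negligible (chart_map (c i) ` (Z \<inter> D i))"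
      using M.null_sets_chart_iff[OF P(1)[OF i], of "Z \<inter> D i"] P(4)[OF i] by blast
    have "negligible (?h ` chart_map (c i) ` (Z \<inter> D i))"
    proof (rule negligible_locally_Lipschitz_image[OF _ neg])
      fix x assume x: "x \<in> chart_map (c i) ` (Z \<inter> D i)"
      have "norm (?h y - ?h x) \<le> C i * norm (y - x)" if "y \<in> chart_map (c i) ` (Z \<inter> D i)" for y
      proof -
        from x obtain p where p: "p \<in> Z \<inter> D i" "x = chart_map (c i) p" by (rule imageE)
        from that obtain q where q: "q \<in> Z \<inter> D i" "y = chart_map (c i) q" by (rule imageE)
        have "p \<in> chart_dom (c i)" "q \<in> chart_dom (c i)" using p q P(4)[OF i] by auto
        then show ?thesis using P(6)[OF i, of q p] p q P(1)[OF i] by (simp add: dist_norm)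
      qed
      then show "\<exists>T B. open T \<and> x \<in> T \<and> (\<forall>y\<in>chart_map (c i) ` (Z \<inter> D i) \<inter> T. norm (?h y - ?h x) \<le> B * norm (y - x))"
        by (intro exI[of _ UNIV] exI[of _ "C i"]) auto
    qed simp
    moreover have "?h ` chart_map (c i) ` (Z \<inter> D i) = chart_map (d i) ` \<phi> ` (Z \<inter> D i)"
      unfolding image_image
    proof (rule image_cong)
      fix p assume "p \<in> Z \<inter> D i"
      then have "p \<in> chart_dom (c i)" using P(4)[OF i] by auto
      then show "?h (chart_map (c i) p) = chart_map (d i) (\<phi> p)" using P(1)[OF i] by simp
    qed simp
    ultimately show ?thesis
      using N.null_sets_chart_iff[OF P(2)[OF i], of "\<phi> ` (Z \<inter> D i)"] P(5)[OF i] by auto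
  qed
  have "Z \<subseteq> points M" using null_setsD2[OF Z] sets.sets_into_space by fastforce
  then have "\<phi> ` Z = (\<Union>i\<in>{..<n}. \<phi> ` (Z \<inter> D i))" using P(8) by blast
  also have "\<dots> \<in> null_sets (completion N.\<mu>)"
    using null by (intro null_sets_UN') auto
  finally show ?thesis .
qed

lemma image_points_borel:
  assumes cont: "continuous_map (surf_top M) (surf_top N) \<phi>"
  shows "closedin (surf_top N) (\<phi> ` points M)" "\<phi> ` points M \<in> sets (borel_alg N)"
proof -
  have "compactin (surf_top N) (\<phi> ` points M)"
    using M.compact cont by (intro image_compactin) (auto simp: compact_space_def)
  then show cl: "closedin (surf_top N) (\<phi> ` points M)"
    using compactin_imp_closedin[OF N.hausdorff] by blast
  then have "openin (surf_top N) (points N - \<phi> ` points M)" "\<phi> ` points M \<subseteq> points N"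
    by (auto simp: closedin_def)
  moreover from this have "\<phi> ` points M = points N - (points N - \<phi> ` points M)" by auto
  ultimately show "\<phi> ` points M \<in> sets (borel_alg N)"
    using sets.compl_sets[OF open_borel_alg] by (metis space_borel_alg)
qed

lemma continuous_measurable:
  assumes cont: "continuous_map (surf_top M) (surf_top N) \<phi>"
  shows "\<phi> \<in> borel_alg M \<rightarrow>\<^sub>M borel_alg N"
  unfolding borel_alg_def[of N]
proof (rule measurable_measure_of[OF open_subsets])
  show "\<phi> \<in> space (borel_alg M) \<rightarrow> points N" using cont by (auto simp: continuous_map_def)
  fix U assume "U \<in> {U. openin (surf_top N) U}"
  then have "openin (surf_top M) {x \<in> points M. \<phi> x \<in> U}" using openin_continuous_map_preimage[OF cont] by blast
  moreover have "{x \<in> points M. \<phi> x \<in> U} = \<phi> -` U \<inter> space (borel_alg M)" by auto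
  ultimately show "\<phi> -` U \<inter> space (borel_alg M) \<in> sets (borel_alg M)" using open_borel_alg by metis
qed

end

section \<open>The area formula\<close>

context surface_pair
begin

context
  fixes \<phi> :: "'a \<Rightarrow> 'b"
  assumes lip: "lipschitz_map M N \<phi>"
    and diff: "AE p in M.\<mu>. differentiable_at_point M N \<phi> p"
begin

text \<open>Discarding one Borel null set makes \<open>\<phi>\<close> differentiable at every point
  of the pieces, as the pointwise choice of derivative matrices in \<open>chart_piece\<close>
  requires.\<close>

lemma adapted_partition:
  obtains Z n c d D where "Z \<in> null_sets M.\<mu>"
    "\<And>i. i < (n::nat) \<Longrightarrow> c i \<in> atlas M" "\<And>i. i < n \<Longrightarrow> d i \<in> atlas N"
    "\<And>i. i < n \<Longrightarrow> D i \<in> sets (borel_alg M)" "\<And>i. i < n \<Longrightarrow> D i \<subseteq> chart_dom (c i)"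
    "\<And>i. i < n \<Longrightarrow> \<phi> ` D i \<subseteq> chart_dom (d i)"
    "\<And>i p. i < n \<Longrightarrow> p \<in> D i \<Longrightarrow> differentiable_at_point M N \<phi> p"
    "disjoint_family_on D {..<n}" "(\<Union>i<n. D i) = points M - Z"
proof -
  obtain n :: nat and c d C D where
    P: "\<And>i. i < n \<Longrightarrow> c i \<in> atlas M" "\<And>i. i < n \<Longrightarrow> d i \<in> atlas N"
    "\<And>i. i < n \<Longrightarrow> D i \<in> sets (borel_alg M)" "\<And>i. i < n \<Longrightarrow> D i \<subseteq> chart_dom (c i)"
    "\<And>i. i < n \<Longrightarrow> \<phi> ` D i \<subseteq> chart_dom (d i)"
    "\<And>i q q'. i < n \<Longrightarrow> q \<in> D i \<Longrightarrow> q' \<in> D i \<Longrightarrow>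
       dist (chart_map (d i) (\<phi> q)) (chart_map (d i) (\<phi> q')) \<le> C i * dist (chart_map (c i) q) (chart_map (c i) q')"
    "disjoint_family_on D {..<n}" "(\<Union>i<n. D i) = points M"
    by (rule lipschitz_partition[OF lip]) blast
  obtain Z where Z: "Z \<in> null_sets M.\<mu>" "{p \<in> space M.\<mu>. \<not> differentiable_at_point M N \<phi> p} \<subseteq> Z"
    using diff unfolding eventually_ae_filter by blast
  have Zb: "Z \<in> sets (borel_alg M)" using null_setsD2[OF Z(1)] by simp
  show thesis
  proof (rule that[of Z n c d "\<lambda>i. D i - Z"])
    show "disjoint_family_on (\<lambda>i. D i - Z) {..<n}"
      using P(7) by (auto simp: disjoint_family_on_def)
    show "(\<Union>i<n. D i - Z) = points M - Z" using P(8) by blast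
    fix i assume i: "i < n"
    show "D i - Z \<in> sets (borel_alg M)" using P(3)[OF i] Zb by (rule sets.Diff)
    show "D i - Z \<subseteq> chart_dom (c i)" "\<phi> ` (D i - Z) \<subseteq> chart_dom (d i)" using P(4,5)[OF i] by blast+
    show "differentiable_at_point M N \<phi> p" if "p \<in> D i - Z" for p
    proof -
      have "p \<in> points M" using that P(8) i by blast
      then show ?thesis using Z(2) that by auto
    qed
  qed (use Z P in auto)
qed

lemma jacobian_measurable: "(\<lambda>p. jacobian M N \<phi> p) \<in> borel_measurable (completion M.\<mu>)"
  and trace_measurable: "(\<lambda>p. trace2 (adjoint_diff_matrix M N \<phi> p)) \<in> borel_measurable (completion M.\<mu>)"
proof -
  obtain Z n c d D where P: "Z \<in> null_sets M.\<mu>"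
    "\<And>i. i < (n::nat) \<Longrightarrow> c i \<in> atlas M" "\<And>i. i < n \<Longrightarrow> d i \<in> atlas N"
    "\<And>i. i < n \<Longrightarrow> D i \<in> sets (borel_alg M)" "\<And>i. i < n \<Longrightarrow> D i \<subseteq> chart_dom (c i)"
    "\<And>i. i < n \<Longrightarrow> \<phi> ` D i \<subseteq> chart_dom (d i)"
    "\<And>i p. i < n \<Longrightarrow> p \<in> D i \<Longrightarrow> differentiable_at_point M N \<phi> p"
    "disjoint_family_on D {..<n}" "(\<Union>i<n. D i) = points M - Z"
    by (rule adapted_partition) blast
  have cov: "points M \<subseteq> (\<Union>i<n. D i) \<union> Z" using P(9) by blast
  have "(\<lambda>p. jacobian M N \<phi> p) \<in> restrict_space (completion M.\<mu>) (D i) \<rightarrow>\<^sub>M borel \<and>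
    (\<lambda>p. trace2 (adjoint_diff_matrix M N \<phi> p)) \<in> restrict_space (completion M.\<mu>) (D i) \<rightarrow>\<^sub>M borel" if i: "i < n" for i
  proof -
    have 1: "(\<lambda>x. jacobian M N \<phi> (chart_inv (c i) x)) \<in> borel_measurable (lebesgue_on (chart_map (c i) ` D i))"
      and 2: "(\<lambda>x. trace2 (adjoint_diff_matrix M N \<phi> (chart_inv (c i) x))) \<in> borel_measurable (lebesgue_on (chart_map (c i) ` D i))"
      using chart_piece[OF lipschitz_continuous[OF lip] P(2-7)[OF i]] i by blast+
    show ?thesis
      using M.measurable_from_chart[OF P(2)[OF i] P(4,5)[OF i] 1] M.measurable_from_chart[OF P(2)[OF i] P(4,5)[OF i] 2] by blast
  qed
  then show "(\<lambda>p. jacobian M N \<phi> p) \<in> borel_measurable (completion M.\<mu>)"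
    "(\<lambda>p. trace2 (adjoint_diff_matrix M N \<phi> p)) \<in> borel_measurable (completion M.\<mu>)"
    using M.measurable_glue_ae[OF P(1,4) cov] by blast+
qed

text \<open>Over points with a unique preimage this is the change of variables formula. The other points
  form a null set, on whose preimage the Jacobian vanishes almost everywhere.\<close>

lemma area_formula:
  assumes mult: "AE q in N.\<mu>. \<exists>\<^sub>\<le>\<^sub>1 p. p \<in> points M \<and> \<phi> p = q"
  shows "(\<integral>\<^sup>+p. ennreal \<bar>jacobian M N \<phi> p\<bar> \<partial>M.\<mu>) = emeasure N.\<mu> (\<phi> ` points M)"
proof -
  obtain Z n c d D where P: "Z \<in> null_sets M.\<mu>"
    "\<And>i. i < (n::nat) \<Longrightarrow> c i \<in> atlas M" "\<And>i. i < n \<Longrightarrow> d i \<in> atlas N"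
    "\<And>i. i < n \<Longrightarrow> D i \<in> sets (borel_alg M)" "\<And>i. i < n \<Longrightarrow> D i \<subseteq> chart_dom (c i)"
    "\<And>i. i < n \<Longrightarrow> \<phi> ` D i \<subseteq> chart_dom (d i)"
    "\<And>i p. i < n \<Longrightarrow> p \<in> D i \<Longrightarrow> differentiable_at_point M N \<phi> p"
    "disjoint_family_on D {..<n}" "(\<Union>i<n. D i) = points M - Z"
    by (rule adapted_partition) blast
  note cont = lipschitz_continuous[OF lip]
  have \<phi>N: "\<phi> p \<in> points N" if "p \<in> points M" for p using lip that by (auto simp: lipschitz_map_def)
  obtain B where B: "B \<in> null_sets N.\<mu>" "{q \<in> space N.\<mu>. \<not> (\<exists>\<^sub>\<le>\<^sub>1 p. p \<in> points M \<and> \<phi> p = q)} \<subseteq> B"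
    using mult unfolding eventually_ae_filter by blast
  \<comment> \<open>\<open>B\<close> is null in \<open>N\<close>, but its preimage may have positive
    area in \<open>M\<close>. It is Borel, and away from it \<open>\<phi>\<close> is
    injective.\<close>
  define Q where "Q = \<phi> -` B \<inter> points M"
  have Q: "Q \<in> sets (borel_alg M)"
    using measurable_sets[OF continuous_measurable[OF cont], of B] null_setsD2[OF B(1)] by (simp add: Q_def)
  have inj: "inj_on \<phi> (points M - Q)"
  proof (rule inj_onI)
    fix p q assume pq: "p \<in> points M - Q" "q \<in> points M - Q" "\<phi> p = \<phi> q"
    then have "\<phi> p \<notin> B" "\<phi> p \<in> space N.\<mu>" using \<phi>N by (auto simp: Q_def)
    then have "\<exists>\<^sub>\<le>\<^sub>1 p'. p' \<in> points M \<and> \<phi> p' = \<phi> p" using B(2) by blast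
    then show "p = q" using pq unfolding Uniq_def by auto
  qed
  define A where "A i = D i - Q" for i
  let ?J = "\<lambda>p. ennreal \<bar>jacobian M N \<phi> p\<bar>"
  have Jm: "?J \<in> borel_measurable (completion M.\<mu>)" using jacobian_measurable by measurable
  have Dp: "D i \<subseteq> points M" if "i < n" for i using P(9) that by blast
  have main: "(\<integral>\<^sup>+p\<in>D i. ?J p \<partial>M.\<mu>) = emeasure (completion N.\<mu>) (\<phi> ` A i) \<and> \<phi> ` A i \<in> sets (completion N.\<mu>)"
    if i: "i < n" for i
  proof -
    define X where "X = chart_map (c i) ` D i"
    define h where "h = chart_map (d i) \<circ> \<phi> \<circ> chart_inv (c i)"
    obtain H :: "real^2 \<Rightarrow> real^2^2" where H:
      "\<And>x. x \<in> X \<Longrightarrow> (h has_derivative (*v) (H x)) (at x within X)"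
      "\<And>x. x \<in> X \<Longrightarrow> jacobian M N \<phi> (chart_inv (c i) x) = sqrt (det (gram N (d i) (h x))) / sqrt (det (gram M (c i) x)) * det (H x)"
      "(\<lambda>x. jacobian M N \<phi> (chart_inv (c i) x)) \<in> borel_measurable (lebesgue_on X)"
      unfolding X_def h_def by (rule chart_piece[OF cont P(2-6)[OF i] P(7)[OF i]]) blast+
    have hp: "h (chart_map (c i) p) = chart_map (d i) (\<phi> p)" if "p \<in> D i" for p
    proof -
      have "p \<in> chart_dom (c i)" using that P(5)[OF i] by blast
      then show ?thesis using P(2)[OF i] by (simp add: h_def)
    qed
    have \<phi>d: "\<phi> p \<in> chart_dom (d i)" if "p \<in> D i" for p using P(6)[OF i] that by blast
    have X: "X \<in> sets lebesgue" "X \<subseteq> img (c i)"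
      using M.chart_image_borel[OF P(2,4,5)[OF i]] P(5)[OF i] by (auto simp: X_def)
    define Y where "Y = chart_map (c i) ` A i"
    have Ab: "A i \<in> sets (borel_alg M)" "A i \<subseteq> chart_dom (c i)" "A i \<subseteq> D i"
      using P(4,5)[OF i] Q by (auto simp: A_def)
    have Y: "Y \<in> sets lebesgue" "Y \<subseteq> X" using M.chart_image_borel[OF P(2)[OF i] Ab(1,2)] Ab(3) by (auto simp: Y_def X_def)
    \<comment> \<open>The removed points are sent into the null set \<open>B\<close>, so the
      Jacobian must vanish at almost all of them.\<close>
    have "negligible (h ` (X - Y))"
    proof -
      have "\<phi> ` (D i \<inter> Q) \<in> null_sets (completion N.\<mu>)"
        using B(1) by (auto simp: null_sets_completion_iff2 Q_def)
      then have "negligible (chart_map (d i) ` \<phi> ` (D i \<inter> Q))"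
        using N.null_sets_chart_iff[OF P(3)[OF i], of "\<phi> ` (D i \<inter> Q)"] \<phi>d by blast
      moreover have "h ` (X - Y) \<subseteq> chart_map (d i) ` \<phi> ` (D i \<inter> Q)"
      proof
        fix y assume "y \<in> h ` (X - Y)"
        then obtain p where p: "p \<in> D i" "chart_map (c i) p \<notin> Y" "y = h (chart_map (c i) p)" by (auto simp: X_def)
        then have "p \<in> Q" by (auto simp: Y_def A_def)
        then show "y \<in> chart_map (d i) ` \<phi> ` (D i \<inter> Q)" using p hp by auto
      qed
      ultimately show ?thesis by (rule negligible_subset)
    qed
    then have "negligible {x \<in> X - Y. det (matrix ((*v) (H x))) \<noteq> 0}"
      using H(1) by (intro jacobian_zero_on_negligible_image[where h=h]) (auto intro: has_derivative_subset)
    then have ae: "AE x in lebesgue. \<not> (x \<in> X - Y \<and> det (H x) \<noteq> 0)"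
      by (auto simp: negligible_iff_null_sets intro: AE_I')
    let ?w = "\<lambda>y. ennreal (sqrt (det (gram N (d i) y))) * indicator (img (d i)) y"
    have himg: "h x \<in> img (d i)" if "x \<in> X" for x
      using that hp \<phi>d by (auto simp: X_def)
    have "(\<integral>\<^sup>+p\<in>D i. ?J p \<partial>M.\<mu>) =
       (\<integral>\<^sup>+x\<in>X. ennreal (sqrt (det (gram M (c i) x))) * ennreal \<bar>jacobian M N \<phi> (chart_inv (c i) x)\<bar> \<partial>lebesgue)"
      unfolding X_def using H(3) by (intro M.nn_integral_chart[OF P(2,4,5)[OF i]]) (simp add: X_def)
    also have "\<dots> = (\<integral>\<^sup>+x\<in>X. ennreal \<bar>det (H x)\<bar> * ?w (h x) \<partial>lebesgue)"
    proof (rule nn_integral_cong)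
      fix x
      show "ennreal (sqrt (det (gram M (c i) x))) * ennreal \<bar>jacobian M N \<phi> (chart_inv (c i) x)\<bar> * indicator X x
        = ennreal \<bar>det (H x)\<bar> * ?w (h x) * indicator X x"
      proof (cases "x \<in> X")
        case True
        have pos: "0 < sqrt (det (gram M (c i) x))" "0 < sqrt (det (gram N (d i) (h x)))"
          using M.dens_pos[OF P(2)[OF i], of x] N.dens_pos[OF P(3)[OF i] himg[OF True]] True X(2) by auto
        have "a * \<bar>b / a * e\<bar> = \<bar>e\<bar> * b" if "0 < a" "0 < b" for a b e :: real
          using that by (simp add: abs_mult)
        from this[OF pos, of "det (H x)"]
        show ?thesis using True himg[OF True] pos unfolding H(2)[OF True]
          by (simp add: ennreal_mult'[symmetric] ennreal_mult''[symmetric])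
      qed simp
    qed
    \<comment> \<open>Shrinking the domain to \<open>Y\<close>, where \<open>h\<close> is injective,
      loses nothing because the determinant vanishes almost everywhere on
      \<open>X - Y\<close>.\<close>
    also have "\<dots> = (\<integral>\<^sup>+x\<in>Y. ennreal \<bar>det (matrix ((*v) (H x)))\<bar> * ?w (h x) \<partial>lebesgue)"
    proof (rule nn_integral_cong_AE, rule AE_mp[OF ae], intro AE_I2 impI)
      fix x assume x: "\<not> (x \<in> X - Y \<and> det (H x) \<noteq> 0)"
      show "ennreal \<bar>det (H x)\<bar> * ?w (h x) * indicator X x = ennreal \<bar>det (matrix ((*v) (H x)))\<bar> * ?w (h x) * indicator Y x"
        using x Y(2) by (cases "x \<in> X"; cases "x \<in> Y") auto
    qed
    also have "\<dots> = (\<integral>\<^sup>+y\<in>h ` Y. ?w y \<partial>lebesgue)"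
    proof (rule nn_integral_change_of_variables[OF Y(1)])
      show "(h has_derivative (*v) (H x)) (at x within Y)" if "x \<in> Y" for x
        using has_derivative_subset[OF H(1) Y(2)] that Y(2) by blast
      show "inj_on h Y"
      proof (rule inj_onI)
        fix x y assume x: "x \<in> Y" and y: "y \<in> Y" and eq: "h x = h y"
        from x obtain p where p: "p \<in> A i" "x = chart_map (c i) p" unfolding Y_def by (rule imageE)
        from y obtain q where q: "q \<in> A i" "y = chart_map (c i) q" unfolding Y_def by (rule imageE)
        have pq: "p \<in> D i" "q \<in> D i" using p q Ab(3) by auto
        have "chart_map (d i) (\<phi> p) = chart_map (d i) (\<phi> q)" using eq p q hp[OF pq(1)] hp[OF pq(2)] by simp
        then have "\<phi> p = \<phi> q" using inj_onD[OF N.chart_inj[OF P(3)[OF i]]] \<phi>d pq by blast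
        moreover have "p \<in> points M - Q" "q \<in> points M - Q" using p q Dp[OF i] by (auto simp: A_def)
        ultimately have "p = q" using inj_onD[OF inj] by blast
        then show "x = y" using p q by simp
      qed
      show "?w \<in> borel_measurable borel" by (rule N.dens_measurable[OF P(3)[OF i]])
    qed
    also have "\<dots> = (\<integral>\<^sup>+y\<in>h ` Y. ennreal (sqrt (det (gram N (d i) y))) \<partial>lebesgue)"
      using himg Y(2) by (intro nn_integral_cong) (auto simp: indicator_def)
    finally have int: "(\<integral>\<^sup>+p\<in>D i. ?J p \<partial>M.\<mu>) = (\<integral>\<^sup>+y\<in>h ` Y. ennreal (sqrt (det (gram N (d i) y))) \<partial>lebesgue)" .
    have hY: "h ` Y = chart_map (d i) ` \<phi> ` A i"
      unfolding Y_def image_image using Ab(3) hp by (intro image_cong) auto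
    have "h differentiable_on Y"
      unfolding differentiable_on_def differentiable_def using has_derivative_subset[OF H(1) Y(2)] Y(2) by blast
    then have hYl: "h ` Y \<in> sets lebesgue" using Y(1) by (intro differentiable_image_in_sets_lebesgue) auto
    have hYs: "h ` Y \<subseteq> img (d i)" using himg Y(2) by blast
    have "chart_inv (d i) ` h ` Y = \<phi> ` A i"
      unfolding hY using Ab(3) \<phi>d by (intro N.chart_inv_map_image[OF P(3)[OF i]]) auto
    then show ?thesis using N.completion_chart_inv[OF P(3)[OF i] hYl hYs] int by simp
  qed
  have "(\<integral>\<^sup>+p. ?J p \<partial>M.\<mu>) = (\<Sum>i<n. \<integral>\<^sup>+p\<in>D i. ?J p \<partial>M.\<mu>)"
    using P(9) by (intro M.nn_integral_partition_ae[OF P(1,4,8) _ Jm]) auto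
  also have "\<dots> = (\<Sum>i<n. emeasure (completion N.\<mu>) (\<phi> ` A i))"
    using main by (intro sum.cong) auto
  also have "\<dots> = emeasure (completion N.\<mu>) (\<Union>i<n. \<phi> ` A i)"
  proof (rule sum_emeasure)
    show "disjoint_family_on (\<lambda>i. \<phi> ` A i) {..<n}"
      unfolding disjoint_family_on_def
    proof (intro ballI impI)
      fix i j assume ij: "i \<in> {..<n}" "j \<in> {..<n}" "i \<noteq> j"
      have "A i \<inter> A j = {}" using P(8) ij by (auto simp: disjoint_family_on_def A_def)
      moreover have "A i \<subseteq> points M - Q" "A j \<subseteq> points M - Q" using Dp ij by (auto simp: A_def)
      ultimately show "\<phi> ` A i \<inter> \<phi> ` A j = {}" using inj_on_image_Int[OF inj, of "A i" "A j"] by simp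
    qed
  qed (use main in auto)
  also have "\<dots> = emeasure (completion N.\<mu>) (\<phi> ` points M)"
  proof -
    have im: "\<phi> ` points M \<in> sets (completion N.\<mu>)"
      using image_points_borel(2)[OF cont] by (intro sets_completionI_sets) simp
    have U: "(\<Union>i<n. \<phi> ` A i) \<in> sets (completion N.\<mu>)" using main by (intro sets.finite_UN) auto
    have sub: "(\<Union>i<n. \<phi> ` A i) \<subseteq> \<phi> ` points M" using Dp by (auto simp: A_def)
    \<comment> \<open>Image points not reached from the pieces \<open>A i\<close> come either from
      the points discarded for lack of differentiability, whose image is null by condition (N), or
      from \<open>Q\<close>, which maps into \<open>B\<close>.\<close>
    have "\<phi> ` (Z \<inter> points M) \<union> B \<in> null_sets (completion N.\<mu>)"
    proof (rule null_sets.Un)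
      have "Z \<inter> points M \<in> null_sets (completion M.\<mu>)" using P(1) by (auto simp: null_sets_completion_iff2)
      then show "\<phi> ` (Z \<inter> points M) \<in> null_sets (completion N.\<mu>)" by (rule lipschitz_image_null[OF lip])
      show "B \<in> null_sets (completion N.\<mu>)" using B(1) by (rule null_sets_completionI)
    qed
    moreover have "\<phi> ` points M - (\<Union>i<n. \<phi> ` A i) \<subseteq> \<phi> ` (Z \<inter> points M) \<union> B"
    proof
      fix q assume q: "q \<in> \<phi> ` points M - (\<Union>i<n. \<phi> ` A i)"
      then obtain p where p: "p \<in> points M" "q = \<phi> p" by blast
      show "q \<in> \<phi> ` (Z \<inter> points M) \<union> B"
      proof (cases "p \<in> Z \<or> p \<in> Q")
        case True then show ?thesis using p by (auto simp: Q_def)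
      next
        case False
        then obtain i where "i < n" "p \<in> D i" using p(1) P(9) by blast
        then have "p \<in> A i" using False by (simp add: A_def)
        then show ?thesis using q p \<open>i < n\<close> by blast
      qed
    qed
    ultimately have null: "\<phi> ` points M - (\<Union>i<n. \<phi> ` A i) \<in> null_sets (completion N.\<mu>)"
      by (rule null_sets_completion_subset[rotated])
    have "(\<Union>i<n. \<phi> ` A i) \<union> (\<phi> ` points M - (\<Union>i<n. \<phi> ` A i)) = \<phi> ` points M" using sub by blast
    with emeasure_Un_null_set[OF U null] show ?thesis by (simp only:)
  qed
  also have "\<dots> = emeasure N.\<mu> (\<phi> ` points M)"
    using image_points_borel(2)[OF cont] by simp
  finally show ?thesis .
qed

end

end

section \<open>The energy inequality\<close>

text \<open>The Jacobian term stands on the side of the energy, with \<open>m\<close> added to the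
  constant. All quantities are then nonnegative and can be integrated without subtraction. In the
  equality case each of the two supporting-line estimates must be tight, also for
  \<open>m = 0\<close>.\<close>

lemma pair_energy_support:
  fixes g :: "real \<Rightarrow> real"
  assumes m: "0 \<le> m" "\<And>x. g v - m * (x - v) \<le> g x" "\<And>x. g x = g v - m * (x - v) \<Longrightarrow> x = v"
    and s: "0 < s" and v: "v = ln s / 2" and ab: "0 < a" "0 < b"
  shows "2 * g v + m \<le> g (ln a) + g (ln b) + m / s * (a * b)"
    and "g (ln a) + g (ln b) + m / s * (a * b) = 2 * g v + m \<Longrightarrow> a = sqrt s \<and> b = sqrt s"
proof -
  have "ln (a * b / s) = ln a + ln b - 2 * v"
    using ab s by (simp add: ln_div ln_mult_pos v)
  then have "(ln a - v) + (ln b - v) \<le> a * b / s - 1"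
    using ln_le_minus_one[of "a * b / s"] ab s by simp
  from mult_left_mono[OF this m(1)]
  have 1: "m * (ln a - v) + m * (ln b - v) \<le> m / s * (a * b) - m" by (simp add: algebra_simps)
  show "2 * g v + m \<le> g (ln a) + g (ln b) + m / s * (a * b)"
    using 1 m(2)[of "ln a"] m(2)[of "ln b"] by linarith
  assume "g (ln a) + g (ln b) + m / s * (a * b) = 2 * g v + m"
  then have "g (ln a) = g v - m * (ln a - v)" "g (ln b) = g v - m * (ln b - v)"
    using 1 m(2)[of "ln a"] m(2)[of "ln b"] by linarith+
  then have "ln a = ln (sqrt s)" "ln b = ln (sqrt s)" using m(3) s by (auto simp: v ln_sqrt)
  then show "a = sqrt s \<and> b = sqrt s" using ab s by (metis exp_ln real_sqrt_gt_zero)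
qed

text \<open>The constant and the total mass are finite, so subtracting \<open>c\<close> is
  legitimate; the difference is nonnegative with integral zero.\<close>

lemma nn_integral_eq_imp_AE_eq:
  assumes f: "f \<in> borel_measurable M" and le: "AE x in M. c \<le> f x" and c: "c \<noteq> \<infinity>"
    and fin: "emeasure M (space M) \<noteq> \<infinity>" and eq: "(\<integral>\<^sup>+x. f x \<partial>M) = c * emeasure M (space M)"
  shows "AE x in M. f x = c"
proof -
  have "(\<integral>\<^sup>+x. f x - c \<partial>M) = (\<integral>\<^sup>+x. f x \<partial>M) - (\<integral>\<^sup>+x. c \<partial>M)"
    using f le c fin by (intro nn_integral_diff) (auto simp: ennreal_mult_eq_top_iff)
  also have "\<dots> = 0"
    using c fin by (simp add: eq) (intro diff_eq_0_ennreal, auto simp: ennreal_mult_less_top top.not_eq_extremum)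
  finally have "(\<integral>\<^sup>+x. f x - c \<partial>M) = 0" .
  then have "AE x in M. f x - c = 0" using f by (subst (asm) nn_integral_0_iff_AE) auto
  then show ?thesis
    using le by eventually_elim (metis antisym c diff_eq_0_iff_ennreal infinity_ennreal_def less_top_ennreal top.not_eq_extremum)
qed

context surface_pair
begin

abbreviation energy_density :: "(real \<Rightarrow> real) \<Rightarrow> ('a \<Rightarrow> 'b) \<Rightarrow> 'a \<Rightarrow> ennreal" where
  "energy_density f \<phi> p \<equiv> extend_at_0 f (fst (singular_values M N \<phi> p)) + extend_at_0 f (snd (singular_values M N \<phi> p))"

lemma singular_values_props:
  assumes "p \<in> points M" "\<phi> p \<in> points N"
  shows "0 \<le> snd (singular_values M N \<phi> p)" "snd (singular_values M N \<phi> p) \<le> fst (singular_values M N \<phi> p)"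
    "fst (singular_values M N \<phi> p) * snd (singular_values M N \<phi> p) = \<bar>jacobian M N \<phi> p\<bar>"
    "(fst (singular_values M N \<phi> p))\<^sup>2 + (snd (singular_values M N \<phi> p))\<^sup>2 = trace2 (adjoint_diff_matrix M N \<phi> p)"
  using sv_pair_props[OF adjoint_props(3)[of p \<phi>, OF assms], of "(jacobian M N \<phi> p)\<^sup>2"] adjoint_props(2)[of p \<phi>, OF assms]
  unfolding adjoint_props(4)[of p \<phi>, OF assms] adjoint_props(1)[of p \<phi>, OF assms] by auto

text \<open>If both singular values are \<open>r\<close>, the trace is \<open>2 * r\<^sup>2\<close>
  and the discriminant vanishes, so \<open>adjoint_disc_eq_0\<close> applies; conversely the adjoint
  matrix is \<open>r\<^sup>2\<close> times the identity.\<close>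

lemma conformal_iff:
  assumes p: "p \<in> points M" "\<phi> p \<in> points N" and r: "0 < r"
  shows "transpose (diff_matrix M N \<phi> p) ** gram_at N (\<phi> p) ** diff_matrix M N \<phi> p = r\<^sup>2 *\<^sub>R gram_at M p
    \<longleftrightarrow> singular_values M N \<phi> p = (r, r)"
proof
  note pd = M.gram_at_posdef[OF p(1)] N.gram_at_posdef[OF p(2)]
  {
    assume "transpose (diff_matrix M N \<phi> p) ** gram_at N (\<phi> p) ** diff_matrix M N \<phi> p = r\<^sup>2 *\<^sub>R gram_at M p"
    then have "adjoint_diff_matrix M N \<phi> p = r\<^sup>2 *\<^sub>R (matrix_inv (gram_at M p) ** gram_at M p)"
      by (simp add: adjoint_diff_matrix_def) (simp add: vec_eq_iff matrix_matrix_mult_def sum_distrib_left ac_simps)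
    then have K: "adjoint_diff_matrix M N \<phi> p = r\<^sup>2 *\<^sub>R mat 1"
      using matrix_inv_mult(1)[OF posdef_invertible[OF pd(1)]] by simp
    have t: "trace2 (adjoint_diff_matrix M N \<phi> p) = 2 * r\<^sup>2" by (simp add: K trace2_def mat_def)
    have d: "(jacobian M N \<phi> p)\<^sup>2 = r\<^sup>2 * r\<^sup>2"
      unfolding adjoint_props(1)[of p \<phi>, OF p, symmetric] by (simp add: K det_2 mat_def)
    show "singular_values M N \<phi> p = (r, r)"
      unfolding adjoint_props(4)[of p \<phi>, OF p] t d using r by (simp add: sv_pair_def power2_eq_square)
  }
  assume s: "singular_values M N \<phi> p = (r, r)"
  have t: "trace2 (adjoint_diff_matrix M N \<phi> p) = 2 * r\<^sup>2"
    using singular_values_props(4)[of p \<phi>, OF p] by (simp add: s)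
  have "\<bar>jacobian M N \<phi> p\<bar> = r * r" using singular_values_props(3)[of p \<phi>, OF p] by (simp add: s)
  then have "(jacobian M N \<phi> p)\<^sup>2 = (r * r)\<^sup>2" by (metis power2_abs)
  then have "4 * det (adjoint_diff_matrix M N \<phi> p) = (trace2 (adjoint_diff_matrix M N \<phi> p))\<^sup>2"
    unfolding t adjoint_props(1)[of p \<phi>, OF p] by (simp add: power2_eq_square)
  from adjoint_disc_eq_0[OF pd this[unfolded adjoint_diff_matrix_def]]
  show "transpose (diff_matrix M N \<phi> p) ** gram_at N (\<phi> p) ** diff_matrix M N \<phi> p = r\<^sup>2 *\<^sub>R gram_at M p"
    using t[unfolded adjoint_diff_matrix_def] by simp
qed

lemma area_image:
  assumes "lipschitz_map M N \<phi>" "AE p in M.\<mu>. differentiable_at_point M N \<phi> p"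
    "AE q in N.\<mu>. \<exists>\<^sub>\<le>\<^sub>1 p. p \<in> points M \<and> \<phi> p = q"
  shows "(\<integral>\<^sup>+p. ennreal \<bar>jacobian M N \<phi> p\<bar> \<partial>M.\<mu>) = ennreal (area N (\<phi> ` points M))"
  using area_formula[OF assms] by (simp add: N.area.emeasure_eq_measure)

lemma area_image_le: "area N (\<phi> ` points M) \<le> area N (points N)" if "lipschitz_map M N \<phi>"
  using that by (intro N.area.finite_measure_mono) (auto simp: lipschitz_map_def intro: sets.top[of N.\<mu>, simplified])

lemma energy_eq_iff:
  assumes "0 \<le> a"
  shows "energy f M N \<phi> = ennreal a \<longleftrightarrow> (\<integral>\<^sup>+p. energy_density f \<phi> p \<partial>M.\<mu>) = ennreal (a * area M (points M))"
    and "ennreal a \<le> energy f M N \<phi> \<longleftrightarrow> ennreal (a * area M (points M)) \<le> (\<integral>\<^sup>+p. energy_density f \<phi> p \<partial>M.\<mu>)"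
proof -
  define V where "V = area M (points M)"
  have V: "0 < V" using M.area_pos by (simp add: V_def)
  define I where "I = (\<integral>\<^sup>+p. energy_density f \<phi> p \<partial>M.\<mu>)"
  have E: "energy f M N \<phi> = I / ennreal V" by (simp add: energy_def I_def V_def)
  show "energy f M N \<phi> = ennreal a \<longleftrightarrow> I = ennreal (a * V)"
    unfolding E using V assms by (cases I) (auto simp: divide_ennreal ennreal_top_divide field_simps)
  show "ennreal a \<le> energy f M N \<phi> \<longleftrightarrow> ennreal (a * V) \<le> I"
    unfolding E using V assms by (cases I) (auto simp: divide_ennreal ennreal_top_divide field_simps)
qed

context
  fixes g f :: "real \<Rightarrow> real"
  assumes cont: "continuous_on UNIV g" and nonneg: "\<And>t. 0 \<le> g t" and g0: "g 0 = 0"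
    and anti: "strict_antimono_on {..0} g" and conv: "strictly_convex_on {..0} g"
    and mono: "strict_mono_on {0..} g" and f_ln: "\<forall>x>0. f x = g (ln x)"
begin

lemma f_eq: "0 < x \<Longrightarrow> f x = g (ln x)"
  using f_ln by blast

lemma energy_density_measurable:
  assumes lip: "lipschitz_map M N \<phi>" and diff: "AE p in M.\<mu>. differentiable_at_point M N \<phi> p"
  shows "energy_density f \<phi> \<in> borel_measurable (completion M.\<mu>)"
proof -
  have [measurable]: "g \<in> borel_measurable borel" using cont by (rule borel_measurable_continuous_onI)
  have "extend_at_0 f = (\<lambda>x. if 0 < x then ennreal (g (ln x)) else \<infinity>)"
    by (intro ext) (simp add: extend_at_0_def f_eq)
  then have [measurable]: "extend_at_0 f \<in> borel_measurable borel" by simp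
  note [measurable] = jacobian_measurable[OF lip diff] trace_measurable[OF lip diff]
  \<comment> \<open>Replaces the definite description by the closed form in trace and Jacobian,
    whose measurability is known.\<close>
  define e where "e p = (let \<sigma> = sv_pair (trace2 (adjoint_diff_matrix M N \<phi> p)) ((jacobian M N \<phi> p)\<^sup>2)
      in extend_at_0 f (fst \<sigma>) + extend_at_0 f (snd \<sigma>))" for p
  have "e \<in> borel_measurable (completion M.\<mu>)"
    unfolding e_def Let_def sv_pair_def fst_conv snd_conv by measurable
  moreover have "energy_density f \<phi> p = e p" if "p \<in> space (completion M.\<mu>)" for p
  proof -
    have "p \<in> points M" "\<phi> p \<in> points N" using that lip by (auto simp: lipschitz_map_def)
    from adjoint_props(4)[of p \<phi>, OF this] show ?thesis by (simp add: e_def Let_def)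
  qed
  ultimately show ?thesis by (subst measurable_cong)
qed

text \<open>Assumes unique preimages almost everywhere instead of membership in
  \<open>Lip_inj_plus\<close>, so that it covers the injective homotheties of the second claim,
  whatever their orientation. The area formula identifies \<open>r\<^sup>2\<close> with the ratio of
  the areas.\<close>

lemma homothety_energy:
  assumes hom: "homothety M N \<phi>" and mult: "AE q in N.\<mu>. \<exists>\<^sub>\<le>\<^sub>1 p. p \<in> points M \<and> \<phi> p = q"
    and le: "area N (points N) \<le> area M (points M)"
  shows "0 < area N (\<phi> ` points M)"
    "energy f M N \<phi> = ennreal (min_pair_energy f (area N (\<phi> ` points M) / area M (points M)))"
proof -
  define V where "V = area M (points M)"
  have V: "0 < V" using M.area_pos by (simp add: V_def)
  obtain r where r: "r > 0" and lip: "lipschitz_map M N \<phi>"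
    and ae: "AE p in M.\<mu>. differentiable_at_point M N \<phi> p \<and>
      transpose (diff_matrix M N \<phi> p) ** gram_at N (\<phi> p) ** diff_matrix M N \<phi> p = r\<^sup>2 *\<^sub>R gram_at M p"
    using hom unfolding homothety_def by blast
  have diff: "AE p in M.\<mu>. differentiable_at_point M N \<phi> p" using ae by eventually_elim blast
  have \<phi>N: "\<phi> p \<in> points N" if "p \<in> points M" for p using lip that by (auto simp: lipschitz_map_def)
  have sv: "AE p in M.\<mu>. p \<in> points M \<and> singular_values M N \<phi> p = (r, r)"
    using ae AE_space by eventually_elim (use conformal_iff[OF _ _ r] \<phi>N in auto)
  have "(\<integral>\<^sup>+p. ennreal \<bar>jacobian M N \<phi> p\<bar> \<partial>M.\<mu>) = (\<integral>\<^sup>+p. ennreal (r * r) \<partial>M.\<mu>)"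
  proof (rule nn_integral_cong_AE)
    show "AE p in M.\<mu>. ennreal \<bar>jacobian M N \<phi> p\<bar> = ennreal (r * r)"
      using sv by eventually_elim (use singular_values_props(3) \<phi>N in fastforce)
  qed
  then have "ennreal (area N (\<phi> ` points M)) = ennreal (r * r * V)"
    unfolding area_image[OF lip diff mult]
    using r V by (simp add: M.area.emeasure_eq_measure V_def ennreal_mult')
  then have A: "area N (\<phi> ` points M) = r * r * V" using r V by (subst (asm) ennreal_inj) auto
  then show "0 < area N (\<phi> ` points M)" using r V by simp
  have s: "area N (\<phi> ` points M) / V = r * r" using A V by simp
  \<comment> \<open>The image fits into \<open>N\<close>, whose area is at most that of
    \<open>M\<close>; this puts the ratio into the range where \<open>min_pair_energy_eq\<close>
    applies.\<close>
  have "r * r * V \<le> V" using A area_image_le[OF lip] le by (simp add: V_def)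
  then have s1: "r * r \<le> 1" using V by simp
  have "(\<integral>\<^sup>+p. energy_density f \<phi> p \<partial>M.\<mu>) = (\<integral>\<^sup>+p. ennreal (2 * f r) \<partial>M.\<mu>)"
  proof (rule nn_integral_cong_AE)
    show "AE p in M.\<mu>. energy_density f \<phi> p = ennreal (2 * f r)"
      using sv by eventually_elim (use r nonneg f_eq[OF r] in \<open>simp add: extend_at_0_def flip: ennreal_plus\<close>)
  qed
  also have "\<dots> = ennreal (2 * f r * V)"
    using r V nonneg f_eq[OF r] by (simp add: M.area.emeasure_eq_measure V_def ennreal_mult')
  finally have "energy f M N \<phi> = ennreal (2 * f r)"
    using r nonneg f_eq[OF r] by (subst energy_eq_iff(1)) (auto simp: V_def)
  moreover have "min_pair_energy f (r * r) = 2 * f r"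
  proof -
    have "ln (r * r) / 2 = ln r" using r by (simp add: ln_mult_pos)
    then show ?thesis
      using min_pair_energy_eq[OF nonneg g0 anti conv mono f_eq, of "r * r"] r s1 f_eq[OF r] by simp
  qed
  ultimately show "energy f M N \<phi> = ennreal (min_pair_energy f (area N (\<phi> ` points M) / area M (points M)))"
    using s by (simp add: V_def)
qed

text \<open>Integrates \<open>pair_energy_support\<close>. Equality of the integrals upgrades to
  equality almost everywhere, hence to singular values \<open>sqrt s\<close>, which by
  \<open>conformal_iff\<close> is a homothety of ratio \<open>sqrt s\<close>.\<close>

lemma energy_bound:
  assumes \<phi>: "\<phi> \<in> Lip_inj_plus M N" and pos: "0 < area N (\<phi> ` points M)"
    and le: "area N (points N) \<le> area M (points M)"
  defines "s \<equiv> area N (\<phi> ` points M) / area M (points M)"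
  shows "ennreal (min_pair_energy f s) \<le> energy f M N \<phi>"
    and "energy f M N \<phi> = ennreal (min_pair_energy f s) \<longleftrightarrow> homothety M N \<phi>"
proof -
  define V where "V = area M (points M)"
  have V: "0 < V" using M.area_pos by (simp add: V_def)
  have lip: "lipschitz_map M N \<phi>" and ae: "AE p in M.\<mu>. differentiable_at_point M N \<phi> p \<and> 0 \<le> jacobian M N \<phi> p"
    and mult: "AE q in N.\<mu>. \<exists>\<^sub>\<le>\<^sub>1 p. p \<in> points M \<and> \<phi> p = q"
    using \<phi> by (auto simp: Lip_inj_plus_def)
  have diff: "AE p in M.\<mu>. differentiable_at_point M N \<phi> p" using ae by eventually_elim blast
  have \<phi>N: "\<phi> p \<in> points N" if "p \<in> points M" for p using lip that by (auto simp: lipschitz_map_def)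
  have s: "0 < s" "s \<le> 1" "area N (\<phi> ` points M) = s * V"
    using pos V area_image_le[OF lip] le by (auto simp: s_def V_def)
  define v where "v = ln s / 2"
  have "v \<le> 0" using s by (simp add: v_def)
  from convex_decreasing_support[OF nonneg g0 anti conv mono this]
  obtain m where m: "0 \<le> m" "\<And>x. g v - m * (x - v) \<le> g x" "\<And>x. g x = g v - m * (x - v) \<Longrightarrow> x = v" by auto
  have F: "min_pair_energy f s = 2 * g v"
    unfolding v_def by (rule min_pair_energy_eq[OF nonneg g0 anti conv mono f_eq s(1,2)])
  let ?e = "energy_density f \<phi>"
  let ?w = "\<lambda>p. ?e p + ennreal (m / s) * ennreal \<bar>jacobian M N \<phi> p\<bar>"
  let ?k = "2 * g v + m"
  have em: "?e \<in> borel_measurable (completion M.\<mu>)" by (rule energy_density_measurable[OF lip diff])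
  have jm: "(\<lambda>p. ennreal \<bar>jacobian M N \<phi> p\<bar>) \<in> borel_measurable (completion M.\<mu>)"
    using jacobian_measurable[OF lip diff] by measurable
  have wm: "?w \<in> borel_measurable (completion M.\<mu>)"
    by (rule borel_measurable_add[OF em borel_measurable_times_ennreal[OF borel_measurable_const jm]])
  have point: "ennreal ?k \<le> ?w p \<and> (?w p = ennreal ?k \<longrightarrow> singular_values M N \<phi> p = (sqrt s, sqrt s))"
    if p: "p \<in> points M" for p
  proof -
    define a b where "a = fst (singular_values M N \<phi> p)" and "b = snd (singular_values M N \<phi> p)"
    have ab: "0 \<le> b" "b \<le> a" "a * b = \<bar>jacobian M N \<phi> p\<bar>"
      using singular_values_props[of p \<phi>, OF p \<phi>N[OF p]] by (simp_all add: a_def b_def)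
    show ?thesis
    proof (cases "b = 0")
      case True
      \<comment> \<open>Where the differential is degenerate the energy density is infinite: the
        bound is trivial and equality is impossible.\<close>
      then have w: "?w p = \<infinity>" by (simp add: extend_at_0_def flip: b_def)
      show ?thesis unfolding w by simp
    next
      case False
      then have pos': "0 < a" "0 < b" using ab by auto
      have w: "?w p = ennreal (g (ln a) + g (ln b) + m / s * (a * b))"
        using pos' nonneg m(1) s(1) unfolding ab(3)[symmetric]
        by (simp add: extend_at_0_def f_eq flip: a_def b_def)
           (simp add: ennreal_mult'[symmetric] flip: ennreal_plus)
      note sup = pair_energy_support[OF m s(1) v_def pos']
      have "singular_values M N \<phi> p = (sqrt s, sqrt s)" if "?w p = ennreal ?k"
      proof -
        have "g (ln a) + g (ln b) + m / s * (a * b) = ?k"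
          using that nonneg m(1) s(1) pos' unfolding w by (subst (asm) ennreal_inj) auto
        then show ?thesis using sup(2) by (simp add: a_def b_def prod_eq_iff)
      qed
      then show ?thesis using sup(1) unfolding w by (auto intro: ennreal_leI)
    qed
  qed
  \<comment> \<open>The Jacobian has integral \<open>s * V\<close> by the area formula, so the added
    term contributes exactly the finite amount \<open>m * V\<close>, which can be cancelled.\<close>
  have intw: "(\<integral>\<^sup>+p. ?w p \<partial>completion M.\<mu>) = (\<integral>\<^sup>+p. ?e p \<partial>M.\<mu>) + ennreal (m * V)"
  proof -
    have "(\<integral>\<^sup>+p. ?w p \<partial>completion M.\<mu>) = (\<integral>\<^sup>+p. ?e p \<partial>completion M.\<mu>) + (\<integral>\<^sup>+p. ennreal (m / s) * ennreal \<bar>jacobian M N \<phi> p\<bar> \<partial>completion M.\<mu>)"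
      by (rule nn_integral_add[OF em borel_measurable_times_ennreal[OF borel_measurable_const jm]])
    also have "(\<integral>\<^sup>+p. ennreal (m / s) * ennreal \<bar>jacobian M N \<phi> p\<bar> \<partial>completion M.\<mu>) = ennreal (m / s) * ennreal (s * V)"
      by (subst nn_integral_cmult[OF jm]) (simp only: nn_integral_completion area_image[OF lip diff mult] s(3))
    also have "\<dots> = ennreal (m * V)" using s(1) m(1) V by (simp add: ennreal_mult'[symmetric])
    finally show ?thesis by (simp only: nn_integral_completion)
  qed
  have sp: "emeasure (completion M.\<mu>) (space (completion M.\<mu>)) = ennreal V"
    by (simp add: M.area.emeasure_eq_measure V_def sets.top[of M.\<mu>, simplified])
  have "ennreal (?k * V) = (\<integral>\<^sup>+p. ennreal ?k \<partial>completion M.\<mu>)"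
    using sp nonneg m(1) by (simp add: ennreal_mult')
  also have "\<dots> \<le> (\<integral>\<^sup>+p. ?w p \<partial>completion M.\<mu>)"
    using point by (intro nn_integral_mono) simp
  finally have "ennreal (?k * V) \<le> (\<integral>\<^sup>+p. ?e p \<partial>M.\<mu>) + ennreal (m * V)" unfolding intw .
  then have "ennreal (2 * g v * V) \<le> (\<integral>\<^sup>+p. ?e p \<partial>M.\<mu>)"
    using nonneg[of v] m(1) V
    by (cases "\<integral>\<^sup>+p. ?e p \<partial>M.\<mu>") (auto simp: algebra_simps simp flip: ennreal_plus)
  then show "ennreal (min_pair_energy f s) \<le> energy f M N \<phi>"
    using nonneg[of v] by (subst energy_eq_iff(2)) (auto simp: F V_def)
  show "energy f M N \<phi> = ennreal (min_pair_energy f s) \<longleftrightarrow> homothety M N \<phi>"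
  proof
    assume "homothety M N \<phi>"
    then show "energy f M N \<phi> = ennreal (min_pair_energy f s)"
      unfolding s_def by (rule homothety_energy(2)[OF _ mult le])
  next
    assume "energy f M N \<phi> = ennreal (min_pair_energy f s)"
    then have "(\<integral>\<^sup>+p. ?e p \<partial>M.\<mu>) = ennreal (2 * g v * V)"
      using nonneg[of v] unfolding F by (subst (asm) energy_eq_iff(1)) (auto simp: V_def)
    then have "(\<integral>\<^sup>+p. ?w p \<partial>completion M.\<mu>) = ennreal ?k * emeasure (completion M.\<mu>) (space (completion M.\<mu>))"
      using nonneg[of v] m(1) V unfolding intw sp
      by (simp add: algebra_simps flip: ennreal_plus ennreal_mult')
    then have "AE p in completion M.\<mu>. ?w p = ennreal ?k"
      using point wm sp by (intro nn_integral_eq_imp_AE_eq) auto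
    then have "AE p in M.\<mu>. ?w p = ennreal ?k" by (simp only: AE_completion_iff)
    with diff AE_space have "AE p in M.\<mu>. differentiable_at_point M N \<phi> p \<and>
        transpose (diff_matrix M N \<phi> p) ** gram_at N (\<phi> p) ** diff_matrix M N \<phi> p = (sqrt s)\<^sup>2 *\<^sub>R gram_at M p"
    proof eventually_elim
      case (elim p)
      then have "p \<in> points M" by simp
      moreover from this have "singular_values M N \<phi> p = (sqrt s, sqrt s)" using point elim by blast
      ultimately show ?case using conformal_iff[where p=p and \<phi>=\<phi> and r="sqrt s"] \<phi>N elim s(1) by simp
    qed
    then show "homothety M N \<phi>" unfolding homothety_def using lip s(1) by (intro conjI exI[of _ "sqrt s"]) auto
  qed
qed

text \<open>By the area formula the Jacobian vanishes almost everywhere, so one singular value is 0,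
  where the extended \<open>f\<close> is infinite.\<close>

lemma energy_degenerate:
  assumes \<phi>: "\<phi> \<in> Lip_inj_plus M N" and zero: "area N (\<phi> ` points M) = 0"
  shows "energy f M N \<phi> = \<infinity>"
proof -
  have lip: "lipschitz_map M N \<phi>" and ae: "AE p in M.\<mu>. differentiable_at_point M N \<phi> p \<and> 0 \<le> jacobian M N \<phi> p"
    and mult: "AE q in N.\<mu>. \<exists>\<^sub>\<le>\<^sub>1 p. p \<in> points M \<and> \<phi> p = q"
    using \<phi> by (auto simp: Lip_inj_plus_def)
  have diff: "AE p in M.\<mu>. differentiable_at_point M N \<phi> p" using ae by eventually_elim blast
  have \<phi>N: "\<phi> p \<in> points N" if "p \<in> points M" for p using lip that by (auto simp: lipschitz_map_def)
  have jm: "(\<lambda>p. ennreal \<bar>jacobian M N \<phi> p\<bar>) \<in> borel_measurable (completion M.\<mu>)"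
    using jacobian_measurable[OF lip diff] by measurable
  have "(\<integral>\<^sup>+p. ennreal \<bar>jacobian M N \<phi> p\<bar> \<partial>completion M.\<mu>) = 0"
    using area_image[OF lip diff mult] zero by (simp add: nn_integral_completion)
  then have "AE p in completion M.\<mu>. ennreal \<bar>jacobian M N \<phi> p\<bar> = 0"
    using jm by (simp add: nn_integral_0_iff_AE)
  then have "AE p in M.\<mu>. ennreal \<bar>jacobian M N \<phi> p\<bar> = 0" by (simp only: AE_completion_iff)
  with AE_space have "AE p in M.\<mu>. energy_density f \<phi> p = \<infinity>"
  proof eventually_elim
    case (elim p)
    then have p: "p \<in> points M" by simp
    have "fst (singular_values M N \<phi> p) * snd (singular_values M N \<phi> p) = 0"
      using singular_values_props(3)[of p \<phi>, OF p \<phi>N[OF p]] elim by simp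
    then show ?case by (auto simp: extend_at_0_def)
  qed
  then have "(\<integral>\<^sup>+p. energy_density f \<phi> p \<partial>M.\<mu>) = (\<integral>\<^sup>+p. \<infinity> \<partial>M.\<mu>)" by (rule nn_integral_cong_AE)
  also have "\<dots> = \<infinity>"
    using M.area_pos by (simp add: M.area.emeasure_eq_measure ennreal_top_mult)
  finally show ?thesis by (simp add: energy_def ennreal_top_divide)
qed

lemma min_pair_energy_strict_antimono:
  assumes "0 < s" "s < t" "t \<le> 1"
  shows "min_pair_energy f t < min_pair_energy f s"
proof -
  have "g (ln t / 2) < g (ln s / 2)" using assms by (intro monotone_onD[OF anti]) auto
  then show ?thesis
    using min_pair_energy_eq[OF nonneg g0 anti conv mono f_eq, of s] min_pair_energy_eq[OF nonneg g0 anti conv mono f_eq, of t] assms by simp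
qed

end

text \<open>The compact image is closed, so the part of \<open>N\<close> it misses is open; having
  area zero, it is empty by \<open>open_area_pos\<close>.\<close>

lemma surjective_of_full_area:
  assumes lip: "lipschitz_map M N \<phi>" and full: "area N (\<phi> ` points M) = area N (points N)"
  shows "\<phi> ` points M = points N"
proof (rule ccontr)
  assume ne: "\<phi> ` points M \<noteq> points N"
  note im = image_points_borel[OF lipschitz_continuous[OF lip]]
  have sub: "\<phi> ` points M \<subseteq> points N" using lip by (auto simp: lipschitz_map_def)
  have "openin (surf_top N) (points N - \<phi> ` points M)" using im(1) by (simp add: closedin_def)
  moreover have "points N - \<phi> ` points M \<noteq> {}" using ne sub by blast
  ultimately have "emeasure N.\<mu> (points N - \<phi> ` points M) \<noteq> 0" by (rule N.open_area_pos)
  moreover have "area N (points N - \<phi> ` points M) = 0"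
    using N.area.finite_measure_Diff[of "points N" "\<phi> ` points M"] im(2) sub full sets.top[of N.\<mu>] by simp
  ultimately show False by (simp add: N.area.emeasure_eq_measure)
qed

end

theorem theorem1p11:
  fixes g f :: "real \<Rightarrow> real"
    and M :: "'a surface" and N :: "'b surface"
  assumes "continuous_on UNIV g" and "\<And>t. 0 \<le> g t" and "g 0 = 0"
    and "strict_antimono_on {..0} g" and "strictly_convex_on {..0} g"
    and "strict_mono_on {0..} g"
    and "\<And>x. 0 < x \<Longrightarrow> f x = g (ln x)"
    and "compact_connected_riemannian_surface M"
    and "compact_connected_riemannian_surface N"
    and "area N (points N) \<le> area M (points M)"
  shows "(\<forall>\<phi>\<in>Lip_inj_plus M N. 0 < area N (\<phi> ` points M) \<longrightarrow>
            energy f M N \<phi> \<ge> ennreal (min_pair_energy f (area N (\<phi> ` points M) / area M (points M))) \<and>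
            (energy f M N \<phi> = ennreal (min_pair_energy f (area N (\<phi> ` points M) / area M (points M)))
              \<longleftrightarrow> homothety M N \<phi>))
       \<and> (\<forall>\<psi>. homothety M N \<psi> \<and> inj_on \<psi> (points M) \<longrightarrow>
            (\<forall>\<phi>\<in>Lip_inj_plus M N. area N (\<phi> ` points M) = area N (\<psi> ` points M) \<longrightarrow>
               energy f M N \<psi> \<le> energy f M N \<phi>))
       \<and> (\<forall>\<phi>\<in>Lip_inj_plus M N.
            energy f M N \<phi> \<ge> ennreal (min_pair_energy f (area N (points N) / area M (points M))) \<and>
            (energy f M N \<phi> = ennreal (min_pair_energy f (area N (points N) / area M (points M)))
              \<longleftrightarrow> homothety M N \<phi> \<and> \<phi> ` points M = points N))"
proof -
  interpret surface_pair M N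
    using assms(8,9) by (simp add: surface_pair_def riemannian_surface_def)
  have f_ln: "\<forall>x>0. f x = g (ln x)" using assms(7) by blast
  note g = assms(1-6) f_ln and le = assms(10)
  note bound = energy_bound(1)[OF g _ _ le] and eq = energy_bound(2)[OF g _ _ le]
  define V where "V = area M (points M)"
  define W where "W = area N (points N)"
  have V: "0 < V" "0 < W" "W \<le> V" using M.area_pos N.area_pos le by (auto simp: V_def W_def)
  let ?F = "min_pair_energy f"
  have first: "\<forall>\<phi>\<in>Lip_inj_plus M N. 0 < area N (\<phi> ` points M) \<longrightarrow>
      energy f M N \<phi> \<ge> ennreal (?F (area N (\<phi> ` points M) / area M (points M))) \<and>
      (energy f M N \<phi> = ennreal (?F (area N (\<phi> ` points M) / area M (points M))) \<longleftrightarrow> homothety M N \<phi>)"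
    using bound eq by blast
  have second: "energy f M N \<psi> \<le> energy f M N \<phi>"
    if \<psi>: "homothety M N \<psi>" "inj_on \<psi> (points M)" and \<phi>: "\<phi> \<in> Lip_inj_plus M N"
      and same: "area N (\<phi> ` points M) = area N (\<psi> ` points M)" for \<psi> \<phi>
  proof -
    have "\<exists>\<^sub>\<le>\<^sub>1 p. p \<in> points M \<and> \<psi> p = q" for q using \<psi>(2) by (auto simp: Uniq_def inj_on_def)
    then have "AE q in N.\<mu>. \<exists>\<^sub>\<le>\<^sub>1 p. p \<in> points M \<and> \<psi> p = q" by simp
    from homothety_energy[OF g \<psi>(1) this le] bound[OF \<phi>] same show ?thesis by simp
  qed
  have third: "energy f M N \<phi> \<ge> ennreal (?F (W / V)) \<and>
      (energy f M N \<phi> = ennreal (?F (W / V)) \<longleftrightarrow> homothety M N \<phi> \<and> \<phi> ` points M = points N)"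
    if \<phi>: "\<phi> \<in> Lip_inj_plus M N" for \<phi>
  proof (cases "area N (\<phi> ` points M) = 0")
    case True
    \<comment> \<open>The energy is infinite while the bound is finite, and the map cannot be onto
      because \<open>N\<close> has positive area.\<close>
    then show ?thesis using energy_degenerate[OF g \<phi>] V by (auto simp: W_def)
  next
    case False
    define A where "A = area N (\<phi> ` points M)"
    have lip: "lipschitz_map M N \<phi>" using \<phi> by (simp add: Lip_inj_plus_def)
    have A: "0 < A" "A \<le> W" using False area_image_le[OF lip] by (auto simp: A_def W_def less_le)
    have b: "ennreal (?F (A / V)) \<le> energy f M N \<phi>"
      and e: "energy f M N \<phi> = ennreal (?F (A / V)) \<longleftrightarrow> homothety M N \<phi>"
      using bound[OF \<phi>] eq[OF \<phi>] A(1) by (auto simp: A_def V_def)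
    show ?thesis
    proof (cases "A = W")
      case True
      then have "\<phi> ` points M = points N" using surjective_of_full_area[OF lip] by (simp add: A_def W_def)
      then show ?thesis using b e True by simp
    next
      case ne: False
      \<comment> \<open>A smaller image has strictly larger minimal energy, so equality is excluded;
        surjectivity is excluded too, since it would give \<open>A = W\<close>.\<close>
      then have "?F (W / V) < ?F (A / V)"
        using A V by (intro min_pair_energy_strict_antimono[OF g]) (auto simp: divide_strict_right_mono)
      \<comment> \<open>\<open>ennreal\<close> sends negative reals to 0; nonnegativity ensures that
        the strict inequality survives the embedding.\<close>
      moreover have "0 \<le> ?F (W / V)"
        using min_pair_energy_eq[OF g(2-6), of f "W / V"] assms(7) g(2) V by simp
      ultimately have "ennreal (?F (W / V)) < ennreal (?F (A / V))" by (simp add: ennreal_lessI)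
      with b have "ennreal (?F (W / V)) < energy f M N \<phi>" by (rule less_le_trans[rotated])
      moreover have "\<phi> ` points M \<noteq> points N" using ne by (auto simp: A_def W_def)
      ultimately show ?thesis by auto
    qed
  qed
  show ?thesis using first second third unfolding V_def W_def by blast
qed

end
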